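(* Let $n\ge 2$, let $\mathfrak{q}=\mathfrak{q}(n)$ be the queer Lie superalgebra with standard Cartan subalgebra $\mathfrak{h}=\mathfrak{h}_{\bar 0}\oplus\mathfrak{h}_{\bar 1}$, and let $A$ be a commutative associative unital $\mathbb{C}$-algebra. For any $\psi\in\mathcal{L}(\mathfrak{h}\otimes A)$ there exists a unique, up to isomorphism, irreducible finite-dimensional $\mathfrak{h}\otimes A$-module $H(\psi)$ such that $xv=\psi(x)v$ for all $x\in\mathfrak{h}_{\bar 0}\otimes A$ and $v\in H(\psi)$. Conversely, any irreducible finite-dimensional $\mathfrak{h}\otimes A$-module is isomorphic to $H(\psi)$ for some $\psi\in\mathcal{L}(\mathfrak{h}\otimes A)$. In other words, the map $$\mathcal{L}(\mathfrak{h}\otimes A)\to\mathcal{R}(\mathfrak{h}\otimes A),\qquad \psi\mapsto H(\psi),$$ is a bijection.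
   Context: Everything is over $\mathbb{C}$. Modules over a Lie superalgebra are $\mathbb{Z}_2$-graded, submodules are graded, and irreducible means nonzero with no proper nonzero graded submodule. A homomorphism of modules is a linear map $f$ with $f(xm)=xf(m)$ for all $x,m$; homomorphisms (in particular isomorphisms) are not required to be homogeneous with respect to the $\mathbb{Z}_2$-grading. Queer Lie superalgebra: let $\hat{\mathfrak{q}}(n)$ be the Lie superalgebra of block matrices $\begin{pmatrix}a&b\\ b&a\end{pmatrix}$ with $a,b$ complex $(n+1)\times(n+1)$ matrices; the even part is given by $b=0$, the odd part by $a=0$, and the bracket on homogeneous elements is $[x,y]=xy-(-1)^{|x||y|}yx$. Its derived subalgebra $\tilde{\mathfrak{q}}(n)$ consists of those matrices with $\operatorname{tr} b=0$, and $\mathfrak{q}(n)=\tilde{\mathfrak{q}}(n)/\mathbb{C}I_{2n+2}$. The standard Cartan subalgebra is $\mathfrak{h}=\mathfrak{h}_{\bar 0}\oplus\mathfrak{h}_{\bar 1}$, where $\mathfrak{h}_{\bar 0}$ is the image in $\mathfrak{q}(n)$ of the matrices with $a$ diagonal and traceless, $b=0$, and $\mathfrak{h}_{\bar 1}$ is the image of the matrices with $a=0$, $b$ diagonal and traceless. For a subalgebra $\mathfrak{s}\subseteq\mathfrak{q}$, the Lie superalgebra $\mathfrak{s}\otimes A$ has grading $(\mathfrak{s}\otimes A)_j=\mathfrak{s}_j\otimes A$ and bracket $[x_1\otimes f_1,x_2\otimes f_2]=[x_1,x_2]\otimes f_1f_2$. $\mathcal{L}(\mathfrak{h}\otimes A)$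 is the set of $\psi\in(\mathfrak{h}_{\bar 0}\otimes A)^*$ such that $\psi(\mathfrak{h}_{\bar 0}\otimes I)=0$ for some ideal $I\subseteq A$ of finite codimension. $\mathcal{R}(\mathfrak{h}\otimes A)$ is the set of isomorphism classes of irreducible finite-dimensional $\mathfrak{h}\otimes A$-modules. *)

theory Defs
  imports "HOL-Analysis.Analysis" "HOL-Library.Poly_Mapping" "HOL-Library.Z2"
begin

section \<open>Complex vector spaces and commutative algebras\<close>

class complex_vector = ab_group_add +
  fixes scaleC :: "complex \<Rightarrow> 'a \<Rightarrow> 'a"  (infixr \<open>*\<^sub>C\<close> 75)
  assumes scaleC_add_right: "c *\<^sub>C (x + y) = c *\<^sub>C x + c *\<^sub>C y"
    and scaleC_add_left: "(c + d) *\<^sub>C x = c *\<^sub>C x + d *\<^sub>C x"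
    and scaleC_scaleC: "c *\<^sub>C d *\<^sub>C x = (c * d) *\<^sub>C x"
    and scaleC_one: "1 *\<^sub>C x = x"

global_interpretation complex_vector:
  vector_space "scaleC :: complex \<Rightarrow> 'a \<Rightarrow> 'a::complex_vector"
  by unfold_locales (simp_all add: scaleC_add_right scaleC_add_left scaleC_scaleC scaleC_one)

abbreviation cspan :: "'a::complex_vector set \<Rightarrow> 'a set"
  where "cspan \<equiv> complex_vector.span"

abbreviation csubspace :: "'a::complex_vector set \<Rightarrow> bool"
  where "csubspace \<equiv> complex_vector.subspace"

text \<open>The sort is \<open>comm_ring + comm_monoid_mult\<close> rather than \<open>comm_ring_1\<close>, since the latter
  postulates \<open>0 \<noteq> 1\<close> and would exclude the zero algebra.\<close>

class complex_comm_algebra = complex_vector + comm_ring + comm_monoid_mult +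
  assumes scaleC_mult_left: "(c *\<^sub>C x) * y = c *\<^sub>C (x * y)"

lemma scaleC_mult_right: "x * (c *\<^sub>C y) = c *\<^sub>C (x * y :: 'a::complex_comm_algebra)"
  by (metis mult.commute scaleC_mult_left)

instantiation complex :: complex_comm_algebra
begin
definition scaleC_complex :: "complex \<Rightarrow> complex \<Rightarrow> complex"
  where "scaleC_complex c x = c * x"
instance by standard (simp_all add: scaleC_complex_def algebra_simps)
end

instantiation vec :: (complex_vector, finite) complex_vector
begin
definition scaleC_vec :: "complex \<Rightarrow> 'a ^ 'b \<Rightarrow> 'a ^ 'b"
  where "scaleC_vec c x = (\<chi> i. c *\<^sub>C (x $ i))"
instance
  by standard
    (simp_all add: scaleC_vec_def vec_eq_iff scaleC_add_right scaleC_add_left scaleC_scaleC scaleC_one)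
end

instantiation poly_mapping :: (type, complex_vector) complex_vector
begin
definition scaleC_poly_mapping :: "complex \<Rightarrow> ('a \<Rightarrow>\<^sub>0 'b) \<Rightarrow> 'a \<Rightarrow>\<^sub>0 'b"
  where "scaleC_poly_mapping c p = Poly_Mapping.map (scaleC c) p"
instance
  by standard
    (auto simp: scaleC_poly_mapping_def poly_mapping_eq_iff fun_eq_iff map.rep_eq lookup_add when_def
      scaleC_scaleC scaleC_one simp flip: scaleC_add_right scaleC_add_left)
end

lemma lookup_scaleC: "Poly_Mapping.lookup (c *\<^sub>C p) k = c *\<^sub>C Poly_Mapping.lookup p k"
  by (cases "Poly_Mapping.lookup p k = 0") (simp_all add: scaleC_poly_mapping_def map.rep_eq)

definition linear_on :: "'a::complex_vector set \<Rightarrow> ('a \<Rightarrow> 'b::complex_vector) \<Rightarrow> bool"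
  where "linear_on S f \<longleftrightarrow>
    (\<forall>x\<in>S. \<forall>y\<in>S. f (x + y) = f x + f y) \<and> (\<forall>c. \<forall>x\<in>S. f (c *\<^sub>C x) = c *\<^sub>C f x)"

text \<open>Closure under scalars is automatic, as the algebra is unital.\<close>

definition algebra_ideal :: "'a::complex_comm_algebra set \<Rightarrow> bool"
  where "algebra_ideal I \<longleftrightarrow>
    0 \<in> I \<and> (\<forall>f\<in>I. \<forall>g\<in>I. f + g \<in> I) \<and> (\<forall>f\<in>I. \<forall>g. g * f \<in> I)"

definition finite_codimension :: "'a::complex_vector set \<Rightarrow> bool"
  where "finite_codimension S \<longleftrightarrow> (\<exists>F. finite F \<and> cspan (S \<union> F) = UNIV)"

section \<open>Lie superalgebras and their modules\<close>

definition parity_sign :: "bit \<Rightarrow> bit \<Rightarrow> complex"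
  where "parity_sign i j = (if i = 1 \<and> j = 1 then - 1 else 1)"

record 'g lie_superalgebra =
  part :: "bit \<Rightarrow> 'g set"
  bracket :: "'g \<Rightarrow> 'g \<Rightarrow> 'g"

text \<open>The underlying spaces are graded subspaces of an ambient vector space, so that a single type
  can host modules of every finite dimension.\<close>

record ('g, 'v) supermodule =
  mpart :: "bit \<Rightarrow> 'v set"
  act :: "'g \<Rightarrow> 'v \<Rightarrow> 'v"

definition lspace :: "'g::complex_vector lie_superalgebra \<Rightarrow> 'g set"
  where "lspace g = {x + y | x y. x \<in> part g 0 \<and> y \<in> part g 1}"

definition mspace :: "('g, 'v::complex_vector) supermodule \<Rightarrow> 'v set"
  where "mspace M = {v + w | v w. v \<in> mpart M 0 \<and> w \<in> mpart M 1}"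

definition is_module ::
    "'g::complex_vector lie_superalgebra \<Rightarrow> ('g, 'v::complex_vector) supermodule \<Rightarrow> bool"
  where "is_module g M \<longleftrightarrow>
    csubspace (mpart M 0) \<and> csubspace (mpart M 1) \<and> mpart M 0 \<inter> mpart M 1 = {0} \<and>
    (\<forall>x\<in>lspace g. linear_on (mspace M) (act M x)) \<and>
    (\<forall>v\<in>mspace M. linear_on (lspace g) (\<lambda>x. act M x v)) \<and>
    (\<forall>i j. \<forall>x\<in>part g i. \<forall>v\<in>mpart M j. act M x v \<in> mpart M (i + j)) \<and>
    (\<forall>i j. \<forall>x\<in>part g i. \<forall>y\<in>part g j. \<forall>v\<in>mspace M.
      act M (bracket g x y) v =
        act M x (act M y v) - parity_sign i j *\<^sub>C act M y (act M x v))"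

definition graded_submodule ::
    "'g::complex_vector lie_superalgebra \<Rightarrow> ('g, 'v::complex_vector) supermodule \<Rightarrow> 'v set \<Rightarrow> bool"
  where "graded_submodule g M W \<longleftrightarrow>
    csubspace W \<and> W = {v + w | v w. v \<in> W \<inter> mpart M 0 \<and> w \<in> W \<inter> mpart M 1} \<and>
    (\<forall>x\<in>lspace g. \<forall>w\<in>W. act M x w \<in> W)"

definition irreducible_module ::
    "'g::complex_vector lie_superalgebra \<Rightarrow> ('g, 'v::complex_vector) supermodule \<Rightarrow> bool"
  where "irreducible_module g M \<longleftrightarrow>
    is_module g M \<and> mspace M \<noteq> {0} \<and>
    (\<forall>W. graded_submodule g M W \<longrightarrow> W = {0} \<or> W = mspace M)"

definition finite_dimensional_module :: "('g, 'v::complex_vector) supermodule \<Rightarrow> bool"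
  where "finite_dimensional_module M \<longleftrightarrow> (\<exists>B. finite B \<and> mspace M = cspan B)"

definition irreducible_fd_module ::
    "'g::complex_vector lie_superalgebra \<Rightarrow> ('g, 'v::complex_vector) supermodule \<Rightarrow> bool"
  where "irreducible_fd_module g M \<longleftrightarrow> irreducible_module g M \<and> finite_dimensional_module M"

text \<open>Isomorphisms need not be homogeneous, so no condition relates them to the gradings.\<close>

definition isomorphic_modules ::
    "'g::complex_vector lie_superalgebra \<Rightarrow> ('g, 'v::complex_vector) supermodule \<Rightarrow>
      ('g, 'w::complex_vector) supermodule \<Rightarrow> bool"
  where "isomorphic_modules g M N \<longleftrightarrow>
    (\<exists>f. linear_on (mspace M) f \<and> bij_betw f (mspace M) (mspace N) \<and>
      (\<forall>x\<in>lspace g. \<forall>m\<in>mspace M. f (act M x m) = act N x (f m)))"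

lemma diff_diff_rearrange: "(a - b) - (c - d) = (a - c) - (b - d :: 'a::ab_group_add)"
  by (simp add: algebra_simps)

section \<open>The queer Lie superalgebra\<close>

text \<open>Matrices of size \<open>2n + 2\<close> are indexed by \<open>'m + 'm\<close> where \<open>CARD('m) = n + 1\<close>.\<close>

type_synonym 'm bmat = "complex ^ ('m + 'm) ^ ('m + 'm)"

definition block :: "complex^'m^'m \<Rightarrow> complex^'m^'m \<Rightarrow> complex^'m^'m \<Rightarrow> complex^'m^'m \<Rightarrow> 'm::finite bmat"
  where "block a b c d = (\<chi> i j.
    case (i, j) of
      (Inl k, Inl l) \<Rightarrow> a $ k $ l
    | (Inl k, Inr l) \<Rightarrow> b $ k $ l
    | (Inr k, Inl l) \<Rightarrow> c $ k $ l
    | (Inr k, Inr l) \<Rightarrow> d $ k $ l)"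

text \<open>The derived subalgebra of the algebra of all matrices \<open>block a b b a\<close>.\<close>

definition queer_tilde :: "'m::finite bmat set"
  where "queer_tilde = {block a b b a | a b. trace b = 0}"

text \<open>The component of degree \<open>j\<close> of a matrix: the diagonal blocks are even, the off-diagonal ones
  odd. On the matrices \<open>block a b b a\<close> this gives \<open>b = 0\<close> for the even and \<open>a = 0\<close> for the odd part.\<close>

definition component :: "bit \<Rightarrow> 'm::finite bmat \<Rightarrow> 'm bmat"
  where "component j x =
    (\<chi> k l. if (if isl k = isl l then 0 else 1) = j then x $ k $ l else 0)"

text \<open>The bilinear extension of \<open>[x, y] = xy - (-1)\<^bsup>|x||y|\<^esup> yx\<close> from homogeneous elements.\<close>

definition matrix_bracket :: "'m::finite bmat \<Rightarrow> 'm bmat \<Rightarrow> 'm bmat"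
  where "matrix_bracket x y = (\<Sum>i\<in>{0,1}. \<Sum>j\<in>{0,1}.
    component i x ** component j y - parity_sign i j *\<^sub>C (component j y ** component i x))"

lemma block_nth [simp]:
  "block a b c d $ Inl k $ Inl l = a $ k $ l" "block a b c d $ Inl k $ Inr l = b $ k $ l"
  "block a b c d $ Inr k $ Inl l = c $ k $ l" "block a b c d $ Inr k $ Inr l = d $ k $ l"
  by (simp_all add: block_def)

lemma bmat_eq_iff:
  "(x :: 'm::finite bmat) = y \<longleftrightarrow>
    (\<forall>k l. x $ Inl k $ Inl l = y $ Inl k $ Inl l \<and> x $ Inl k $ Inr l = y $ Inl k $ Inr l \<and>
      x $ Inr k $ Inl l = y $ Inr k $ Inl l \<and> x $ Inr k $ Inr l = y $ Inr k $ Inr l)"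
  unfolding vec_eq_iff split_sum_all by blast

lemma sum_UNIV_Plus:
  "(\<Sum>i\<in>UNIV. f i) = (\<Sum>k\<in>UNIV. f (Inl k)) + (\<Sum>k\<in>UNIV. f (Inr k :: 'a::finite + 'b::finite))"
  by (simp flip: UNIV_Plus_UNIV add: sum.Plus)

lemma scaleC_nth [simp]: "(c *\<^sub>C x) $ i = c *\<^sub>C (x $ i)"
  by (simp add: scaleC_vec_def)

lemma block_mult:
  "block a b c d ** block a' b' c' d' =
    block (a ** a' + b ** c') (a ** b' + b ** d') (c ** a' + d ** c') (c ** b' + d ** d')"
  by (simp add: bmat_eq_iff matrix_matrix_mult_def sum_UNIV_Plus)

lemma block_add: "block a b c d + block a' b' c' d' = block (a + a') (b + b') (c + c') (d + d')"
  by (simp add: bmat_eq_iff)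

lemma block_diff: "block a b c d - block a' b' c' d' = block (a - a') (b - b') (c - c') (d - d')"
  by (simp add: bmat_eq_iff)

lemma block_scaleC: "k *\<^sub>C block a b c d = block (k *\<^sub>C a) (k *\<^sub>C b) (k *\<^sub>C c) (k *\<^sub>C d)"
  by (simp add: bmat_eq_iff)

lemma block_0: "0 = block 0 0 0 0"
  by (simp add: bmat_eq_iff)

lemma block_1: "mat 1 = block (mat 1) 0 0 (mat 1)"
  by (simp add: bmat_eq_iff mat_def)

lemma component_block:
  "component 0 (block a b c d) = block a 0 0 d" "component 1 (block a b c d) = block 0 b c 0"
  by (simp_all add: bmat_eq_iff component_def)

lemma matrix_bracket_block:
  "matrix_bracket (block a b b a) (block a' b' b' a') =
    block (a ** a' - a' ** a + (b ** b' + b' ** b)) (a ** b' - b' ** a + (b ** a' - a' ** b))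
      (a ** b' - b' ** a + (b ** a' - a' ** b)) (a ** a' - a' ** a + (b ** b' + b' ** b))"
  by (simp add: matrix_bracket_def parity_sign_def component_block block_mult block_add block_diff
      block_scaleC algebra_simps)

lemma queer_tilde_bracket:
  assumes "x \<in> queer_tilde" and "y \<in> queer_tilde"
  shows "matrix_bracket x y \<in> queer_tilde"
proof -
  obtain a b a' b' where "x = block a b b a" "y = block a' b' b' a'"
    using assms unfolding queer_tilde_def by blast
  moreover have "trace (a ** b' - b' ** a + (b ** a' - a' ** b)) = 0"
    by (simp add: trace_add trace_sub trace_mul_sym[of a b'] trace_mul_sym[of b a'])
  ultimately show ?thesis
    unfolding queer_tilde_def by (auto simp: matrix_bracket_block)
qed

lemma csubspace_queer_tilde: "csubspace (queer_tilde :: 'm::finite bmat set)"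
proof (rule complex_vector.subspaceI)
  have tr: "trace (c *\<^sub>C b) = c * trace b" for c and b :: "complex^'m^'m"
    by (simp add: trace_def scaleC_complex_def sum_distrib_left)
  show "(0 :: 'm bmat) \<in> queer_tilde"
    unfolding queer_tilde_def block_0 by (force simp: trace_def)
  show "x + y \<in> queer_tilde" if "x \<in> queer_tilde" "y \<in> queer_tilde" for x y :: "'m bmat"
    using that unfolding queer_tilde_def by (force simp: block_add trace_add)
  show "c *\<^sub>C x \<in> queer_tilde" if "x \<in> queer_tilde" for c and x :: "'m bmat"
    using that unfolding queer_tilde_def by (force simp: block_scaleC tr)
qed

lemma component_add: "component j (x + y) = component j x + component j y"
  by (simp add: component_def vec_eq_iff)

lemma component_scaleC: "component j (c *\<^sub>C x) = c *\<^sub>C component j x"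
  by (simp add: component_def vec_eq_iff)

lemma matrix_mult_scaleC:
  fixes x :: "complex^'n::finite^'m::finite" and y :: "complex^'k::finite^'n"
  shows "(c *\<^sub>C x) ** y = c *\<^sub>C (x ** y)" "x ** (c *\<^sub>C y) = c *\<^sub>C (x ** y)"
  by (simp_all add: matrix_matrix_mult_def vec_eq_iff scaleC_complex_def sum_distrib_left algebra_simps)

lemma matrix_add_rdistrib: "(x + y) ** z = x ** z + y ** (z :: 'a::semiring_1^'n^'m)"
  by (simp add: matrix_matrix_mult_def vec_eq_iff algebra_simps sum.distrib)

lemma matrix_bracket_bilinear:
  "matrix_bracket (x + y) z = matrix_bracket x z + matrix_bracket y z"
  "matrix_bracket z (x + y) = matrix_bracket z x + matrix_bracket z y"
  "matrix_bracket (c *\<^sub>C x) z = c *\<^sub>C matrix_bracket x z"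
  "matrix_bracket z (c *\<^sub>C x) = c *\<^sub>C matrix_bracket z x"
  by (simp_all add: matrix_bracket_def component_add component_scaleC matrix_add_ldistrib
      matrix_add_rdistrib matrix_mult_scaleC complex_vector.scale_right_diff_distrib
      scaleC_add_right scaleC_scaleC algebra_simps)

lemma matrix_bracket_mat_1:
  fixes x :: "'m::finite bmat"
  shows "matrix_bracket (mat 1) x = 0" "matrix_bracket x (mat 1) = 0"
proof -
  have c: "component 0 (mat 1) = mat 1" "component 1 (mat 1 :: 'm bmat) = 0"
    unfolding block_1 component_block by (simp_all add: block_0)
  show "matrix_bracket (mat 1) x = 0" "matrix_bracket x (mat 1) = 0"
    by (simp_all add: matrix_bracket_def c parity_sign_def)
qed

text \<open>The quotient of \<^const>\<open>queer_tilde\<close> by the scalar matrices.\<close>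

definition queer_rel :: "'m::finite bmat \<Rightarrow> 'm bmat \<Rightarrow> bool"
  where "queer_rel x y \<longleftrightarrow> x \<in> queer_tilde \<and> y \<in> queer_tilde \<and> (\<exists>c. x - y = c *\<^sub>C mat 1)"

lemma part_equivp_queer_rel: "part_equivp (queer_rel :: 'm::finite bmat \<Rightarrow> _)"
proof (rule part_equivpI)
  show "\<exists>x :: 'm bmat. queer_rel x x"
    using complex_vector.subspace_0[OF csubspace_queer_tilde]
    by (auto simp: queer_rel_def intro!: exI[of _ 0])
  show "symp (queer_rel :: 'm bmat \<Rightarrow> _)"
  proof (rule sympI)
    fix x y :: "'m bmat"
    assume "queer_rel x y"
    then obtain c where c: "x \<in> queer_tilde" "y \<in> queer_tilde" "x - y = c *\<^sub>C mat 1"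
      unfolding queer_rel_def by blast
    then have "y - x = (- c) *\<^sub>C mat 1"
      by (metis complex_vector.scale_minus_left minus_diff_eq)
    with c show "queer_rel y x"
      unfolding queer_rel_def by blast
  qed
  show "transp (queer_rel :: 'm bmat \<Rightarrow> _)"
  proof (rule transpI)
    fix x y z :: "'m bmat"
    assume "queer_rel x y" "queer_rel y z"
    then obtain c d where c: "x \<in> queer_tilde" "z \<in> queer_tilde" "x - y = c *\<^sub>C mat 1" "y - z = d *\<^sub>C mat 1"
      unfolding queer_rel_def by blast
    have "x - z = (x - y) + (y - z)"
      by simp
    also have "\<dots> = (c + d) *\<^sub>C mat 1"
      by (simp add: c scaleC_add_left)
    finally have "x - z = (c + d) *\<^sub>C mat 1" .
    with c show "queer_rel x z"
      unfolding queer_rel_def by blast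
  qed
qed

quotient_type 'm queer = "'m::finite bmat" / partial: queer_rel
  by (rule part_equivp_queer_rel)

lemma queer_rel_iff:
  "queer_rel x y \<longleftrightarrow> x \<in> queer_tilde \<and> y \<in> queer_tilde \<and> x - y \<in> cspan {mat 1}"
  by (auto simp: queer_rel_def complex_vector.span_singleton)

lemmas queer_tilde_closed = csubspace_queer_tilde[THEN complex_vector.subspace_0]
  csubspace_queer_tilde[THEN complex_vector.subspace_add]
  csubspace_queer_tilde[THEN complex_vector.subspace_neg]
  csubspace_queer_tilde[THEN complex_vector.subspace_diff]
  csubspace_queer_tilde[THEN complex_vector.subspace_scale]

lemma queer_rel_refl: "x \<in> queer_tilde \<Longrightarrow> queer_rel x x"
  by (simp add: queer_rel_iff complex_vector.span_zero)

lemma queer_rel_refl_iff: "queer_rel x x \<longleftrightarrow> x \<in> queer_tilde"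
  by (auto simp: queer_rel_iff complex_vector.span_zero)

instantiation queer :: (finite) complex_vector
begin

lift_definition zero_queer :: "'a queer" is 0
  by (simp add: queer_rel_refl queer_tilde_closed)

lift_definition plus_queer :: "'a queer \<Rightarrow> 'a queer \<Rightarrow> 'a queer" is "(+)"
  unfolding queer_rel_iff by (subst add_diff_add) (intro conjI queer_tilde_closed complex_vector.span_add; blast)

lift_definition uminus_queer :: "'a queer \<Rightarrow> 'a queer" is uminus
  unfolding queer_rel_iff by (subst minus_diff_minus) (intro conjI queer_tilde_closed complex_vector.span_neg; blast)

lift_definition minus_queer :: "'a queer \<Rightarrow> 'a queer \<Rightarrow> 'a queer" is "(-)"
  unfolding queer_rel_iff
  by (subst diff_diff_rearrange) (blast intro: queer_tilde_closed complex_vector.span_diff)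

lift_definition scaleC_queer :: "complex \<Rightarrow> 'a queer \<Rightarrow> 'a queer" is "scaleC"
  unfolding queer_rel_iff complex_vector.scale_right_diff_distrib[symmetric]
  by (intro conjI queer_tilde_closed complex_vector.span_scale; blast)

instance
  by standard
    (transfer; simp add: queer_rel_refl_iff queer_tilde_closed scaleC_add_left scaleC_add_right
      scaleC_scaleC scaleC_one; simp add: queer_rel_refl_iff queer_tilde_closed algebra_simps)+
end

lift_definition queer_bracket :: "'m::finite queer \<Rightarrow> 'm queer \<Rightarrow> 'm queer" is matrix_bracket
proof -
  fix x x' y y' :: "'m::finite bmat"
  assume "queer_rel x x'" "queer_rel y y'"
  then obtain c d where q: "x \<in> queer_tilde" "x' \<in> queer_tilde" "y \<in> queer_tilde" "y' \<in> queer_tilde"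
    and *: "x - x' = c *\<^sub>C mat 1" "y - y' = d *\<^sub>C mat 1"
    unfolding queer_rel_def by blast
  have "matrix_bracket x y = matrix_bracket (x' + c *\<^sub>C mat 1) (y' + d *\<^sub>C mat 1)"
    by (metis * diff_add_cancel add.commute)
  also have "\<dots> = matrix_bracket x' y'"
    by (simp add: matrix_bracket_bilinear matrix_bracket_mat_1)
  finally show "queer_rel (matrix_bracket x y) (matrix_bracket x' y')"
    using queer_tilde_bracket q by (auto simp: queer_rel_def intro!: exI[of _ 0])
qed

definition diagonal :: "'a::zero^'m^'m \<Rightarrow> bool"
  where "diagonal a \<longleftrightarrow> (\<forall>i j. i \<noteq> j \<longrightarrow> a $ i $ j = 0)"

definition cartan :: "bit \<Rightarrow> 'm::finite queer set"
  where "cartan j = abs_queer `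
    (if j = 0 then {block a 0 0 a | a. diagonal a \<and> trace a = 0}
     else {block 0 b b 0 | b. diagonal b \<and> trace b = 0})"

section \<open>Tensor products\<close>

definition pure_free :: "'v \<Rightarrow> 'w \<Rightarrow> ('v \<times> 'w) \<Rightarrow>\<^sub>0 complex"
  where "pure_free x f = Poly_Mapping.single (x, f) 1"

text \<open>The tensor product is the quotient of the free vector space on \<open>'v \<times> 'w\<close> by the span of the
  bilinearity relations.\<close>

definition tensor_relations :: "(('v::complex_vector \<times> 'w::complex_vector) \<Rightarrow>\<^sub>0 complex) set"
  where "tensor_relations =
    {pure_free (x + y) f - pure_free x f - pure_free y f | x y f. True} \<union>
    {pure_free x (f + g) - pure_free x f - pure_free x g | x f g. True} \<union>
    {pure_free (c *\<^sub>C x) f - c *\<^sub>C pure_free x f | c x f. True} \<union>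
    {pure_free x (c *\<^sub>C f) - c *\<^sub>C pure_free x f | c x f. True}"

definition tensor_rel ::
    "(('v::complex_vector \<times> 'w::complex_vector) \<Rightarrow>\<^sub>0 complex) \<Rightarrow> (('v \<times> 'w) \<Rightarrow>\<^sub>0 complex) \<Rightarrow> bool"
  where "tensor_rel p q \<longleftrightarrow> p - q \<in> cspan tensor_relations"

lemma equivp_tensor_rel:
  "equivp (tensor_rel :: (('v::complex_vector \<times> 'w::complex_vector) \<Rightarrow>\<^sub>0 complex) \<Rightarrow> _)"
proof (rule equivpI)
  show "reflp (tensor_rel :: (('v \<times> 'w) \<Rightarrow>\<^sub>0 complex) \<Rightarrow> _)"
    by (simp add: reflp_def tensor_rel_def complex_vector.span_zero)
  show "symp (tensor_rel :: (('v \<times> 'w) \<Rightarrow>\<^sub>0 complex) \<Rightarrow> _)"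
    unfolding symp_def tensor_rel_def
    by (metis complex_vector.span_neg[of "_ :: ('v \<times> 'w) \<Rightarrow>\<^sub>0 complex"] minus_diff_eq)
  show "transp (tensor_rel :: (('v \<times> 'w) \<Rightarrow>\<^sub>0 complex) \<Rightarrow> _)"
  proof (rule transpI)
    fix p q r :: "('v \<times> 'w) \<Rightarrow>\<^sub>0 complex"
    assume "tensor_rel p q" "tensor_rel q r"
    then have "(p - q) + (q - r) \<in> cspan tensor_relations"
      unfolding tensor_rel_def by (rule complex_vector.span_add)
    then show "tensor_rel p r"
      by (simp add: tensor_rel_def)
  qed
qed

lemma tensor_rel_refl: "p = q \<Longrightarrow> tensor_rel p q"
  by (simp add: tensor_rel_def complex_vector.span_zero)

quotient_type (overloaded) ('v, 'w) tensor = "('v::complex_vector \<times> 'w::complex_vector) \<Rightarrow>\<^sub>0 complex" / tensor_rel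
  by (rule equivp_tensor_rel)

instantiation tensor :: (complex_vector, complex_vector) complex_vector
begin

lift_definition zero_tensor :: "('a, 'b) tensor" is 0 .

lift_definition plus_tensor :: "('a, 'b) tensor \<Rightarrow> ('a, 'b) tensor \<Rightarrow> ('a, 'b) tensor" is "(+)"
  unfolding tensor_rel_def by (subst add_diff_add) (rule complex_vector.span_add)

lift_definition uminus_tensor :: "('a, 'b) tensor \<Rightarrow> ('a, 'b) tensor" is uminus
  unfolding tensor_rel_def by (subst minus_diff_minus) (rule complex_vector.span_neg)

lift_definition minus_tensor :: "('a, 'b) tensor \<Rightarrow> ('a, 'b) tensor \<Rightarrow> ('a, 'b) tensor" is "(-)"
  unfolding tensor_rel_def by (subst diff_diff_rearrange) (rule complex_vector.span_diff)

lift_definition scaleC_tensor :: "complex \<Rightarrow> ('a, 'b) tensor \<Rightarrow> ('a, 'b) tensor" is scaleC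
  unfolding tensor_rel_def complex_vector.scale_right_diff_distrib[symmetric]
  by (rule complex_vector.span_scale)

instance
  by standard
    (transfer; rule tensor_rel_refl;
      simp add: scaleC_add_left scaleC_add_right scaleC_scaleC scaleC_one ac_simps)+
end

lift_definition tensor :: "'v::complex_vector \<Rightarrow> 'w::complex_vector \<Rightarrow> ('v, 'w) tensor"  (infix \<open>\<otimes>\<^sub>C\<close> 70)
  is pure_free .

definition linear_ext :: "('k \<Rightarrow> 'b::complex_vector) \<Rightarrow> ('k \<Rightarrow>\<^sub>0 complex) \<Rightarrow> 'b"
  where "linear_ext F p = (\<Sum>k\<in>Poly_Mapping.keys p. Poly_Mapping.lookup p k *\<^sub>C F k)"

lemma linear_ext_superset:
  assumes "finite S" "Poly_Mapping.keys p \<subseteq> S"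
  shows "linear_ext F p = (\<Sum>k\<in>S. Poly_Mapping.lookup p k *\<^sub>C F k)"
  unfolding linear_ext_def
  by (rule sum.mono_neutral_left) (use assms in \<open>auto simp: in_keys_iff\<close>)

lemma linear_ext_add: "linear_ext F (p + q) = linear_ext F p + linear_ext F q"
proof -
  let ?S = "Poly_Mapping.keys p \<union> Poly_Mapping.keys q"
  have "Poly_Mapping.keys (p + q) \<subseteq> ?S"
    by (rule Poly_Mapping.keys_add)
  then show ?thesis
    by (simp add: linear_ext_superset[of ?S] lookup_add scaleC_add_left sum.distrib)
qed

lemma linear_ext_scaleC: "linear_ext F (c *\<^sub>C p) = c *\<^sub>C linear_ext F p"
proof -
  have "Poly_Mapping.keys (c *\<^sub>C p) \<subseteq> Poly_Mapping.keys p"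
    by (auto simp: in_keys_iff lookup_scaleC)
  then show ?thesis
    by (simp add: linear_ext_superset[of "Poly_Mapping.keys p"] lookup_scaleC scaleC_complex_def
        scaleC_scaleC complex_vector.scale_sum_right)
qed

lemma linear_ext_diff: "linear_ext F (p - q) = linear_ext F p - linear_ext F q"
  by (metis add_diff_cancel_right' diff_add_cancel linear_ext_add)

lemma linear_ext_pure: "linear_ext F (pure_free x f) = F (x, f)"
  by (simp add: linear_ext_def pure_free_def scaleC_one)

lemma linear_ext_fun_add: "linear_ext (\<lambda>k. F k + G k) p = linear_ext F p + linear_ext G p"
  by (simp add: linear_ext_def scaleC_add_right sum.distrib)

lemma linear_ext_fun_diff: "linear_ext (\<lambda>k. F k - G k) p = linear_ext F p - linear_ext G p"
  by (simp add: linear_ext_def complex_vector.scale_right_diff_distrib sum_subtractf)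

lemma linear_ext_fun_scaleC: "linear_ext (\<lambda>k. c *\<^sub>C F k) p = c *\<^sub>C linear_ext F p"
  by (simp add: linear_ext_def complex_vector.scale_sum_right scaleC_scaleC mult.commute)

lemma linear_ext_mem:
  assumes "csubspace S" "\<And>k. F k \<in> S"
  shows "linear_ext F p \<in> S"
  unfolding linear_ext_def
  by (intro complex_vector.subspace_sum complex_vector.subspace_scale assms)

lemma linear_ext_relations:
  assumes "r \<in> cspan tensor_relations" "csubspace S"
    and "\<And>x y f. F (x + y, f) - F (x, f) - F (y, f) \<in> S"
    and "\<And>x f g. F (x, f + g) - F (x, f) - F (x, g) \<in> S"
    and "\<And>c x f. F (c *\<^sub>C x, f) - c *\<^sub>C F (x, f) \<in> S"
    and "\<And>c x f. F (x, c *\<^sub>C f) - c *\<^sub>C F (x, f) \<in> S"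
  shows "linear_ext F r \<in> S"
proof -
  have "csubspace {p. linear_ext F p \<in> S}"
    using assms(2)
    by (auto intro!: complex_vector.subspaceI simp: linear_ext_add linear_ext_scaleC
        complex_vector.subspace_add complex_vector.subspace_scale complex_vector.subspace_0
        linear_ext_def[of F 0])
  moreover have "tensor_relations \<subseteq> {p. linear_ext F p \<in> S}"
    using assms(3-6) unfolding tensor_relations_def
    by (auto simp: linear_ext_diff linear_ext_scaleC linear_ext_pure)
  ultimately show ?thesis
    using assms(1) complex_vector.span_minimal by blast
qed

section \<open>The Lie superalgebra of the tensor product\<close>

lemma queer_bracket_bilinear:
  "queer_bracket (x + y) z = queer_bracket x z + queer_bracket y z"
  "queer_bracket z (x + y) = queer_bracket z x + queer_bracket z y"
  "queer_bracket (c *\<^sub>C x) z = c *\<^sub>C queer_bracket x z"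
  "queer_bracket z (c *\<^sub>C x) = c *\<^sub>C queer_bracket z x"
  by (transfer; simp add: matrix_bracket_bilinear queer_rel_refl_iff queer_tilde_closed queer_tilde_bracket)+

definition pure_bracket ::
    "'m::finite queer \<times> 'a::complex_comm_algebra \<Rightarrow> 'm queer \<times> 'a \<Rightarrow> ('m queer \<times> 'a) \<Rightarrow>\<^sub>0 complex"
  where "pure_bracket k l = pure_free (queer_bracket (fst k) (fst l)) (snd k * snd l)"

lift_definition tensor_bracket ::
    "('m::finite queer, 'a::complex_comm_algebra) tensor \<Rightarrow> ('m queer, 'a) tensor \<Rightarrow> ('m queer, 'a) tensor"
  is "\<lambda>p q. linear_ext (\<lambda>k. linear_ext (pure_bracket k) q) p"
proof -
  fix p p' q q' :: "('m queer \<times> 'a) \<Rightarrow>\<^sub>0 complex"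
  let ?R = "cspan tensor_relations :: (('m queer \<times> 'a) \<Rightarrow>\<^sub>0 complex) set"
  let ?br = "\<lambda>p q. linear_ext (\<lambda>k. linear_ext (pure_bracket k) q) p"
  assume "tensor_rel p p'" "tensor_rel q q'"
  then have *: "p - p' \<in> ?R" "q - q' \<in> ?R"
    by (simp_all add: tensor_rel_def)
  have R: "csubspace ?R"
    by (rule complex_vector.subspace_span)
  have rels: "pure_free (x + y) f - pure_free x f - pure_free y f \<in> ?R"
    "pure_free x (f + g) - pure_free x f - pure_free x g \<in> ?R"
    "pure_free (c *\<^sub>C x) f - c *\<^sub>C pure_free x f \<in> ?R"
    "pure_free x (c *\<^sub>C f) - c *\<^sub>C pure_free x f \<in> ?R" for x y f g c
    by (rule complex_vector.span_base; unfold tensor_relations_def; blast)+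
  have "?br (p - p') q \<in> ?R"
    by (rule linear_ext_relations[OF *(1) R];
        simp flip: linear_ext_fun_diff linear_ext_fun_scaleC; rule linear_ext_mem[OF R];
        simp add: pure_bracket_def queer_bracket_bilinear distrib_right scaleC_mult_left rels)
  moreover have "?br p' (q - q') \<in> ?R"
    by (rule linear_ext_mem[OF R], rule linear_ext_relations[OF *(2) R];
        simp add: pure_bracket_def queer_bracket_bilinear distrib_left scaleC_mult_right rels)
  moreover have "?br p q - ?br p' q' = ?br (p - p') q + ?br p' (q - q')"
    by (simp add: linear_ext_diff linear_ext_fun_diff)
  ultimately show "tensor_rel (?br p q) (?br p' q')"
    unfolding tensor_rel_def by (simp add: complex_vector.span_add)
qed

lemma tensor_bracket_pure: "tensor_bracket (x \<otimes>\<^sub>C f) (y \<otimes>\<^sub>C g) = queer_bracket x y \<otimes>\<^sub>C (f * g)"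
  by transfer (simp add: linear_ext_pure pure_bracket_def equivp_reflp[OF equivp_tensor_rel])

text \<open>For subspaces \<open>S\<close> and \<open>I\<close> the canonical map from \<open>S \<otimes> I\<close> to the tensor product of the
  ambient spaces is injective, so the former is identified with its image.\<close>

definition tensor_space ::
    "'v::complex_vector set \<Rightarrow> 'w::complex_vector set \<Rightarrow> ('v, 'w) tensor set"
  where "tensor_space S I = cspan {x \<otimes>\<^sub>C f | x f. x \<in> S \<and> f \<in> I}"

definition cartan_tensor :: "('m::finite queer, 'a::complex_comm_algebra) tensor lie_superalgebra"
  where "cartan_tensor = \<lparr>part = (\<lambda>j. tensor_space (cartan j) UNIV), bracket = tensor_bracket\<rparr>"

text \<open>A functional on a subspace is a function on the ambient type, made unique by
  \<^const>\<open>extensional\<close>.\<close>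

definition cartan_functionals :: "(('m::finite queer, 'a::complex_comm_algebra) tensor \<Rightarrow> complex) set"
  where "cartan_functionals =
    {\<psi> \<in> extensional (tensor_space (cartan 0) UNIV).
      linear_on (tensor_space (cartan 0) UNIV) \<psi> \<and>
      (\<exists>I. algebra_ideal I \<and> finite_codimension I \<and> (\<forall>t\<in>tensor_space (cartan 0) I. \<psi> t = 0))}"

definition has_weight ::
    "(('m::finite queer, 'a::complex_comm_algebra) tensor, 'v::complex_vector) supermodule \<Rightarrow>
      (('m queer, 'a) tensor \<Rightarrow> complex) \<Rightarrow> bool"
  where "has_weight M \<psi> \<longleftrightarrow>
    (\<forall>x\<in>tensor_space (cartan 0) UNIV. \<forall>v\<in>mspace M. act M x v = \<psi> x *\<^sub>C v)"

text \<open>Every finite-dimensional vector space is isomorphic to a subspace of \<open>nat \<Rightarrow>\<^sub>0 complex\<close>, so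
  the modules on such subspaces represent all isomorphism classes.\<close>

type_synonym ('m, 'a) cartan_module = "(('m queer, 'a) tensor, nat \<Rightarrow>\<^sub>0 complex) supermodule"

definition weight_module ::
    "(('m::finite queer, 'a::complex_comm_algebra) tensor \<Rightarrow> complex) \<Rightarrow> ('m, 'a) cartan_module"
  where "weight_module \<psi> = (SOME H. irreducible_fd_module cartan_tensor H \<and> has_weight H \<psi>)"

definition isomorphism_rel ::
    "(('m::finite, 'a::complex_comm_algebra) cartan_module \<times> ('m, 'a) cartan_module) set"
  where "isomorphism_rel = {(M, N). irreducible_fd_module cartan_tensor M \<and>
    irreducible_fd_module cartan_tensor N \<and> isomorphic_modules cartan_tensor M N}"

definition irreducible_classes ::
    "('m::finite, 'a::complex_comm_algebra) cartan_module set set"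
  where "irreducible_classes = {M. irreducible_fd_module cartan_tensor M} // isomorphism_rel"

end

theory Submission
  imports Defs "HOL-Computational_Algebra.Fundamental_Theorem_Algebra"
begin

text \<open>
  The even part \<open>h\<^sub>0 \<otimes> A\<close> is central in \<open>h \<otimes> A\<close>, and brackets of odd elements lie in it. Once
  \<open>h\<^sub>0 \<otimes> A\<close> acts through a functional \<open>\<psi>\<close>, the odd part therefore acts by odd operators satisfying
  \<open>xy + yx = \<psi>([x, y])\<close>, the relations of the Clifford algebra of the symmetric form
  \<open>weight_form\<close>. If \<open>\<psi>\<close> vanishes on \<open>h\<^sub>0 \<otimes> I\<close> for an ideal \<open>I\<close> of finite codimension, then
  \<open>h\<^sub>1 \<otimes> I\<close> lies in the radical of the form, so that there is a finite orthonormal basis modulo the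
  radical (\<open>clifford_frame_exists\<close>). The radical acts by zero on an irreducible module
  (\<open>act_radical\<close>). The irreducible modules of weight \<open>\<psi>\<close> are thus the irreducible graded modules of
  a Clifford algebra with finitely many generators.

  The grading is absorbed into the algebra: the parity operator is an involution that anticommutes
  with every odd operator, so a graded module for \<open>r\<close> Clifford generators is an ungraded module for
  \<open>r + 1\<close> of them, and its graded submodules are the invariant subspaces. Two irreducible
  representations of \<open>s\<close> generators are related by a bijection that intertwines all generators but
  the last (\<open>irreducible_clifford_rep_unique\<close>). For odd \<open>s\<close> there are two isomorphism classes,
  exchanged by changing the sign of the last generator. With the parity operator as the last
  generator, this sign change is the parity shift, and a bijection that ignores it is an isomorphism
  of modules that need not be homogeneous. An irreducible representation exists as a minimal
  invariant subspace of the Jordan-Wigner representation (\<open>irreducible_clifford_rep_exists\<close>).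

  Conversely, an element of \<open>h\<^sub>0 \<otimes> A\<close> has an eigenvector in a finite-dimensional irreducible module,
  and its eigenspaces are graded submodules, so it acts by a scalar \<open>\<psi>(x)\<close>. The largest ideal \<open>I\<close>
  with \<open>\<psi>(h\<^sub>0 \<otimes> I) = 0\<close> contains all \<open>f\<close> for which \<open>h\<^sub>1 \<otimes> f\<close> acts by zero, because
  \<open>h\<^sub>0 = [h\<^sub>1, h\<^sub>1]\<close>; these \<open>f\<close> form the common kernel of finitely many linear maps into a
  finite-dimensional space, so \<open>I\<close> has finite codimension (\<open>weight_exists\<close>). The equality
  \<open>h\<^sub>0 = [h\<^sub>1, h\<^sub>1]\<close> is where \<open>n \<ge> 2\<close> enters: for \<open>n = 1\<close> the odd Cartan elements are multiples
  of one matrix whose square is scalar, and all their brackets vanish in \<open>q(1)\<close>.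
\<close>

section \<open>Linear maps on subspaces\<close>

lemma linear_onD:
  assumes "linear_on S f"
  shows "x \<in> S \<Longrightarrow> y \<in> S \<Longrightarrow> f (x + y) = f x + f y" and "x \<in> S \<Longrightarrow> f (c *\<^sub>C x) = c *\<^sub>C f x"
  using assms by (auto simp: linear_on_def)

lemma linear_on_0: "linear_on S f \<Longrightarrow> csubspace S \<Longrightarrow> f 0 = 0"
  using linear_onD(2)[of S f 0 0] complex_vector.subspace_0[of S] by simp

lemma linear_on_minus: "linear_on S f \<Longrightarrow> x \<in> S \<Longrightarrow> f (- x) = - f x"
  using linear_onD(2)[of S f x "- 1"] by simp

lemma linear_on_diff:
  assumes "linear_on S f" "csubspace S" "x \<in> S" "y \<in> S"
  shows "f (x - y) = f x - f y"
  using linear_onD(1)[OF assms(1,3), of "- y"] linear_on_minus[OF assms(1,4)]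
    complex_vector.subspace_neg[OF assms(2,4)] by simp

lemma linear_on_sum:
  assumes "linear_on S f" "csubspace S" "\<And>i. i \<in> I \<Longrightarrow> g i \<in> S"
  shows "f (\<Sum>i\<in>I. g i) = (\<Sum>i\<in>I. f (g i))"
  using assms(3)
proof (induction I rule: infinite_finite_induct)
  case (insert i I)
  then have "(\<Sum>j\<in>I. g j) \<in> S"
    by (intro complex_vector.subspace_sum[OF assms(2)]) auto
  with insert show ?case
    by (simp add: linear_onD(1)[OF assms(1)])
qed (simp_all add: linear_on_0[OF assms(1,2)])

lemma linear_on_subset: "linear_on S f \<Longrightarrow> R \<subseteq> S \<Longrightarrow> linear_on R f"
  unfolding linear_on_def by blast

lemma linear_on_compose:
  assumes "linear_on S f" "linear_on R g" "\<And>x. x \<in> S \<Longrightarrow> f x \<in> R"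
  shows "linear_on S (\<lambda>x. g (f x))"
  using assms by (simp add: linear_on_def)

lemma linear_on_add: "linear_on S f \<Longrightarrow> linear_on S g \<Longrightarrow> linear_on S (\<lambda>x. f x + g x)"
  by (simp add: linear_on_def scaleC_add_right add_ac)

lemma linear_on_scale: "linear_on S f \<Longrightarrow> linear_on S (\<lambda>x. c *\<^sub>C f x)"
  by (simp add: linear_on_def scaleC_add_right scaleC_scaleC mult.commute)

lemma linear_on_id: "linear_on S (\<lambda>x. x)"
  by (simp add: linear_on_def)

lemma linear_on_lincomb:
  assumes "linear_on S f" "csubspace S" "\<And>i. i \<in> I \<Longrightarrow> g i \<in> S"
  shows "f (\<Sum>i\<in>I. c i *\<^sub>C g i) = (\<Sum>i\<in>I. c i *\<^sub>C f (g i))"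
  using assms(3) linear_onD(2)[OF assms(1)]
  by (subst linear_on_sum[OF assms(1,2)]) (auto intro: complex_vector.subspace_scale[OF assms(2)])

lemma lincomb_mem: "csubspace S \<Longrightarrow> (\<And>i. i \<in> I \<Longrightarrow> g i \<in> S) \<Longrightarrow> (\<Sum>i\<in>I. c i *\<^sub>C g i) \<in> S"
  by (intro complex_vector.subspace_sum complex_vector.subspace_scale)

lemma linear_on_sum_fun:
  "(\<And>i. i \<in> I \<Longrightarrow> linear_on S (f i)) \<Longrightarrow> linear_on S (\<lambda>x. \<Sum>i\<in>I. f i x)"
  by (simp add: linear_on_def sum.distrib complex_vector.scale_sum_right)

lemma linear_on_scaleC_left:
  "linear_on S h \<Longrightarrow> linear_on S (\<lambda>x. h x *\<^sub>C v)"
  by (simp add: linear_on_def scaleC_add_left scaleC_scaleC scaleC_complex_def)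

lemma linear_on_inverse:
  assumes "linear_on S f" "bij_betw f S R" "csubspace S"
  shows "linear_on R (inv_into S f)"
proof -
  let ?g = "inv_into S f"
  have g: "?g y \<in> S" "f (?g y) = y" if "y \<in> R" for y
    using that assms(2) by (auto simp: bij_betw_def inv_into_into f_inv_into_f)
  have inj: "?g (f x) = x" if "x \<in> S" for x
    using that assms(2) by (auto simp: bij_betw_def)
  have "?g (x + y) = ?g x + ?g y" if "x \<in> R" "y \<in> R" for x y
    using inj[of "?g x + ?g y"] g that linear_onD(1)[OF assms(1)]
      complex_vector.subspace_add[OF assms(3)] by metis
  moreover have "?g (c *\<^sub>C x) = c *\<^sub>C ?g x" if "x \<in> R" for c x
    using inj[of "c *\<^sub>C ?g x"] g that linear_onD(2)[OF assms(1)]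
      complex_vector.subspace_scale[OF assms(3)] by metis
  ultimately show ?thesis
    unfolding linear_on_def by blast
qed

lemma less_add_two_cases:
  assumes "i < Suc (Suc s)"
  obtains "i = 0" | "i = 1" | j where "i = j + 2" "j < s"
proof -
  have "i = 0 \<or> i = 1 \<or> i = (i - 2) + 2 \<and> i - 2 < s"
    using assms by auto
  then show ?thesis
    using that by blast
qed

lemma double_scaleC: "v + v = 2 *\<^sub>C (v :: 'a::complex_vector)"
  using scaleC_add_left[of 1 1 v] by (simp add: scaleC_one)

lemma half_double: "(1/2) *\<^sub>C (v + v) = (v :: 'a::complex_vector)"
  by (simp add: double_scaleC scaleC_scaleC scaleC_one)

section \<open>Representations of Clifford algebras\<close>

text \<open>The generators are normalised to be anticommuting involutions. They are only constrained on the
  subspace \<open>V\<close>, since the modules to be compared live on subspaces of larger types.\<close>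

locale clifford_rep =
  fixes s :: nat and V :: "'v::complex_vector set" and \<gamma> :: "nat \<Rightarrow> 'v \<Rightarrow> 'v"
  assumes subspace: "csubspace V"
    and linear: "i < s \<Longrightarrow> linear_on V (\<gamma> i)"
    and closed: "i < s \<Longrightarrow> v \<in> V \<Longrightarrow> \<gamma> i v \<in> V"
    and anticommutator: "i < s \<Longrightarrow> j < s \<Longrightarrow> v \<in> V \<Longrightarrow>
      \<gamma> i (\<gamma> j v) + \<gamma> j (\<gamma> i v) = (if i = j then 2 else 0) *\<^sub>C v"
begin

lemma square: "i < s \<Longrightarrow> v \<in> V \<Longrightarrow> \<gamma> i (\<gamma> i v) = v"
  using anticommutator[of i i v] by (simp add: double_scaleC)

lemma anticommute: "i < s \<Longrightarrow> j < s \<Longrightarrow> i \<noteq> j \<Longrightarrow> v \<in> V \<Longrightarrow> \<gamma> i (\<gamma> j v) = - \<gamma> j (\<gamma> i v)"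
  using anticommutator[of i j v] by (simp add: eq_neg_iff_add_eq_0)

lemma gamma_0: "i < s \<Longrightarrow> \<gamma> i 0 = 0"
  by (rule linear_on_0[OF linear subspace])

lemma gamma_minus: "i < s \<Longrightarrow> v \<in> V \<Longrightarrow> \<gamma> i (- v) = - \<gamma> i v"
  by (rule linear_on_minus[OF linear])

end

definition irreducible_clifford_rep ::
    "nat \<Rightarrow> 'v::complex_vector set \<Rightarrow> (nat \<Rightarrow> 'v \<Rightarrow> 'v) \<Rightarrow> bool"
  where "irreducible_clifford_rep s V \<gamma> \<longleftrightarrow> clifford_rep s V \<gamma> \<and> V \<noteq> {0} \<and>
    (\<forall>W. csubspace W \<longrightarrow> W \<subseteq> V \<longrightarrow> (\<forall>i<s. \<forall>w\<in>W. \<gamma> i w \<in> W) \<longrightarrow> W = {0} \<or> W = V)"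

text \<open>Splitting off the first two generators. The operator \<open>T = i \<gamma>\<^sub>0 \<gamma>\<^sub>1\<close> is an involution that commutes
  with all other generators and anticommutes with \<open>\<gamma>\<^sub>0\<close>. Hence \<open>V\<close> is the direct sum of the
  \<open>1\<close>-eigenspace \<open>V_plus\<close> and its image under \<open>\<gamma>\<^sub>0\<close>, and \<open>V_plus\<close> is a representation of the
  remaining generators that determines \<open>V\<close>. \<open>P\<close> is the projection onto \<open>V_plus\<close>.\<close>

locale clifford_pair = clifford_rep "Suc (Suc s)" V \<gamma>
  for s :: nat and V :: "'v::complex_vector set" and \<gamma> :: "nat \<Rightarrow> 'v \<Rightarrow> 'v"
begin

definition T :: "'v \<Rightarrow> 'v"
  where "T v = \<i> *\<^sub>C \<gamma> 0 (\<gamma> 1 v)"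

definition P :: "'v \<Rightarrow> 'v"
  where "P v = (1/2) *\<^sub>C (v + T v)"

definition V_plus :: "'v set"
  where "V_plus = {v \<in> V. T v = v}"

lemma mem [intro]:
  "x \<in> V \<Longrightarrow> y \<in> V \<Longrightarrow> x + y \<in> V" "x \<in> V \<Longrightarrow> y \<in> V \<Longrightarrow> x - y \<in> V" "x \<in> V \<Longrightarrow> c *\<^sub>C x \<in> V" "x \<in> V \<Longrightarrow> - x \<in> V"
  "x \<in> V \<Longrightarrow> \<gamma> 0 x \<in> V" "x \<in> V \<Longrightarrow> \<gamma> (Suc 0) x \<in> V"
  using subspace closed
  by (auto simp: complex_vector.subspace_add complex_vector.subspace_diff complex_vector.subspace_scale
      complex_vector.subspace_neg)

lemma gamma_scale: "i < Suc (Suc s) \<Longrightarrow> x \<in> V \<Longrightarrow> \<gamma> i (c *\<^sub>C x) = c *\<^sub>C \<gamma> i x"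
  by (rule linear_onD(2)[OF linear])

lemma gamma_add: "i < Suc (Suc s) \<Longrightarrow> x \<in> V \<Longrightarrow> y \<in> V \<Longrightarrow> \<gamma> i (x + y) = \<gamma> i x + \<gamma> i y"
  by (rule linear_onD(1)[OF linear])

lemma gamma_diff: "i < Suc (Suc s) \<Longrightarrow> x \<in> V \<Longrightarrow> y \<in> V \<Longrightarrow> \<gamma> i (x - y) = \<gamma> i x - \<gamma> i y"
  by (rule linear_on_diff[OF linear subspace])

lemma T_0: "T 0 = 0"
  by (simp add: T_def gamma_0)

lemma T_mem [intro]: "v \<in> V \<Longrightarrow> T v \<in> V"
  unfolding T_def using mem by auto

lemma T_add: "v \<in> V \<Longrightarrow> w \<in> V \<Longrightarrow> T (v + w) = T v + T w"
  unfolding T_def by (simp add: gamma_add mem scaleC_add_right)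

lemma T_scale: "v \<in> V \<Longrightarrow> T (c *\<^sub>C v) = c *\<^sub>C T v"
  unfolding T_def by (simp add: gamma_scale mem scaleC_scaleC mult.commute)

lemma T_gamma0: "v \<in> V \<Longrightarrow> T (\<gamma> 0 v) = - \<gamma> 0 (T v)"
  using anticommute[of 1 0 v]
  by (simp add: T_def gamma_scale gamma_minus mem)

lemma gamma1: "v \<in> V \<Longrightarrow> \<gamma> 1 v = (- \<i>) *\<^sub>C \<gamma> 0 (T v)"
  by (simp add: T_def gamma_scale mem square scaleC_scaleC scaleC_one)

lemma T_T: "v \<in> V \<Longrightarrow> T (T v) = v"
  using anticommute[of 1 0 "\<gamma> (Suc 0) v"]
  by (simp add: T_def gamma_scale gamma_minus mem square scaleC_scaleC scaleC_one)

lemma T_gamma: "i < s \<Longrightarrow> v \<in> V \<Longrightarrow> T (\<gamma> (i + 2) v) = \<gamma> (i + 2) (T v)"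
  using anticommute[of 1 "i + 2" v] anticommute[of 0 "i + 2" "\<gamma> (Suc 0) v"]
  by (simp add: T_def gamma_scale gamma_minus mem closed)

lemma P_mem [intro]: "v \<in> V \<Longrightarrow> P v \<in> V"
  unfolding P_def by (intro mem T_mem)

lemma P_add: "v \<in> V \<Longrightarrow> w \<in> V \<Longrightarrow> P (v + w) = P v + P w"
  by (simp add: P_def T_add add_ac flip: scaleC_add_right)

lemma P_scale: "v \<in> V \<Longrightarrow> P (c *\<^sub>C v) = c *\<^sub>C P v"
  by (simp add: P_def T_scale scaleC_scaleC mult.commute flip: scaleC_add_right)

lemma P_plus: "v \<in> V \<Longrightarrow> P v \<in> V_plus"
  by (simp add: V_plus_def P_mem) (simp add: P_def T_add T_scale mem T_mem T_T add.commute)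

lemma V_plusD: "v \<in> V_plus \<Longrightarrow> v \<in> V" "v \<in> V_plus \<Longrightarrow> T v = v"
  by (auto simp: V_plus_def)

lemma P_fix: "v \<in> V_plus \<Longrightarrow> P v = v"
  by (simp add: P_def V_plusD half_double)

lemma P_gamma0_plus: "v \<in> V_plus \<Longrightarrow> P (\<gamma> 0 v) = 0"
  by (simp add: P_def V_plusD T_gamma0)

lemma P_gamma: "i < s \<Longrightarrow> v \<in> V \<Longrightarrow> P (\<gamma> (i + 2) v) = \<gamma> (i + 2) (P v)"
  by (simp add: P_def T_gamma gamma_scale gamma_add mem T_mem closed del: add_2_eq_Suc')

lemma P_T: "v \<in> V \<Longrightarrow> P (T v) = P v"
  by (simp add: P_def T_T add.commute)

lemma decompose: "v \<in> V \<Longrightarrow> P v + \<gamma> 0 (P (\<gamma> 0 v)) = v"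
  by (simp add: P_def gamma_scale gamma_add gamma_diff mem T_mem square T_gamma0
      double_scaleC scaleC_scaleC scaleC_one flip: scaleC_add_right)

lemma V_plus_rep: "clifford_rep s V_plus (\<lambda>i. \<gamma> (i + 2))"
proof
  show "csubspace V_plus"
    using subspace
    by (auto intro!: complex_vector.subspaceI simp: V_plus_def T_add T_scale
        complex_vector.subspace_0 complex_vector.subspace_add complex_vector.subspace_scale T_0)
  show "linear_on V_plus (\<gamma> (i + 2))" if "i < s" for i
    using linear[of "i + 2"] that V_plusD(1) by (auto elim: linear_on_subset)
  show "\<gamma> (i + 2) v \<in> V_plus" if "i < s" "v \<in> V_plus" for i v
    using that closed[of "i + 2" v] T_gamma[of i v] by (simp add: V_plus_def)
  show "\<gamma> (i + 2) (\<gamma> (j + 2) v) + \<gamma> (j + 2) (\<gamma> (i + 2) v) = (if i = j then 2 else 0) *\<^sub>C v"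
    if "i < s" "j < s" "v \<in> V_plus" for i j v
    using that anticommutator[of "i + 2" "j + 2" v] V_plusD(1) by simp
qed

text \<open>For an invariant \<open>W \<subseteq> V_plus\<close>, the subspace \<open>W + \<gamma>\<^sub>0 W\<close> of \<open>V\<close> is invariant under all
  generators, and it meets \<open>V_plus\<close> in \<open>W\<close>.\<close>

lemma V_plus_irreducible:
  assumes "irreducible_clifford_rep (Suc (Suc s)) V \<gamma>"
  shows "irreducible_clifford_rep s V_plus (\<lambda>i. \<gamma> (i + 2))"
proof -
  interpret plus: clifford_rep s V_plus "\<lambda>i. \<gamma> (i + 2)"
    by (rule V_plus_rep)
  have "V_plus \<noteq> {0}"
  proof
    assume *: "V_plus = {0}"
    have "v = 0" if "v \<in> V" for v
      using P_plus[of v] P_plus[of "\<gamma> 0 v"] decompose[OF that] that * by (auto simp: mem gamma_0)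
    then show False
      using assms complex_vector.subspace_0[OF subspace]
      by (auto simp: irreducible_clifford_rep_def)
  qed
  moreover have "W = {0} \<or> W = V_plus"
    if W: "csubspace W" "W \<subseteq> V_plus" "\<forall>i<s. \<forall>w\<in>W. \<gamma> (i + 2) w \<in> W" for W
  proof -
    note W' = complex_vector.subspace_add[OF W(1)] complex_vector.subspace_scale[OF W(1)]
      complex_vector.subspace_neg[OF W(1)] complex_vector.subspace_0[OF W(1)]
    have WV: "w \<in> V" "T w = w" if "w \<in> W" for w
      using that W(2) V_plusD by auto
    \<comment> \<open>This is \<open>W + \<gamma>\<^sub>0 W\<close>, described by the two components of its elements.\<close>
    let ?X = "{v \<in> V. P v \<in> W \<and> P (\<gamma> 0 v) \<in> W}"
    have sub: "csubspace ?X"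
      using complex_vector.subspace_0[OF subspace] P_fix[of 0] complex_vector.subspace_0[OF plus.subspace]
      by (auto intro!: complex_vector.subspaceI simp: W' gamma_add gamma_scale P_add P_scale gamma_0 mem)
    have inv0: "\<gamma> 0 v \<in> ?X" if "v \<in> ?X" for v
      using that by (auto simp: square)
    have invT: "T v \<in> ?X" if v: "v \<in> ?X" for v
    proof -
      have "\<gamma> 0 (T v) = (- 1) *\<^sub>C T (\<gamma> 0 v)"
        using v by (simp add: T_gamma0)
      then have "P (\<gamma> 0 (T v)) = (- 1) *\<^sub>C P (\<gamma> 0 v)"
        using v by (simp only: P_scale T_mem mem P_T mem_Collect_eq)
      with v show ?thesis
        by (auto simp: P_T W')
    qed
    have "\<gamma> i v \<in> ?X" if "i < Suc (Suc s)" and v: "v \<in> ?X" for i v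
    proof -
      from that(1) show ?thesis
      proof (cases rule: less_add_two_cases)
        case 1
        then show ?thesis using inv0 v by simp
      next
        case 2
        then show ?thesis
          using v gamma1[of v] complex_vector.subspace_scale[OF sub inv0[OF invT[OF v]], of "- \<i>"]
          by simp
      next
        case (3 j)
        have "\<gamma> 0 (\<gamma> i v) = \<gamma> i (- \<gamma> 0 v)"
          using anticommute[of 0 "j + 2" v] 3 v by (simp add: gamma_minus mem)
        also have "P \<dots> = \<gamma> i (P (- \<gamma> 0 v))"
          using P_gamma[of j "- \<gamma> 0 v"] 3 v by (simp add: mem)
        also have "P (- \<gamma> 0 v) = - P (\<gamma> 0 v)"
          using P_scale[of "\<gamma> 0 v" "- 1"] v by (simp add: mem)
        finally have "P (\<gamma> 0 (\<gamma> i v)) \<in> W"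
          using W(3) 3 v by (simp add: W')
        then show ?thesis
          using P_gamma[of j v] 3 v W(3) closed[of i v] by simp
      qed
    qed
    with assms sub have "?X = {0} \<or> ?X = V"
      unfolding irreducible_clifford_rep_def by (metis (no_types, lifting) mem_Collect_eq subsetI)
    moreover have "W \<subseteq> ?X"
      using W(2) by (auto simp: P_fix P_gamma0_plus W' WV)
    moreover have "V_plus \<subseteq> W" if "?X = V"
      using that P_fix V_plusD(1) by (metis (mono_tags, lifting) mem_Collect_eq subsetI)
    ultimately show ?thesis
      using W(2) W'(4) by blast
  qed
  ultimately show ?thesis
    unfolding irreducible_clifford_rep_def using V_plus_rep by blast
qed

end

text \<open>A map \<open>f\<close> between the \<open>1\<close>-eigenspaces extends to the whole spaces by \<open>a + \<gamma>\<^sub>0 b \<mapsto> f a + \<gamma>\<^sub>0 (f b)\<close>.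
  The extension commutes with \<open>\<gamma>\<^sub>0\<close> and \<open>T\<close> by construction, hence with \<open>\<gamma>\<^sub>1 = - i \<gamma>\<^sub>0 T\<close>. It commutes
  with each later generator that \<open>f\<close> commutes with, as both sides pick up the same sign when that
  generator passes \<open>\<gamma>\<^sub>0\<close>.\<close>

lemma clifford_pair_extend:
  fixes V :: "'v::complex_vector set" and V' :: "'w::complex_vector set"
  assumes "clifford_pair s V \<gamma>" "clifford_pair s V' \<gamma>'"
    and f: "linear_on (clifford_pair.V_plus V \<gamma>) f"
      "\<And>v. v \<in> clifford_pair.V_plus V \<gamma> \<Longrightarrow> f v \<in> clifford_pair.V_plus V' \<gamma>'"
    and F_def: "\<And>v. F v = f (clifford_pair.P \<gamma> v) + \<gamma>' 0 (f (clifford_pair.P \<gamma> (\<gamma> 0 v)))"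
  shows "linear_on V F"
    and "v \<in> V \<Longrightarrow> F v \<in> V'"
    and "v \<in> V \<Longrightarrow> F (\<gamma> 0 v) = \<gamma>' 0 (F v)"
    and "v \<in> V \<Longrightarrow> F (\<gamma> 1 v) = \<gamma>' 1 (F v)"
    and "v \<in> V \<Longrightarrow> i < s \<Longrightarrow>
      (\<And>w. w \<in> clifford_pair.V_plus V \<gamma> \<Longrightarrow> f (\<gamma> (i + 2) w) = \<gamma>' (i + 2) (f w)) \<Longrightarrow>
      F (\<gamma> (i + 2) v) = \<gamma>' (i + 2) (F v)"
    and "v \<in> V \<Longrightarrow> clifford_pair.P \<gamma>' (F v) = f (clifford_pair.P \<gamma> v)"
proof -
  interpret M: clifford_pair s V \<gamma> by fact
  interpret N: clifford_pair s V' \<gamma>' by fact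
  have fV: "f v \<in> V'" "N.T (f v) = f v" "N.P (f v) = f v" if "v \<in> M.V_plus" for v
    using f(2)[OF that] N.V_plusD N.P_fix by auto
  have f0: "f 0 = 0"
    using f(1) by (rule linear_on_0) (rule clifford_rep.subspace[OF M.V_plus_rep])
  have fm: "f (- v) = - f v" if "v \<in> M.V_plus" for v
    using f(1) that by (rule linear_on_minus)
  show FV: "F v \<in> V'" if "v \<in> V" for v
    using that by (auto simp: F_def fV M.P_plus M.mem N.mem)
  show "linear_on V F"
    unfolding linear_on_def
    by (simp add: F_def M.P_add M.P_scale M.gamma_add M.gamma_scale M.mem M.P_plus linear_onD[OF f(1)]
        fV N.gamma_add N.gamma_scale scaleC_add_right add_ac)
  show F0: "F (\<gamma> 0 v) = \<gamma>' 0 (F v)" if "v \<in> V" for v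
    using that
    by (simp add: F_def M.mem M.square N.gamma_add fV M.P_plus N.mem N.square add.commute)
  have FT: "F (M.T v) = N.T (F v)" if "v \<in> V" for v
  proof -
    have "M.P (\<gamma> 0 (M.T v)) = - M.P (\<gamma> 0 v)"
      using M.T_gamma0[OF that] M.P_T[of "\<gamma> 0 v"] M.P_scale[of "\<gamma> 0 (M.T v)" "- 1"] that
      by (simp add: M.mem M.T_mem)
    then show ?thesis
      using that
      by (simp add: F_def M.P_T N.T_add fV M.P_plus M.mem N.mem N.T_gamma0 fm N.gamma_minus)
  qed
  show "F (\<gamma> 1 v) = \<gamma>' 1 (F v)" if "v \<in> V" for v
    using that F0[of "(- \<i>) *\<^sub>C M.T v"] FT[OF that] linear_onD(2)[OF \<open>linear_on V F\<close>, of "M.T v" "- \<i>"]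
    by (simp only: M.gamma1 N.gamma1 FV)
      (metis (no_types, lifting) F0 FV M.T_mem M.mem(5) \<open>linear_on V F\<close> linear_onD(2))
  show "F (\<gamma> (i + 2) v) = \<gamma>' (i + 2) (F v)" if v: "v \<in> V" and i: "i < s"
    and fi: "\<And>w. w \<in> M.V_plus \<Longrightarrow> f (\<gamma> (i + 2) w) = \<gamma>' (i + 2) (f w)"
  proof -
    have "\<gamma> 0 (\<gamma> (i + 2) v) = - \<gamma> (i + 2) (\<gamma> 0 v)"
      using M.anticommute[of 0 "i + 2" v] v i by simp
    then have "M.P (\<gamma> 0 (\<gamma> (i + 2) v)) = - \<gamma> (i + 2) (M.P (\<gamma> 0 v))"
      using M.P_scale[of "\<gamma> (i + 2) (\<gamma> 0 v)" "- 1"] M.P_gamma[of i "\<gamma> 0 v"] v i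
      by (simp add: M.mem M.closed)
    moreover have "\<gamma> (i + 2) (M.P (\<gamma> 0 v)) \<in> M.V_plus"
      using clifford_rep.closed[OF M.V_plus_rep i M.P_plus[of "\<gamma> 0 v"]] v by (simp add: M.mem)
    ultimately have "F (\<gamma> (i + 2) v) =
        \<gamma>' (i + 2) (f (M.P v)) - \<gamma>' 0 (\<gamma>' (i + 2) (f (M.P (\<gamma> 0 v))))"
      using v M.P_gamma[OF i v] fi[of "M.P v"] fi[of "M.P (\<gamma> 0 v)"] N.closed[of "i + 2"] i fV(1)
      by (simp add: F_def fm M.P_plus M.mem N.gamma_minus)
    also have "\<dots> = \<gamma>' (i + 2) (F v)"
      using N.anticommute[of 0 "i + 2" "f (M.P (\<gamma> 0 v))"] v i
      by (simp add: F_def N.gamma_add fV M.P_plus M.mem N.mem)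
    finally show ?thesis .
  qed
  show "N.P (F v) = f (M.P v)" if "v \<in> V" for v
    using that f(2)
    by (simp add: F_def N.P_add fV M.P_plus M.mem N.mem N.P_gamma0_plus)
qed

text \<open>A single involution has an eigenvector: either \<open>v\<close> is fixed, or \<open>\<gamma>\<^sub>0 v - v\<close> is a nonzero eigenvector for
  the eigenvalue \<open>- 1\<close>.\<close>

lemma irreducible_clifford_rep_singleton:
  assumes "irreducible_clifford_rep s V \<gamma>" "s \<le> 1"
  obtains v where "v \<noteq> 0" "V = cspan {v}"
proof -
  interpret clifford_rep s V \<gamma>
    using assms(1) by (simp add: irreducible_clifford_rep_def)
  obtain v where v: "v \<in> V" "v \<noteq> 0"
    using assms(1) complex_vector.subspace_0[OF subspace]
    unfolding irreducible_clifford_rep_def by blast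
  have "\<exists>w\<in>V. w \<noteq> 0 \<and> (\<forall>i<s. \<gamma> i w \<in> cspan {w})"
  proof (cases "s = 1 \<and> \<gamma> 0 v \<noteq> v")
    case True
    let ?w = "\<gamma> 0 v - v"
    have g: "\<gamma> 0 v \<in> V"
      using closed[of 0 v] v True by simp
    have "\<gamma> 0 ?w = - ?w"
      using linear_on_diff[OF linear subspace g v(1), of 0] square[of 0 v] True v by simp
    also have "\<dots> \<in> cspan {?w}"
      by (intro complex_vector.span_neg complex_vector.span_base) simp
    finally show ?thesis
      using True g v complex_vector.subspace_diff[OF subspace, of "\<gamma> 0 v" v]
      by (intro bexI[of _ ?w]) auto
  next
    case False
    show ?thesis
    proof -
      have "\<gamma> i v = v" if "i < s" for i
        using that False assms(2) by (cases "i = 0") auto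
      with v show ?thesis
        by (intro bexI[of _ v]) (auto simp: complex_vector.span_base)
    qed
  qed
  then obtain w where w: "w \<in> V" "w \<noteq> 0" "\<And>i. i < s \<Longrightarrow> \<gamma> i w \<in> cspan {w}"
    by blast
  have sub: "cspan {w} \<subseteq> V"
    using w(1) subspace by (simp add: complex_vector.span_minimal)
  have "\<gamma> i x \<in> cspan {w}" if "i < s" "x \<in> cspan {w}" for i x
  proof -
    obtain c where "x = c *\<^sub>C w"
      using \<open>x \<in> cspan {w}\<close> by (auto simp: complex_vector.span_singleton)
    then show ?thesis
      using complex_vector.span_scale[OF w(3)[OF \<open>i < s\<close>], of c] linear_onD(2)[OF linear[OF \<open>i < s\<close>] w(1)]
      by simp
  qed
  then have "cspan {w} = {0} \<or> cspan {w} = V"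
    using assms(1) sub complex_vector.subspace_span unfolding irreducible_clifford_rep_def by blast
  then have "V = cspan {w}"
    using w(2) complex_vector.span_base[of w "{w}"] by auto
  with w(2) show ?thesis
    by (rule that)
qed

lemma linear_bij_cspan_singleton:
  fixes v :: "'v::complex_vector" and w :: "'w::complex_vector"
  assumes "v \<noteq> 0" "w \<noteq> 0"
  obtains f where "linear_on (cspan {v}) f" "bij_betw f (cspan {v}) (cspan {w})"
proof -
  define f where "f x = (THE c. x = c *\<^sub>C v) *\<^sub>C w" for x
  have f: "f (c *\<^sub>C v) = c *\<^sub>C w" for c
    unfolding f_def using assms(1) by simp
  have "linear_on (cspan {v}) f"
    unfolding linear_on_def complex_vector.span_singleton
    by (auto simp: f scaleC_scaleC simp flip: scaleC_add_left)
  moreover have "bij_betw f (cspan {v}) (cspan {w})"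
    unfolding bij_betw_def inj_on_def complex_vector.span_singleton image_image
    using assms by (auto simp: f image_image)
  ultimately show ?thesis
    by (rule that)
qed

text \<open>Induction in steps of two, along the passage to \<open>V_plus\<close>, down to one-dimensional spaces. The last
  generator has to be exempt: with one generator, the two signs by which it can act on a line give
  representations that are not isomorphic, and this ambiguity persists for every odd \<open>s\<close>.\<close>

theorem irreducible_clifford_rep_unique:
  fixes V :: "'v::complex_vector set" and V' :: "'w::complex_vector set"
  assumes "irreducible_clifford_rep s V \<gamma>" "irreducible_clifford_rep s V' \<gamma>'"
  obtains f where "linear_on V f" "bij_betw f V V'"
    "\<And>i v. Suc i < s \<Longrightarrow> v \<in> V \<Longrightarrow> f (\<gamma> i v) = \<gamma>' i (f v)"
proof -
  have "\<exists>f. linear_on V f \<and> bij_betw f V V' \<and> (\<forall>i v. Suc i < s \<longrightarrow> v \<in> V \<longrightarrow> f (\<gamma> i v) = \<gamma>' i (f v))"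
    using assms
  proof (induction s arbitrary: V V' \<gamma> \<gamma>' rule: induct_nat_012)
    case 0
    then show ?case
      by (metis irreducible_clifford_rep_singleton linear_bij_cspan_singleton not_less_zero zero_le_one)
  next
    case 1
    then show ?case
      by (metis One_nat_def Suc_less_eq irreducible_clifford_rep_singleton le_refl
          linear_bij_cspan_singleton not_less_zero)
  next
    case (ge2 s)
    interpret M: clifford_pair s V \<gamma>
      using ge2.prems(1) by (simp add: clifford_pair_def irreducible_clifford_rep_def)
    interpret N: clifford_pair s V' \<gamma>'
      using ge2.prems(2) by (simp add: clifford_pair_def irreducible_clifford_rep_def)
    obtain f where f: "linear_on M.V_plus f" "bij_betw f M.V_plus N.V_plus"
      "\<And>i v. Suc i < s \<Longrightarrow> v \<in> M.V_plus \<Longrightarrow> f (\<gamma> (i + 2) v) = \<gamma>' (i + 2) (f v)"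
      using ge2.IH(1)[OF M.V_plus_irreducible[OF ge2.prems(1)] N.V_plus_irreducible[OF ge2.prems(2)]]
      by blast
    define g where "g = inv_into M.V_plus f"
    have g: "linear_on N.V_plus g"
      unfolding g_def by (rule linear_on_inverse[OF f(1,2) clifford_rep.subspace[OF M.V_plus_rep]])
    have gm: "g v \<in> M.V_plus" "f (g v) = v" if "v \<in> N.V_plus" for v
      using that f(2) by (auto simp: g_def bij_betw_def inv_into_into f_inv_into_f)
    have fm: "f v \<in> N.V_plus" "g (f v) = v" if "v \<in> M.V_plus" for v
      using that f(2) by (auto simp: g_def bij_betw_def)
    define F where "F v = f (M.P v) + \<gamma>' 0 (f (M.P (\<gamma> 0 v)))" for v
    define G where "G v = g (N.P v) + \<gamma> 0 (g (N.P (\<gamma>' 0 v)))" for v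
    note F = clifford_pair_extend[OF M.clifford_pair_axioms N.clifford_pair_axioms f(1) fm(1) F_def]
    note G = clifford_pair_extend[OF N.clifford_pair_axioms M.clifford_pair_axioms g gm(1) G_def]
    have "G (F v) = v" if "v \<in> V" for v
      using that M.decompose[OF that] F(6)[of v] F(6)[of "\<gamma> 0 v"] F(3)[of v]
      by (simp add: G_def fm M.P_plus M.mem)
    moreover have "F (G v) = v" if "v \<in> V'" for v
      using that N.decompose[OF that] G(6)[of v] G(6)[of "\<gamma>' 0 v"] G(3)[of v]
      by (simp add: F_def gm N.P_plus N.mem)
    ultimately have bij: "bij_betw F V V'"
      using F(2) G(2) by (intro bij_betw_byWitness[where f' = G]) auto
    have "F (\<gamma> i v) = \<gamma>' i (F v)" if "Suc i < Suc (Suc s)" "v \<in> V" for i v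
    proof -
      from Suc_lessD[OF that(1)] show ?thesis
      proof (cases rule: less_add_two_cases)
        case (3 j)
        then show ?thesis
          using that F(5)[of v j] f(3)[of j] by simp
      qed (use F(3,4) that in auto)
    qed
    with F(1) bij show ?case
      by blast
  qed
  then show ?thesis
    using that by blast
qed

section \<open>Existence of irreducible Clifford representations\<close>

text \<open>The Jordan-Wigner representation: the basis vectors are indexed by numbers, read as sets of bits. The
  generator \<open>\<gamma>\<^sub>i\<close> flips bit \<open>i\<close>, with a sign counting the bits set below \<open>i\<close>. Of two distinct
  generators, the flip made by the lower one changes the sign of the higher one but not conversely,
  so they anticommute.\<close>

definition jw_sign :: "nat \<Rightarrow> nat \<Rightarrow> complex"
  where "jw_sign i k = (- 1) ^ card {j. j < i \<and> bit k j}"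

definition jordan_wigner :: "nat \<Rightarrow> (nat \<Rightarrow>\<^sub>0 complex) \<Rightarrow> nat \<Rightarrow>\<^sub>0 complex"
  where "jordan_wigner i = linear_ext (\<lambda>k. Poly_Mapping.single (flip_bit i k) (jw_sign i k))"

lemma jw_sign_square: "jw_sign i k * jw_sign i k = 1"
  by (simp add: jw_sign_def flip: power_add)

lemma jw_sign_flip_ge: "i \<le> j \<Longrightarrow> jw_sign i (flip_bit j k) = jw_sign i k"
  unfolding jw_sign_def by (rule arg_cong[where f = "\<lambda>A. (- 1) ^ card A"]) (auto simp: bit_simps)

lemma jw_sign_flip_less:
  assumes "i < j"
  shows "jw_sign j (flip_bit i k) = - jw_sign j k"
proof -
  let ?A = "{l. l < j \<and> l \<noteq> i \<and> bit k l}"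
  have "card (insert i ?A) = Suc (card ?A)"
    by (rule card_insert_disjoint) auto
  moreover have "{l. l < j \<and> bit k l} = (if bit k i then insert i ?A else ?A)"
    and "{l. l < j \<and> bit (flip_bit i k) l} = (if bit k i then ?A else insert i ?A)"
    using assms by (auto simp: bit_simps)
  ultimately show ?thesis
    by (simp add: jw_sign_def)
qed

lemma jordan_wigner_single:
  "jordan_wigner i (Poly_Mapping.single k c) = c *\<^sub>C Poly_Mapping.single (flip_bit i k) (jw_sign i k)"
  by (cases "c = 0") (simp_all add: jordan_wigner_def linear_ext_def)

lemma scaleC_single: "c *\<^sub>C Poly_Mapping.single k d = Poly_Mapping.single k (c *\<^sub>C d)"
  by (rule poly_mapping_eqI) (simp add: lookup_scaleC lookup_single when_def)

lemma jordan_wigner_linear: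
  "jordan_wigner i (p + q) = jordan_wigner i p + jordan_wigner i q"
  "jordan_wigner i (c *\<^sub>C p) = c *\<^sub>C jordan_wigner i p"
  by (simp_all add: jordan_wigner_def linear_ext_add linear_ext_scaleC)

lemma jordan_wigner_linear_ext:
  "jordan_wigner i (linear_ext F p) = linear_ext (\<lambda>k. jordan_wigner i (F k)) p"
proof -
  have "linear_on UNIV (jordan_wigner i)"
    by (simp add: linear_on_def jordan_wigner_linear)
  then show ?thesis
    by (simp add: linear_ext_def linear_on_sum jordan_wigner_linear)
qed

lemma linear_ext_single: "linear_ext (\<lambda>k. Poly_Mapping.single k c) p = c *\<^sub>C p"
  by (rule poly_mapping_eqI)
    (simp add: linear_ext_def lookup_sum lookup_scaleC lookup_single scaleC_complex_def when_def
      if_distrib in_keys_iff mult.commute cong: if_cong)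

lemma jordan_wigner_anticommutator:
  "jordan_wigner i (jordan_wigner j p) + jordan_wigner j (jordan_wigner i p) = (if i = j then 2 else 0) *\<^sub>C p"
proof -
  have *: "jw_sign j k * jw_sign i (flip_bit j k) + jw_sign i k * jw_sign j (flip_bit i k) =
      (if i = j then 2 else 0)" for k
    by (cases i j rule: linorder_cases)
      (simp_all add: jw_sign_flip_ge jw_sign_flip_less jw_sign_square)
  have flip: "flip_bit i (flip_bit j k) = flip_bit j (flip_bit i k)" "flip_bit i (flip_bit i k) = k" for i j k :: nat
    by (auto intro!: bit_eqI simp: bit_simps)
  have "jordan_wigner i (jordan_wigner j p) + jordan_wigner j (jordan_wigner i p) =
      linear_ext (\<lambda>k. Poly_Mapping.single (flip_bit j (flip_bit i k))
        (jw_sign j k * jw_sign i (flip_bit j k) + jw_sign i k * jw_sign j (flip_bit i k))) p"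
    unfolding jordan_wigner_def[of j, THEN fun_cong, of p] jordan_wigner_def[of i, THEN fun_cong, of p]
    by (simp add: jordan_wigner_linear_ext jordan_wigner_single scaleC_single scaleC_complex_def flip(1)
        single_add flip: linear_ext_fun_add)
  also have "\<dots> = linear_ext (\<lambda>k. Poly_Mapping.single k (if i = j then 2 else 0)) p"
    unfolding * by (rule arg_cong[where f = "\<lambda>F. linear_ext F p"]) (auto simp: flip(2))
  finally show ?thesis
    by (simp add: linear_ext_single)
qed

lemma jordan_wigner_rep:
  "clifford_rep s (cspan {Poly_Mapping.single k 1 | k. k < 2 ^ s}) jordan_wigner"
proof
  let ?B = "{Poly_Mapping.single k 1 | k. k < 2 ^ s} :: (nat \<Rightarrow>\<^sub>0 complex) set"
  show "csubspace (cspan ?B)"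
    by simp
  show "linear_on (cspan ?B) (jordan_wigner i)" for i
    by (simp add: linear_on_def jordan_wigner_linear)
  show "jordan_wigner i v \<in> cspan ?B" if "i < s" "v \<in> cspan ?B" for i v
    using that(2)
  proof (induction rule: complex_vector.span_induct_alt)
    case base
    then show ?case
      by (simp add: jordan_wigner_def linear_ext_def complex_vector.span_zero)
  next
    case (step c x y)
    then obtain k where k: "x = Poly_Mapping.single k 1" "k < 2 ^ s"
      by blast
    have "take_bit s (flip_bit i k) = flip_bit i k"
      using that(1) k(2) by (simp add: take_bit_flip_bit_eq take_bit_nat_eq_self)
    then have "flip_bit i k < 2 ^ s"
      by (metis take_bit_nat_less_exp)
    then have "Poly_Mapping.single (flip_bit i k) 1 \<in> cspan ?B"
      by (intro complex_vector.span_base) blast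
    then have "jordan_wigner i x \<in> cspan ?B"
      unfolding k(1) jordan_wigner_single
      using complex_vector.span_scale[of "Poly_Mapping.single (flip_bit i k) 1" ?B "jw_sign i k"]
      by (simp add: scaleC_single scaleC_complex_def)
    with step show ?case
      by (simp add: jordan_wigner_linear complex_vector.span_add complex_vector.span_scale)
  qed
  show "jordan_wigner i (jordan_wigner j v) + jordan_wigner j (jordan_wigner i v) =
      (if i = j then 2 else 0) *\<^sub>C v" for i j v
    by (rule jordan_wigner_anticommutator)
qed

lemma subspace_finite_basis:
  assumes "csubspace W" "W \<subseteq> cspan B" "finite B"
  obtains C where "finite C" "card C \<le> card B" "C \<subseteq> W" "complex_vector.independent C" "W = cspan C"
proof -
  obtain C where C: "C \<subseteq> W" "complex_vector.independent C" "W \<subseteq> cspan C"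
    using complex_vector.maximal_independent_subset by blast
  then have "finite C \<and> card C \<le> card B"
    using complex_vector.independent_span_bound[of B C] assms(2,3) by blast
  with C show ?thesis
    using that complex_vector.span_minimal[OF C(1) assms(1)] by blast
qed

text \<open>Stated without assuming that the ambient space is finite-dimensional, as the modules are
  finite-dimensional subspaces of \<open>nat \<Rightarrow>\<^sub>0 complex\<close>.\<close>

lemma card_independent_eq_imp_span:
  assumes "complex_vector.independent C" "C \<subseteq> cspan B" "finite B" "card C = card B"
  shows "cspan C = cspan B"
proof -
  have "cspan B \<subseteq> cspan C"
  proof
    fix x
    assume x: "x \<in> cspan B"
    show "x \<in> cspan C"
    proof (rule ccontr)
      assume *: "x \<notin> cspan C"
      then have "complex_vector.independent (insert x C)"
        using assms(1) by (rule complex_vector.independent_insertI)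
      then have "finite (insert x C)" "card (insert x C) \<le> card B"
        using complex_vector.independent_span_bound[OF assms(3), of "insert x C"] x assms(2) by auto
      moreover have "x \<notin> C"
        using * complex_vector.span_base by blast
      ultimately show False
        using assms(4) by simp
    qed
  qed
  moreover have "cspan C \<subseteq> cspan B"
    using assms(2) by (simp add: complex_vector.span_minimal)
  ultimately show ?thesis
    by blast
qed

text \<open>A nonzero invariant subspace of the Jordan-Wigner representation that is spanned by as few vectors as
  possible is irreducible.\<close>

theorem irreducible_clifford_rep_exists:
  obtains V :: "(nat \<Rightarrow>\<^sub>0 complex) set" and \<gamma> and B
  where "irreducible_clifford_rep s V \<gamma>" "finite B" "V = cspan B"
proof -
  let ?B = "{Poly_Mapping.single k 1 | k. k < 2 ^ s} :: (nat \<Rightarrow>\<^sub>0 complex) set"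
  interpret clifford_rep s "cspan ?B" jordan_wigner
    by (rule jordan_wigner_rep)
  define invariant where "invariant V \<longleftrightarrow> V \<noteq> {0} \<and> csubspace V \<and> V \<subseteq> cspan ?B \<and>
    (\<forall>i<s. \<forall>w\<in>V. jordan_wigner i w \<in> V)" for V
  let ?Q = "\<lambda>n. \<exists>B. finite B \<and> card B = n \<and> invariant (cspan B)"
  have "Poly_Mapping.single 0 1 \<in> cspan ?B"
    by (rule complex_vector.span_base) (auto intro!: exI[of _ 0])
  moreover have "Poly_Mapping.single 0 (1::complex) \<noteq> 0"
    by simp
  ultimately have "invariant (cspan ?B)"
    using closed by (auto simp: invariant_def)
  then have "?Q (card ?B)"
    by (intro exI[of _ ?B]) auto
  then have "?Q (LEAST n. ?Q n)"
    by (rule LeastI)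
  then obtain B where B: "finite B" "card B = (LEAST n. ?Q n)" "invariant (cspan B)"
    by blast
  have "W = cspan B" if W: "csubspace W" "W \<subseteq> cspan B" "\<forall>i<s. \<forall>w\<in>W. jordan_wigner i w \<in> W" "W \<noteq> {0}" for W
  proof -
    obtain C where C: "finite C" "card C \<le> card B" "complex_vector.independent C" "W = cspan C"
      using subspace_finite_basis[OF W(1,2) B(1)] by metis
    have "invariant W"
      using W B(3) by (auto simp: invariant_def)
    then have "?Q (card C)"
      using C by blast
    then have "card B \<le> card C"
      unfolding B(2) by (rule Least_le)
    with C show ?thesis
      using card_independent_eq_imp_span[OF C(3) _ B(1)] W(2) complex_vector.span_superset by fastforce
  qed
  moreover have "clifford_rep s (cspan B) jordan_wigner"
    using B(3) linear closed anticommutator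
    unfolding clifford_rep_def invariant_def by (meson linear_on_subset subsetD)
  ultimately have "irreducible_clifford_rep s (cspan B) jordan_wigner"
    using B(3) unfolding irreducible_clifford_rep_def invariant_def by blast
  then show ?thesis
    using B(1) that by blast
qed

section \<open>Linear algebra in finite dimension\<close>

text \<open>Some nonzero polynomial \<open>p\<close> in \<open>f\<close> kills a given nonzero vector \<open>v\<close>, because the iterates \<open>f\<^sup>i v\<close> are
  linearly dependent. Splitting off a root \<open>c\<close>, so that \<open>p = (X - c) q\<close>, either \<open>q(f) v\<close> is an eigenvector
  for \<open>c\<close>, or \<open>q\<close> is an annihilating polynomial of smaller degree.\<close>

lemma eigenvector_exists:
  fixes f :: "'v::complex_vector \<Rightarrow> 'v"
  assumes V: "csubspace V" "V \<subseteq> cspan B" "finite B" "V \<noteq> {0}"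
    and f: "linear_on V f" "\<And>v. v \<in> V \<Longrightarrow> f v \<in> V"
  obtains c v where "v \<in> V" "v \<noteq> 0" "f v = c *\<^sub>C v"
proof -
  \<comment> \<open>\<open>ev p v\<close> is \<open>p(f) v\<close>.\<close>
  define ev where "ev p v = (\<Sum>i\<le>degree p. coeff p i *\<^sub>C (f ^^ i) v)" for p v
  have pow: "(f ^^ i) v \<in> V" if "v \<in> V" for i v
    using that f(2) by (induction i) auto
  have ev_ge: "ev p v = (\<Sum>i\<le>n. coeff p i *\<^sub>C (f ^^ i) v)" if "degree p \<le> n" for p n v
    unfolding ev_def using that by (intro sum.mono_neutral_left) (auto simp: coeff_eq_0)
  have ev_mem: "ev p v \<in> V" if "v \<in> V" for p v
    unfolding ev_def using that pow V(1)
    by (intro complex_vector.subspace_sum complex_vector.subspace_scale) auto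
  have factor: "ev ([:- c, 1:] * q) v = f (ev q v) - c *\<^sub>C ev q v" if v: "v \<in> V" for c q v
  proof -
    let ?n = "Suc (degree q)"
    have "degree ([:- c, 1:] * q) \<le> ?n"
      using degree_mult_le[of "[:- c, 1:]" q] by simp
    then have "ev ([:- c, 1:] * q) v = (\<Sum>i\<le>?n. coeff ([:- c, 1:] * q) i *\<^sub>C (f ^^ i) v)"
      by (rule ev_ge)
    also have "\<dots> = (\<Sum>i\<le>?n. coeff (pCons 0 q) i *\<^sub>C (f ^^ i) v) - (\<Sum>i\<le>?n. (c * coeff q i) *\<^sub>C (f ^^ i) v)"
      by (simp add: complex_vector.scale_left_diff_distrib sum_subtractf algebra_simps
          complex_vector.scale_left_distrib complex_vector.scale_minus_left sum.distrib sum_negf del: sum.atMost_Suc)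
    also have "(\<Sum>i\<le>?n. coeff (pCons 0 q) i *\<^sub>C (f ^^ i) v) = (\<Sum>i\<le>degree q. coeff q i *\<^sub>C f ((f ^^ i) v))"
      by (subst sum.atMost_Suc_shift) simp
    also have "\<dots> = f (ev q v)"
      unfolding ev_def using v pow V(1)
      by (simp add: linear_on_sum[OF f(1) V(1)] linear_onD(2)[OF f(1)] complex_vector.subspace_scale)
    also have "(\<Sum>i\<le>?n. (c * coeff q i) *\<^sub>C (f ^^ i) v) = c *\<^sub>C ev q v"
      unfolding ev_ge[of q ?n v, simplified]
      by (simp add: complex_vector.scale_sum_right scaleC_scaleC scaleC_add_right)
    finally show ?thesis .
  qed
  have main: "\<exists>c w. w \<in> V \<and> w \<noteq> 0 \<and> f w = c *\<^sub>C w" if "p \<noteq> 0" "v \<in> V" "v \<noteq> 0" "ev p v = 0" for p v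
    using that
  proof (induction "degree p" arbitrary: p rule: less_induct)
    case less
    have "degree p \<noteq> 0"
    proof
      assume "degree p = 0"
      then obtain a where "p = [:a:]"
        by (auto elim: degree_eq_zeroE)
      with less.prems show False
        by (simp add: ev_def)
    qed
    then have "\<not> constant (poly p)"
      by (simp add: constant_degree)
    then obtain c where "poly p c = 0"
      using fundamental_theorem_of_algebra by blast
    then obtain q where q: "p = [:- c, 1:] * q"
      by (auto simp: poly_eq_0_iff_dvd)
    with less.prems have "q \<noteq> 0"
      by auto
    show ?case
    proof (cases "ev q v = 0")
      case True
      have "degree q < degree p"
        using \<open>q \<noteq> 0\<close> by (subst q) (simp add: degree_mult_eq del: mult_pCons_left)
      with less True \<open>q \<noteq> 0\<close> show ?thesis
        by blast
    next
      case False
      then show ?thesis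
        using less.prems factor[of v c q] ev_mem[of v q] q by auto
    qed
  qed
  obtain v where v: "v \<in> V" "v \<noteq> 0"
    using V(1,4) complex_vector.subspace_0 by blast
  have "\<exists>p. p \<noteq> 0 \<and> ev p v = 0"
  proof (cases "inj_on (\<lambda>i. (f ^^ i) v) {..card B}")
    case True
    let ?S = "(\<lambda>i. (f ^^ i) v) ` {..card B}"
    have "card ?S = Suc (card B)"
      using True by (simp add: card_image)
    then have "complex_vector.dependent ?S"
      using complex_vector.independent_span_bound[OF V(3), of ?S] pow[OF v(1)] V(2) by fastforce
    then obtain u where u: "(\<Sum>x\<in>?S. u x *\<^sub>C x) = 0" "\<exists>x\<in>?S. u x \<noteq> 0"
      by (auto simp: complex_vector.dependent_finite)
    define p where "p = (\<Sum>i\<le>card B. monom (u ((f ^^ i) v)) i)"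
    have coeff: "coeff p i = (if i \<le> card B then u ((f ^^ i) v) else 0)" for i
      unfolding p_def by (simp add: coeff_sum)
    then have "degree p \<le> card B"
      by (intro degree_le) auto
    then have "ev p v = 0"
      using u(1) True by (simp add: ev_ge coeff sum.reindex)
    moreover have "p \<noteq> 0"
      using u(2) coeff by (metis (no_types, lifting) atMost_iff coeff_0 imageE)
    ultimately show ?thesis
      by blast
  next
    case False
    then obtain i j where ij: "i < j" "(f ^^ i) v = (f ^^ j) v"
      unfolding inj_on_def by (metis linorder_neq_iff)
    define p where "p = monom 1 j - monom (1::complex) i"
    have "degree p \<le> j"
      using ij(1) unfolding p_def by (intro degree_diff_le) (auto simp: degree_monom_eq)
    then have "ev p v = (\<Sum>k\<le>j. coeff p k *\<^sub>C (f ^^ k) v)"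
      by (rule ev_ge)
    also have "\<dots> = (\<Sum>k\<le>j. if j = k then (f ^^ k) v else 0) - (\<Sum>k\<le>j. if i = k then (f ^^ k) v else 0)"
      unfolding sum_subtractf[symmetric] p_def
      by (intro sum.cong) (auto simp: coeff_monom scaleC_one)
    also have "\<dots> = 0"
      using ij by simp
    finally have "ev p v = 0" .
    moreover have "coeff p j \<noteq> 0"
      using ij(1) by (simp add: p_def)
    then have "p \<noteq> 0"
      by auto
    ultimately show ?thesis
      by blast
  qed
  then show ?thesis
    using main v that by blast
qed

text \<open>Adding one map \<open>L k\<close> at a time: the image under \<open>L k\<close> of the common kernel of the previous maps is
  finite-dimensional, and preimages of a basis of it, taken inside that kernel, extend the
  complement.\<close>

lemma finite_codimension_kernel:
  fixes L :: "'i \<Rightarrow> 'a::complex_vector \<Rightarrow> 'v::complex_vector"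
  assumes "finite K" "finite B" and L: "\<And>i. i \<in> K \<Longrightarrow> linear_on UNIV (L i)" "\<And>i a. i \<in> K \<Longrightarrow> L i a \<in> cspan B"
  shows "finite_codimension {a. \<forall>i\<in>K. L i a = 0}"
proof -
  have "\<exists>F. finite F \<and> (\<forall>a. \<exists>b\<in>cspan F. \<forall>i\<in>K. L i (a - b) = 0)"
    using assms(1) L
  proof (induction K)
    case empty
    then show ?case
      by (intro exI[of _ "{}"]) simp
  next
    case (insert k K)
    then obtain F where F: "finite F" "\<And>a. \<exists>b\<in>cspan F. \<forall>i\<in>K. L i (a - b) = 0"
      by blast
    let ?S = "{a. \<forall>i\<in>K. L i a = 0}"
    have lin: "linear_on UNIV (L i)" if "i \<in> insert k K" for i
      using insert.prems(1) that by blast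
    have L0: "L i 0 = 0" if "i \<in> insert k K" for i
      using lin[OF that] by (rule linear_on_0) simp
    have S: "csubspace ?S"
      using lin L0 by (auto intro!: complex_vector.subspaceI simp: linear_onD[OF lin])
    have "csubspace (L k ` ?S)"
    proof (rule complex_vector.subspaceI)
      show "0 \<in> L k ` ?S"
        using L0 complex_vector.subspace_0[OF S] by (metis (no_types, lifting) imageI insertI1)
      show "x + y \<in> L k ` ?S" if "x \<in> L k ` ?S" "y \<in> L k ` ?S" for x y
        using that complex_vector.subspace_add[OF S] linear_onD(1)[OF lin[of k]]
        by (smt (verit) UNIV_I image_iff insertI1)
      show "c *\<^sub>C x \<in> L k ` ?S" if "x \<in> L k ` ?S" for c x
        using that complex_vector.subspace_scale[OF S] linear_onD(2)[OF lin[of k]]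
        by (smt (verit) UNIV_I image_iff insertI1)
    qed
    moreover have "L k ` ?S \<subseteq> cspan B"
      using insert.prems(2) by blast
    ultimately obtain C where C: "finite C" "C \<subseteq> L k ` ?S" "L k ` ?S = cspan C"
      using assms(2) by (rule subspace_finite_basis)
    obtain G where G: "G \<subseteq> ?S" "finite G" "C = L k ` G"
      using finite_subset_image[OF C(1,2)] by blast
    have span_image: "\<exists>b\<in>cspan G. L k b = x" if "x \<in> cspan C" for x
      using that
    proof (induction rule: complex_vector.span_induct_alt)
      case base
      then show ?case
        using L0 complex_vector.span_zero by blast
    next
      case (step c x y)
      then obtain g b where "g \<in> G" "x = L k g" "b \<in> cspan G" "y = L k b"
        using G(3) by blast
      then show ?case
        using linear_onD[OF lin[of k]]
        by (intro bexI[of _ "c *\<^sub>C g + b"])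
          (auto intro: complex_vector.span_add complex_vector.span_scale complex_vector.span_base)
    qed
    have "\<exists>b\<in>cspan (F \<union> G). \<forall>i\<in>insert k K. L i (a - b) = 0" for a
    proof -
      obtain b where b: "b \<in> cspan F" "\<forall>i\<in>K. L i (a - b) = 0"
        using F(2) by blast
      then have "L k (a - b) \<in> cspan C"
        using C(3) by blast
      then obtain b' where b': "b' \<in> cspan G" "L k b' = L k (a - b)"
        using span_image by blast
      have "b' \<in> ?S"
        using b'(1) complex_vector.span_minimal[OF G(1) S] by blast
      then have "L i (a - b - b') = 0" if "i \<in> insert k K" for i
        using that b b' linear_on_diff[OF lin[OF that], of "a - b" b'] by auto
      moreover have "b + b' \<in> cspan (F \<union> G)"
        using b(1) b'(1) complex_vector.span_mono[of F "F \<union> G"] complex_vector.span_mono[of G "F \<union> G"]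
        by (blast intro: complex_vector.span_add)
      ultimately show ?thesis
        by (intro bexI[of _ "b + b'"]) (auto simp: diff_diff_add)
    qed
    with F(1) G(2) show ?case
      by (intro exI[of _ "F \<union> G"]) auto
  qed
  then obtain F where F: "finite F" "\<And>a. \<exists>b\<in>cspan F. \<forall>i\<in>K. L i (a - b) = 0"
    by blast
  let ?S = "{a. \<forall>i\<in>K. L i a = 0}"
  have "a \<in> cspan (?S \<union> F)" for a
  proof -
    obtain b where b: "b \<in> cspan F" "a - b \<in> ?S"
      using F(2) by blast
    have "(a - b) + b \<in> cspan (?S \<union> F)"
      using b complex_vector.span_mono[of F "?S \<union> F"]
      by (blast intro: complex_vector.span_add complex_vector.span_base)
    then show ?thesis
      by simp
  qed
  with F(1) show ?thesis
    unfolding finite_codimension_def by blast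
qed

lemma finite_codimension_mono:
  assumes "finite_codimension S" "S \<subseteq> S'"
  shows "finite_codimension S'"
proof -
  obtain F where F: "finite F" "cspan (S \<union> F) = UNIV"
    using assms(1) by (auto simp: finite_codimension_def)
  have "cspan (S \<union> F) \<subseteq> cspan (S' \<union> F)"
    using assms(2) by (intro complex_vector.span_mono) auto
  with F show ?thesis
    unfolding finite_codimension_def by blast
qed

section \<open>Orthonormal bases modulo the radical\<close>

definition radical_on :: "'g set \<Rightarrow> ('g \<Rightarrow> 'g \<Rightarrow> complex) \<Rightarrow> 'g set"
  where "radical_on U \<beta> = {x \<in> U. \<forall>y\<in>U. \<beta> x y = 0}"

text \<open>An orthonormal family inside the span of \<open>F\<close> is linearly independent, so its size is bounded and one
  of maximal size exists. On the orthogonal complement of a maximal family the form has no vector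
  with \<open>\<beta>(x, x) \<noteq> 0\<close>, as such a vector could be normalised and added (every complex number has a
  square root). By polarization the form vanishes there, so the complement consists of radical
  vectors. The normalisation \<open>\<beta>(e, e) = 2\<close> makes \<open>e\<close> act as an involution, since \<open>2 e\<^sup>2 = \<beta>(e, e)\<close>.\<close>

lemma orthonormal_basis_mod_radical:
  fixes U :: "'g::complex_vector set"
  assumes U: "csubspace U"
    and lin: "\<And>x. x \<in> U \<Longrightarrow> linear_on U (\<beta> x)"
    and sym: "\<And>x y. x \<in> U \<Longrightarrow> y \<in> U \<Longrightarrow> \<beta> x y = \<beta> y x"
    and F: "finite F" "F \<subseteq> U"
    and span: "\<And>x. x \<in> U \<Longrightarrow> \<exists>a\<in>cspan F. x - a \<in> radical_on U \<beta>"
  obtains r :: nat and e where "\<And>i. i < r \<Longrightarrow> e i \<in> U"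
    "\<And>i j. i < r \<Longrightarrow> j < r \<Longrightarrow> \<beta> (e i) (e j) = (if i = j then 2 else 0)"
    "\<And>x. x \<in> U \<Longrightarrow> x - (\<Sum>i<r. (\<beta> (e i) x / 2) *\<^sub>C e i) \<in> radical_on U \<beta>"
proof -
  have FU: "cspan F \<subseteq> U"
    using F(2) U by (rule complex_vector.span_minimal)
  have add: "\<beta> x (y + z) = \<beta> x y + \<beta> x z" "\<beta> (y + z) x = \<beta> y x + \<beta> z x"
    if "x \<in> U" "y \<in> U" "z \<in> U" for x y z
    using that linear_onD(1)[OF lin] complex_vector.subspace_add[OF U] by (simp_all add: sym[of _ x])
  have diff: "\<beta> x (y - z) = \<beta> x y - \<beta> x z" if "x \<in> U" "y \<in> U" "z \<in> U" for x y z
    using that linear_on_diff[OF lin U] by simp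
  have scale: "\<beta> x (c *\<^sub>C y) = c * \<beta> x y" "\<beta> (c *\<^sub>C y) x = c * \<beta> y x" if "x \<in> U" "y \<in> U" for x y c
    using that linear_onD(2)[OF lin] complex_vector.subspace_scale[OF U]
    by (simp_all add: sym[of _ x] scaleC_complex_def)
  have sumU: "(\<Sum>i\<in>I. c i *\<^sub>C g i) \<in> U" if "\<And>i. i \<in> I \<Longrightarrow> g i \<in> U" for I :: "nat set" and c g
    using that by (intro complex_vector.subspace_sum[OF U] complex_vector.subspace_scale[OF U])
  have \<beta>sum: "\<beta> x (\<Sum>i\<in>I. c i *\<^sub>C g i) = (\<Sum>i\<in>I. c i * \<beta> x (g i))"
    if "x \<in> U" "\<And>i. i \<in> I \<Longrightarrow> g i \<in> U" for x and I :: "nat set" and c g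
    using that linear_on_sum[OF lin U, of x I "\<lambda>i. c i *\<^sub>C g i"] scale(1)
    by (simp add: complex_vector.subspace_scale[OF U])
  define onb where "onb r e \<longleftrightarrow> (\<forall>i<r. e i \<in> cspan F) \<and>
    (\<forall>i<r. \<forall>j<r. \<beta> (e i) (e j) = (if i = j then 2 else 0))" for r and e :: "nat \<Rightarrow> 'g"
  have bound: "r \<le> card F" if "onb r e" for r e
  proof -
    have e: "e i \<in> U" "e i \<in> cspan F" if "i < r" for i
      using that \<open>onb r e\<close> FU by (auto simp: onb_def)
    have inj: "inj_on e {..<r}"
      using \<open>onb r e\<close> by (auto simp: inj_on_def onb_def) (metis zero_neq_numeral)
    have "complex_vector.independent (e ` {..<r})"
    proof (rule complex_vector.independent_if_scalars_zero)
      fix f x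
      assume f: "(\<Sum>x\<in>e ` {..<r}. f x *\<^sub>C x) = 0" and x: "x \<in> e ` {..<r}"
      then obtain j where j: "j < r" "x = e j"
        by blast
      have "0 = \<beta> (e j) (\<Sum>i<r. f (e i) *\<^sub>C e i)"
        using f inj linear_on_0[OF lin U] e(1) j by (simp add: sum.reindex)
      also have "\<dots> = (\<Sum>i<r. f (e i) * \<beta> (e j) (e i))"
        using e j by (intro \<beta>sum) auto
      also have "\<dots> = (\<Sum>i<r. if j = i then 2 * f (e i) else 0)"
        using \<open>onb r e\<close> j by (intro sum.cong) (auto simp: onb_def)
      also have "\<dots> = 2 * f x"
        using j by simp
      finally show "f x = 0"
        by simp
    qed simp
    then have "card (e ` {..<r}) \<le> card F"
      using complex_vector.independent_span_bound[OF F(1)] e(2) by blast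
    with inj show ?thesis
      by (simp add: card_image)
  qed
  have "\<exists>r. (\<exists>e. onb r e) \<and> (\<forall>r'. (\<exists>e. onb r' e) \<longrightarrow> r' \<le> r)"
    by (rule Nat.ex_has_greatest_nat[where k = 0 and b = "card F"]) (use bound in \<open>auto simp: onb_def\<close>)
  then obtain r e where onb: "onb r e" and max: "\<And>r' e'. onb r' e' \<Longrightarrow> r' \<le> r"
    by blast
  have e: "e i \<in> U" "e i \<in> cspan F" if "i < r" for i
    using that onb FU by (auto simp: onb_def)
  have ee: "\<beta> (e i) (e j) = (if i = j then 2 else 0)" if "i < r" "j < r" for i j
    using that onb by (auto simp: onb_def)
  define pr where "pr x = (\<Sum>i<r. (\<beta> (e i) x / 2) *\<^sub>C e i)" for x
  have prU: "pr x \<in> U" for x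
    unfolding pr_def using e by (intro sumU) auto
  have pr_F: "pr x \<in> cspan F" for x
    unfolding pr_def using e by (intro complex_vector.span_sum complex_vector.span_scale) auto
  have \<beta>pr: "\<beta> (e j) (pr x) = \<beta> (e j) x" if "j < r" for j x
  proof -
    have "\<beta> (e j) (pr x) = (\<Sum>i<r. (\<beta> (e i) x / 2) * \<beta> (e j) (e i))"
      unfolding pr_def using e that by (intro \<beta>sum) auto
    also have "\<dots> = (\<Sum>i<r. if j = i then \<beta> (e i) x else 0)"
      using ee that by (intro sum.cong) auto
    finally show ?thesis
      using that by simp
  qed
  let ?C = "{x \<in> cspan F. \<forall>i<r. \<beta> (e i) x = 0}"
  have isotropic: "\<beta> x x = 0" if x: "x \<in> ?C" for x
  proof (rule ccontr)
    assume *: "\<beta> x x \<noteq> 0"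
    define c where "c = csqrt (2 / \<beta> x x)"
    have c: "c * (c * \<beta> x x) = 2"
      using * power2_csqrt[of "2 / \<beta> x x"] by (simp add: c_def power2_eq_square flip: mult.assoc)
    have xU: "x \<in> U"
      using x FU by blast
    have "onb (Suc r) (e(r := c *\<^sub>C x))"
      unfolding onb_def using x xU e ee c sym[OF xU e(1)]
      by (auto simp: less_Suc_eq scale complex_vector.subspace_scale[OF U] complex_vector.span_scale)
    then show False
      using max by fastforce
  qed
  have C_rad: "x \<in> radical_on U \<beta>" if x: "x \<in> ?C" for x
    unfolding radical_on_def
  proof safe
    show xU: "x \<in> U"
      using x FU by blast
    fix y
    assume y: "y \<in> U"
    obtain a where a: "a \<in> cspan F" "y - a \<in> radical_on U \<beta>"
      using span[OF y] by blast
    have aU: "a \<in> U"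
      using a(1) FU by blast
    let ?z = "a - pr a"
    have z: "?z \<in> ?C"
      using a(1) pr_F e(1) \<beta>pr aU prU diff by (auto intro: complex_vector.span_diff)
    have zU: "?z \<in> U"
      using z FU by blast
    have "x + ?z \<in> ?C"
      using x z xU zU e(1) add(1) by (auto intro: complex_vector.span_add)
    then have "\<beta> (x + ?z) (x + ?z) = 0"
      by (rule isotropic)
    then have "\<beta> x ?z = 0"
      using xU zU isotropic[OF x] isotropic[OF z] complex_vector.subspace_add[OF U xU zU]
      by (simp add: add sym[of ?z x])
    moreover have "\<beta> x (pr a) = (\<Sum>i<r. (\<beta> (e i) a / 2) * \<beta> x (e i))"
      unfolding pr_def using e xU by (intro \<beta>sum) auto
    moreover have "\<beta> x (e i) = 0" if "i < r" for i
      using that x e(1) xU sym[of x "e i"] by auto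
    moreover have "\<beta> x (y - a) = 0"
      using a(2) xU y aU complex_vector.subspace_diff[OF U y aU] sym[of x "y - a"]
      by (simp add: radical_on_def)
    ultimately show "\<beta> x y = 0"
      using diff[OF xU y aU] diff[OF xU aU prU[of a]] by simp
  qed
  show ?thesis
  proof (rule that[of r e])
    fix x
    assume x: "x \<in> U"
    obtain a where a: "a \<in> cspan F" "x - a \<in> radical_on U \<beta>"
      using span[OF x] by blast
    have aU: "a \<in> U"
      using a(1) FU by blast
    have "a - pr a \<in> radical_on U \<beta>"
      using a(1) pr_F e(1) \<beta>pr aU prU diff by (intro C_rad) (auto intro: complex_vector.span_diff)
    moreover have "\<beta> (e i) a = \<beta> (e i) x" if "i < r" for i
    proof -
      have "\<beta> (e i) (x - a) = 0"
        using a(2) e(1)[OF that] complex_vector.subspace_diff[OF U x aU] sym[of "e i" "x - a"]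
        by (simp add: radical_on_def)
      then show ?thesis
        using diff[OF e(1)[OF that] x aU] by simp
    qed
    then have "pr a = pr x"
      by (simp add: pr_def)
    ultimately have "a - pr x \<in> radical_on U \<beta>"
      by simp
    moreover have "u + w \<in> radical_on U \<beta>" if "u \<in> radical_on U \<beta>" "w \<in> radical_on U \<beta>" for u w
      using that add(2) complex_vector.subspace_add[OF U] unfolding radical_on_def by simp
    ultimately have "(x - a) + (a - pr x) \<in> radical_on U \<beta>"
      using a(2) by blast
    then show "x - (\<Sum>i<r. (\<beta> (e i) x / 2) *\<^sub>C e i) \<in> radical_on U \<beta>"
      by (simp add: pr_def)
  qed (use e ee in auto)
qed

section \<open>The Cartan subalgebra\<close>

definition diag :: "complex^'m \<Rightarrow> complex^'m^'m"
  where "diag a = (\<chi> i j. if i = j then a $ i else 0)"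

lemma diag_mult: "diag a ** diag b = diag (\<chi> i. a $ i * b $ i)"
proof -
  have "(\<Sum>k\<in>UNIV. diag a $ i $ k * diag b $ k $ j) =
      (\<Sum>k\<in>UNIV. if i = k then a $ k * diag b $ k $ j else 0)" for i j
    by (rule sum.cong) (auto simp: diag_def)
  then show ?thesis
    by (simp add: matrix_matrix_mult_def vec_eq_iff) (simp add: diag_def)
qed

lemma diag_add: "diag (a + b) = diag a + diag b"
  by (simp add: diag_def vec_eq_iff)

lemma diag_scaleC: "diag (c *\<^sub>C a) = c *\<^sub>C diag a"
  by (simp add: diag_def vec_eq_iff scaleC_complex_def)

lemma trace_diag: "trace (diag a) = (\<Sum>i\<in>UNIV. a $ i)"
  by (simp add: diag_def trace_def)

lemma diagonal_diag: "diagonal (diag a)"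
  by (simp add: diag_def diagonal_def)

lemma diagonalE:
  assumes "diagonal a"
  obtains b where "a = diag b"
  using assms by (intro that[of "\<chi> i. a $ i $ i"]) (auto simp: diag_def diagonal_def vec_eq_iff)

text \<open>In \<open>q(n)\<close> the scalar matrices vanish, so the trace condition on the even part can be dropped: every
  diagonal matrix agrees with a traceless one modulo scalars. This makes \<open>even_diag\<close> linear on the
  whole space. The odd part needs the trace condition already to lie in the derived algebra.\<close>

definition even_diag :: "complex^'m \<Rightarrow> 'm::finite queer"
  where "even_diag a = abs_queer (block (diag a) 0 0 (diag a))"

definition odd_diag :: "complex^'m \<Rightarrow> 'm::finite queer"
  where "odd_diag b = abs_queer (block 0 (diag b) (diag b) 0)"

definition traceless :: "(complex^'m) set"
  where "traceless = {b. (\<Sum>i\<in>UNIV. b $ i) = 0}"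

lemma subspace_traceless: "csubspace traceless"
  by (rule complex_vector.subspaceI)
    (simp_all add: traceless_def sum.distrib scaleC_complex_def flip: sum_distrib_left)

lemma even_diag_queer_tilde: "block (diag a) 0 0 (diag a) \<in> queer_tilde"
  unfolding queer_tilde_def by (force simp: trace_def)

lemma odd_diag_queer_tilde: "b \<in> traceless \<Longrightarrow> block 0 (diag b) (diag b) 0 \<in> queer_tilde"
  unfolding queer_tilde_def traceless_def by (force simp: trace_diag)

lemma abs_queer_hom:
  "x \<in> queer_tilde \<Longrightarrow> y \<in> queer_tilde \<Longrightarrow> abs_queer (x + y) = abs_queer x + abs_queer y"
  "x \<in> queer_tilde \<Longrightarrow> abs_queer (c *\<^sub>C x) = c *\<^sub>C abs_queer x"
  "x \<in> queer_tilde \<Longrightarrow> y \<in> queer_tilde \<Longrightarrow>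
    queer_bracket (abs_queer x) (abs_queer y) = abs_queer (matrix_bracket x y)"
  by (simp_all add: plus_queer.abs_eq scaleC_queer.abs_eq queer_bracket.abs_eq queer_rel_refl)

lemma linear_even_diag: "linear_on UNIV even_diag"
  by (simp add: linear_on_def even_diag_def even_diag_queer_tilde diag_add diag_scaleC block_add block_scaleC
      flip: abs_queer_hom)

lemma linear_odd_diag: "linear_on traceless odd_diag"
  by (simp add: linear_on_def odd_diag_def odd_diag_queer_tilde diag_add diag_scaleC block_add block_scaleC
      flip: abs_queer_hom)

lemma even_diag_const: "even_diag (\<chi> i. c) = 0"
proof -
  have "queer_rel (block (diag (\<chi> i. c)) 0 0 (diag (\<chi> i. c)) :: 'a bmat) 0"
    unfolding queer_rel_def
  proof (intro conjI even_diag_queer_tilde queer_tilde_closed exI[of _ c])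
    show "block (diag (\<chi> i. c)) 0 0 (diag (\<chi> i. c)) - 0 = c *\<^sub>C (mat 1 :: 'a bmat)"
      unfolding block_1 block_scaleC by (simp add: bmat_eq_iff diag_def mat_def scaleC_complex_def)
  qed
  then show ?thesis
    unfolding even_diag_def zero_queer_def by (simp add: Quotient_rel_abs[OF Quotient_queer])
qed

lemma cartan_even: "cartan 0 = range even_diag"
proof
  show "cartan 0 \<subseteq> range (even_diag :: _ \<Rightarrow> 'a queer)"
    unfolding cartan_def even_diag_def by (auto elim!: diagonalE)
  show "range even_diag \<subseteq> (cartan 0 :: 'a queer set)"
  proof safe
    fix a :: "complex^'a"
    define c where "c = (\<Sum>i\<in>UNIV. a $ i) / CARD('a)"
    have "even_diag (a - (\<chi> i. c)) = even_diag a"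
      using linear_on_diff[OF linear_even_diag complex_vector.subspace_UNIV, of a "\<chi> i. c"] even_diag_const[of c] by simp
    moreover have "trace (diag (a - (\<chi> i. c))) = 0"
      by (simp add: trace_diag sum_subtractf c_def)
    moreover have "even_diag b \<in> cartan 0" if "trace (diag b) = 0" for b :: "complex^'a"
      unfolding cartan_def even_diag_def using that diagonal_diag[of b] by auto
    ultimately show "even_diag a \<in> cartan 0"
      by metis
  qed
qed

lemma cartan_odd: "cartan 1 = odd_diag ` traceless"
proof
  show "cartan 1 \<subseteq> (odd_diag ` traceless :: 'a queer set)"
    unfolding cartan_def odd_diag_def traceless_def by (auto simp: trace_diag elim!: diagonalE)
  have "odd_diag b \<in> cartan 1" if "b \<in> traceless" for b :: "complex^'a"
  proof -
    have "trace (diag b) = 0"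
      using that by (simp add: trace_diag traceless_def)
    then show ?thesis
      unfolding cartan_def odd_diag_def using diagonal_diag[of b] by auto
  qed
  then show "odd_diag ` traceless \<subseteq> (cartan 1 :: 'a queer set)"
    by blast
qed

lemma bracket_diag:
  "queer_bracket (even_diag a) (even_diag b) = 0"
  "b \<in> traceless \<Longrightarrow> queer_bracket (even_diag a) (odd_diag b) = 0"
  "b \<in> traceless \<Longrightarrow> queer_bracket (odd_diag b) (even_diag a) = 0"
  "b \<in> traceless \<Longrightarrow> c \<in> traceless \<Longrightarrow>
    queer_bracket (odd_diag b) (odd_diag c) = 2 *\<^sub>C even_diag (\<chi> i. b $ i * c $ i)"
proof -
  have z: "abs_queer (block 0 0 0 0) = 0"
    by (simp add: zero_queer_def flip: block_0)
  have diag_commute: "diag a ** diag b = diag b ** diag a" for a b :: "complex^'a"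
    by (simp add: diag_mult mult.commute)
  note simps = even_diag_def odd_diag_def abs_queer_hom even_diag_queer_tilde odd_diag_queer_tilde
    matrix_bracket_block
  show "queer_bracket (even_diag a) (even_diag b) = 0"
    by (simp add: simps diag_commute[of a b] z)
  show "queer_bracket (even_diag a) (odd_diag b) = 0" "queer_bracket (odd_diag b) (even_diag a) = 0"
    if "b \<in> traceless"
    using that by (simp_all add: simps diag_commute[of a b] z)
  show "queer_bracket (odd_diag b) (odd_diag c) = 2 *\<^sub>C even_diag (\<chi> i. b $ i * c $ i)"
    if "b \<in> traceless" "c \<in> traceless"
    using that
    by (simp add: simps diag_mult mult.commute double_scaleC block_scaleC
        flip: abs_queer_hom(2)[OF even_diag_queer_tilde])
qed

lemma vec_eq_sum_axis: "(a :: complex^'m::finite) = (\<Sum>k\<in>UNIV. a $ k *\<^sub>C axis k 1)"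
  by (simp add: vec_eq_iff sum_component axis_def scaleC_complex_def if_distrib cong: if_cong)

lemma even_diag_sum: "even_diag a = (\<Sum>k\<in>UNIV. a $ k *\<^sub>C even_diag (axis k 1))"
  by (subst vec_eq_sum_axis)
    (simp add: linear_on_sum[OF linear_even_diag] linear_onD(2)[OF linear_even_diag])

lemma axis_diff_traceless: "axis k 1 - axis l 1 \<in> traceless"
  by (simp add: traceless_def sum_subtractf axis_def)

lemma cartan_odd_finite_span:
  obtains D :: "'m::finite queer set" where "finite D" "D \<subseteq> cartan 1" "cartan 1 \<subseteq> cspan D"
proof
  let ?D = "range (\<lambda>(k, l). odd_diag (axis k 1 - axis l 1)) :: 'm queer set"
  show "finite ?D"
    by simp
  show "?D \<subseteq> cartan 1"
    unfolding cartan_odd using axis_diff_traceless by fast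
  show "cartan 1 \<subseteq> cspan ?D"
    unfolding cartan_odd
  proof safe
    fix b :: "complex^'m"
    assume b: "b \<in> traceless"
    obtain l :: 'm where True
      by simp
    have "(\<Sum>k\<in>UNIV. b $ k *\<^sub>C (axis k 1 - axis l 1)) = b - (\<Sum>k\<in>UNIV. b $ k) *\<^sub>C axis l 1"
      by (subst (3) vec_eq_sum_axis)
        (simp add: complex_vector.scale_right_diff_distrib sum_subtractf complex_vector.scale_sum_left)
    then have "b = (\<Sum>k\<in>UNIV. b $ k *\<^sub>C (axis k 1 - axis l 1))"
      using b by (simp add: traceless_def)
    then have "odd_diag b = odd_diag (\<Sum>k\<in>UNIV. b $ k *\<^sub>C (axis k 1 - axis l 1))"
      by simp
    also have "\<dots> = (\<Sum>k\<in>UNIV. b $ k *\<^sub>C odd_diag (axis k 1 - axis l 1))"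
      by (simp add: linear_on_sum[OF linear_odd_diag subspace_traceless] linear_onD(2)[OF linear_odd_diag]
          axis_diff_traceless complex_vector.subspace_scale[OF subspace_traceless])
    also have "\<dots> \<in> cspan ?D"
      by (intro complex_vector.span_sum complex_vector.span_scale complex_vector.span_base)
        (auto intro!: image_eqI[where x = "(_, l)"])
    finally show "odd_diag b \<in> cspan ?D" .
  qed
qed

text \<open>The equality \<open>[h\<^sub>1, h\<^sub>1] = h\<^sub>0\<close>: for distinct indices \<open>k\<close>, \<open>l\<close>, \<open>p\<close> the traceless diagonal matrices
  \<open>E\<^sub>k - E\<^sub>l\<close> and \<open>E\<^sub>k - E\<^sub>p\<close> have product \<open>E\<^sub>k\<close>. Three indices are needed.\<close>

lemma even_diag_axis_bracket:
  assumes "CARD('m::finite) \<ge> 3"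
  obtains b c :: "complex^'m" where "b \<in> traceless" "c \<in> traceless"
    "queer_bracket (odd_diag b) (odd_diag c) = 2 *\<^sub>C even_diag (axis k 1)"
proof -
  have "card (UNIV - {k}) \<ge> 2"
    using assms by simp
  then obtain l where l: "l \<noteq> k"
    by (metis Diff_iff card.empty ex_in_conv not_numeral_le_zero singletonI)
  have "card (UNIV - {k, l}) \<ge> 1"
    using assms l by (simp add: card_Diff_subset)
  then obtain p where p: "p \<noteq> k" "p \<noteq> l"
    by (metis Diff_iff card.empty ex_in_conv not_one_le_zero insert_iff)
  have "(\<chi> i. (axis k 1 - axis l 1 :: complex^'m) $ i * (axis k 1 - axis p 1) $ i) = axis k 1"
    using l p by (auto simp: vec_eq_iff axis_def)
  then show ?thesis
    using bracket_diag(4)[OF axis_diff_traceless axis_diff_traceless, of k l k p] that axis_diff_traceless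
    by metis
qed

section \<open>Tensor products with the Cartan subalgebra\<close>

lemma tensor_linear:
  "(x + y) \<otimes>\<^sub>C f = x \<otimes>\<^sub>C f + y \<otimes>\<^sub>C f" "x \<otimes>\<^sub>C (f + g) = x \<otimes>\<^sub>C f + x \<otimes>\<^sub>C g"
  "(c *\<^sub>C x) \<otimes>\<^sub>C f = c *\<^sub>C (x \<otimes>\<^sub>C f)" "x \<otimes>\<^sub>C (c *\<^sub>C f) = c *\<^sub>C (x \<otimes>\<^sub>C f)"
  by (transfer, unfold tensor_rel_def, rule complex_vector.span_base, unfold tensor_relations_def,
      simp add: diff_diff_eq[symmetric], blast)+

lemma linear_tensor: "linear_on UNIV (\<lambda>x. x \<otimes>\<^sub>C f)" "linear_on UNIV (\<lambda>f. x \<otimes>\<^sub>C f)"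
  by (simp_all add: linear_on_def tensor_linear)

lemma tensor_bracket_linear:
  "tensor_bracket t (u + v) = tensor_bracket t u + tensor_bracket t v"
  "tensor_bracket t (c *\<^sub>C u) = c *\<^sub>C tensor_bracket t u"
  "tensor_bracket (t + v) u = tensor_bracket t u + tensor_bracket v u"
  "tensor_bracket (c *\<^sub>C t) u = c *\<^sub>C tensor_bracket t u"
proof -
  show "tensor_bracket t (u + v) = tensor_bracket t u + tensor_bracket t v"
    by (transfer, rule tensor_rel_refl) (simp add: linear_ext_add linear_ext_fun_add)
  show "tensor_bracket t (c *\<^sub>C u) = c *\<^sub>C tensor_bracket t u"
    by (transfer, rule tensor_rel_refl) (simp add: linear_ext_scaleC linear_ext_fun_scaleC)
  show "tensor_bracket (t + v) u = tensor_bracket t u + tensor_bracket v u"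
    by (transfer, rule tensor_rel_refl) (simp add: linear_ext_add)
  show "tensor_bracket (c *\<^sub>C t) u = c *\<^sub>C tensor_bracket t u"
    by (transfer, rule tensor_rel_refl) (simp add: linear_ext_scaleC)
qed

lemma linear_tensor_bracket: "linear_on UNIV (tensor_bracket t)" "linear_on UNIV (\<lambda>t. tensor_bracket t u)"
  by (simp_all add: linear_on_def tensor_bracket_linear)

lemma linear_span_induct:
  assumes "linear_on UNIV f" "csubspace W" "\<And>x. x \<in> S \<Longrightarrow> f x \<in> W" "x \<in> cspan S"
  shows "f x \<in> W"
  using assms(4)
proof (induction rule: complex_vector.span_induct_alt)
  case base
  then show ?case
    using assms(1,2) by (simp add: linear_on_0 complex_vector.subspace_0)
next
  case (step c x y)
  then show ?case
    using assms(2,3) by (simp add: linear_onD[OF assms(1)] complex_vector.subspace_add complex_vector.subspace_scale)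
qed

lemma bilinear_span_induct:
  assumes "\<And>t. linear_on UNIV (f t)" "\<And>u. linear_on UNIV (\<lambda>t. f t u)" "csubspace W"
    "\<And>x y. x \<in> S \<Longrightarrow> y \<in> T \<Longrightarrow> f x y \<in> W" "x \<in> cspan S" "y \<in> cspan T"
  shows "f x y \<in> W"
proof (rule linear_span_induct[OF assms(2,3) _ assms(5)])
  show "f x y \<in> W" if "x \<in> S" for x
    by (rule linear_span_induct[OF assms(1,3) _ assms(6)]) (rule assms(4)[OF that])
qed

lemma tensor_space_base: "x \<in> S \<Longrightarrow> f \<in> I \<Longrightarrow> x \<otimes>\<^sub>C f \<in> tensor_space S I"
  unfolding tensor_space_def by (rule complex_vector.span_base) blast

lemma subspace_tensor_space: "csubspace (tensor_space S I)"
  unfolding tensor_space_def by (rule complex_vector.subspace_span)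

lemma tensor_space_mono: "S \<subseteq> S' \<Longrightarrow> I \<subseteq> I' \<Longrightarrow> tensor_space S I \<subseteq> tensor_space S' I'"
  unfolding tensor_space_def by (rule complex_vector.span_mono) blast

text \<open>The even part is central because diagonal matrices commute.\<close>

lemma tensor_bracket_even:
  assumes "t \<in> tensor_space (cartan 0) UNIV" "u \<in> tensor_space (cartan j) UNIV"
  shows "tensor_bracket t u = 0" "tensor_bracket u t = 0"
proof -
  have z: "0 \<otimes>\<^sub>C f = (0 :: ('a queer, 'b) tensor)" for f
    using linear_on_0[OF linear_tensor(1)] by simp
  have br: "queer_bracket x y = 0" "queer_bracket y x = 0" if "x \<in> cartan 0" "y \<in> cartan j" for x y :: "'a queer"
    using that by (cases j; auto simp: cartan_even cartan_odd bracket_diag)+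
  have "tensor_bracket t u \<in> {0}"
    using assms unfolding tensor_space_def
    by (rule bilinear_span_induct[OF linear_tensor_bracket, rotated 2]) (auto simp: tensor_bracket_pure br z)
  then show "tensor_bracket t u = 0"
    by simp
  have "tensor_bracket u t \<in> {0}"
    using assms(2,1) unfolding tensor_space_def
    by (rule bilinear_span_induct[OF linear_tensor_bracket, rotated 2]) (auto simp: tensor_bracket_pure br z)
  then show "tensor_bracket u t = 0"
    by simp
qed

lemma bracket_cartan_odd:
  assumes "x \<in> cartan 1" "y \<in> cartan 1"
  shows "queer_bracket x y \<in> cartan 0" "queer_bracket x y = queer_bracket y x"
proof -
  obtain b where b: "x = odd_diag b" "b \<in> traceless"
    using assms(1) unfolding cartan_odd by (rule imageE)
  obtain c where c: "y = odd_diag c" "c \<in> traceless"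
    using assms(2) unfolding cartan_odd by (rule imageE)
  note bc = b c
  show "queer_bracket x y \<in> cartan 0"
    using bc by (simp add: bracket_diag cartan_even flip: linear_onD(2)[OF linear_even_diag])
  show "queer_bracket x y = queer_bracket y x"
    using bc by (simp add: bracket_diag mult.commute)
qed

lemma tensor_bracket_odd:
  assumes "t \<in> tensor_space (cartan 1) I" "u \<in> tensor_space (cartan 1) UNIV"
    and "\<And>f g. f \<in> I \<Longrightarrow> f * g \<in> I"
  shows "tensor_bracket t u \<in> tensor_space (cartan 0) I"
  using assms(1,2) unfolding tensor_space_def[of "cartan 1"]
  by (rule bilinear_span_induct[OF linear_tensor_bracket subspace_tensor_space, rotated])
    (auto simp: tensor_bracket_pure assms(3) bracket_cartan_odd intro!: tensor_space_base)

lemma tensor_bracket_odd_commute: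
  assumes "t \<in> tensor_space (cartan 1) UNIV" "u \<in> tensor_space (cartan 1) UNIV"
  shows "tensor_bracket t u = tensor_bracket u t"
proof -
  have "tensor_bracket t u + (- 1) *\<^sub>C tensor_bracket u t \<in> {0}"
    using assms unfolding tensor_space_def
  proof (rule bilinear_span_induct[where f = "\<lambda>t u. tensor_bracket t u + (- 1) *\<^sub>C tensor_bracket u t", rotated 4])
    show "linear_on UNIV (\<lambda>u. tensor_bracket t u + (- 1) *\<^sub>C tensor_bracket u t)"
      and "linear_on UNIV (\<lambda>u. tensor_bracket u t + (- 1) *\<^sub>C tensor_bracket t u)" for t :: "('a queer, 'b) tensor"
      by (intro linear_on_add linear_on_scale linear_tensor_bracket)+
  qed (auto simp: tensor_bracket_pure bracket_cartan_odd(2) mult.commute)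
  then show ?thesis
    by simp
qed

text \<open>The projection onto the even part is needed to define an action on \<open>x\<^sub>0 + x\<^sub>1\<close> in terms of the two
  components: it shows that the sum of the even and odd parts is direct, and it supplies the
  components as linear functions of the sum.\<close>

lift_definition even_part :: "'m::finite queer \<Rightarrow> 'm queer" is "component 0"
proof -
  fix x y :: "'m bmat"
  assume "queer_rel x y"
  then obtain c where *: "x \<in> queer_tilde" "y \<in> queer_tilde" "x - y = c *\<^sub>C mat 1"
    unfolding queer_rel_def by blast
  have c: "component 0 (mat 1 :: 'm bmat) = mat 1"
    unfolding block_1 component_block by simp
  have mem: "component 0 z \<in> queer_tilde" if z: "z \<in> queer_tilde" for z :: "'m bmat"
  proof -
    obtain a b where "z = block a b b a"
      using z by (auto simp: queer_tilde_def)
    then show ?thesis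
      unfolding queer_tilde_def by (force simp: component_block trace_def)
  qed
  have "component 0 x = component 0 (y + c *\<^sub>C mat 1)"
    using *(3) by (metis add.commute diff_add_cancel)
  then have "component 0 x - component 0 y = c *\<^sub>C mat 1"
    by (simp add: component_add component_scaleC c)
  with * mem show "queer_rel (component 0 x) (component 0 y)"
    by (auto simp: queer_rel_def)
qed

lemma even_part_linear: "even_part (x + y) = even_part x + even_part y" "even_part (c *\<^sub>C x) = c *\<^sub>C even_part x"
  by (transfer; simp add: component_add component_scaleC queer_rel_refl_iff queer_tilde_closed;
      auto simp: queer_tilde_def component_block block_add block_scaleC trace_def; force simp: trace_def)+

lemma even_part_diag:
  "even_part (even_diag a) = even_diag a" "b \<in> traceless \<Longrightarrow> even_part (odd_diag b) = 0"
  by (simp_all add: even_diag_def odd_diag_def even_part.abs_eq queer_rel_refl even_diag_queer_tilde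
      odd_diag_queer_tilde component_block zero_queer_def flip: block_0)

lift_definition even_proj :: "('m::finite queer, 'a::complex_vector) tensor \<Rightarrow> ('m queer, 'a) tensor"
  is "linear_ext (\<lambda>k. pure_free (even_part (fst k)) (snd k))"
proof -
  fix p q :: "('m queer \<times> 'a) \<Rightarrow>\<^sub>0 complex"
  assume "tensor_rel p q"
  then have "linear_ext (\<lambda>k. pure_free (even_part (fst k)) (snd k)) (p - q) \<in> cspan tensor_relations"
    unfolding tensor_rel_def
    by (rule linear_ext_relations; simp add: even_part_linear;
        intro complex_vector.span_base; unfold tensor_relations_def; blast)
  then show "tensor_rel (linear_ext (\<lambda>k. pure_free (even_part (fst k)) (snd k)) p)
      (linear_ext (\<lambda>k. pure_free (even_part (fst k)) (snd k)) q)"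
    by (simp add: tensor_rel_def linear_ext_diff)
qed

lemma linear_even_proj:
  "linear_on UNIV (even_proj :: ('m::finite queer, 'a::complex_vector) tensor \<Rightarrow> _)"
proof -
  have "even_proj (t + u) = even_proj t + even_proj u" for t u :: "('m queer, 'a) tensor"
    by (transfer, rule tensor_rel_refl) (simp add: linear_ext_add)
  moreover have "even_proj (c *\<^sub>C t) = c *\<^sub>C even_proj t" for c and t :: "('m queer, 'a) tensor"
    by (transfer, rule tensor_rel_refl) (simp add: linear_ext_scaleC)
  ultimately show ?thesis
    by (simp add: linear_on_def)
qed

lemma even_proj_pure: "even_proj (x \<otimes>\<^sub>C f) = even_part x \<otimes>\<^sub>C f"
  by transfer (simp add: linear_ext_pure equivp_reflp[OF equivp_tensor_rel])

lemma even_proj_even: 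
  assumes "t \<in> tensor_space (cartan 0) UNIV"
  shows "even_proj t = t"
proof -
  have "even_proj t + (- 1) *\<^sub>C t \<in> {0}"
    using assms unfolding tensor_space_def
    by (rule linear_span_induct[OF linear_on_add[OF linear_even_proj linear_on_scale[OF linear_on_id]], rotated 2])
      (auto simp: even_proj_pure cartan_even even_part_diag)
  then show ?thesis
    by simp
qed

lemma even_proj_odd: 
  assumes "t \<in> tensor_space (cartan 1) UNIV"
  shows "even_proj t = 0"
proof -
  have z: "0 \<otimes>\<^sub>C f = (0 :: ('a queer, 'b) tensor)" for f
    using linear_on_0[OF linear_tensor(1)] by simp
  have "even_proj t \<in> {0}"
    using assms unfolding tensor_space_def
    by (rule linear_span_induct[OF linear_even_proj, rotated 2])
      (auto simp: even_proj_pure cartan_odd even_part_diag z)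
  then show ?thesis
    by simp
qed

section \<open>Modules over the Cartan current algebra\<close>

abbreviation cartan_part :: "bit \<Rightarrow> ('m::finite queer, 'a::complex_comm_algebra) tensor set"
  where "cartan_part j \<equiv> tensor_space (cartan j) UNIV"

lemma part_cartan_tensor: "part cartan_tensor j = cartan_part j" "bracket cartan_tensor = tensor_bracket"
  by (simp_all add: cartan_tensor_def)

lemma lspace_cartan_tensor: "lspace cartan_tensor = {x + y | x y. x \<in> cartan_part 0 \<and> y \<in> cartan_part 1}"
  by (simp add: lspace_def part_cartan_tensor)

lemma lspaceE:
  assumes "x \<in> lspace cartan_tensor"
  obtains x0 x1 where "x = x0 + x1" "x0 \<in> cartan_part 0" "x1 \<in> cartan_part 1"
  using assms unfolding lspace_cartan_tensor by blast

lemma cartan_part_lspace: "x \<in> cartan_part j \<Longrightarrow> x \<in> lspace cartan_tensor"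
  unfolding lspace_cartan_tensor
  using complex_vector.subspace_0[OF subspace_tensor_space]
  by (cases j) (force intro: exI[of _ x] exI[of _ 0])+

lemma subspace_lspace: "csubspace (lspace cartan_tensor)"
  unfolding lspace_cartan_tensor by (intro complex_vector.subspace_sums subspace_tensor_space)

lemma bit_not_zero: "j \<noteq> 0 \<longleftrightarrow> j = (1::bit)"
  by (cases j) auto

text \<open>The operator that is \<open>1\<close> on the even and \<open>- 1\<close> on the odd part of a module.\<close>

definition parity :: "('g, 'v::complex_vector) supermodule \<Rightarrow> 'v \<Rightarrow> 'v"
  where "parity M v = (THE w. \<exists>a\<in>mpart M 0. \<exists>b\<in>mpart M 1. v = a + b \<and> w = a - b)"

locale cartan_rep =
  fixes M :: "(('m::finite queer, 'a::complex_comm_algebra) tensor, 'v::complex_vector) supermodule"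
  assumes module: "is_module cartan_tensor M"
begin

abbreviation V :: "'v set"
  where "V \<equiv> mspace M"

lemma subspace_mpart: "csubspace (mpart M j)"
  using module by (cases j) (auto simp: is_module_def)

lemma mpart_disjoint: "v \<in> mpart M 0 \<Longrightarrow> v \<in> mpart M 1 \<Longrightarrow> v = 0"
  using module by (auto simp: is_module_def)

lemma subspace_V: "csubspace V"
  unfolding mspace_def
  using complex_vector.subspace_sums[OF subspace_mpart[of 0] subspace_mpart[of 1]] by simp

lemma mpart_V: "v \<in> mpart M j \<Longrightarrow> v \<in> V"
  unfolding mspace_def
  using complex_vector.subspace_0[OF subspace_mpart]
  by (cases j) (force intro: exI[of _ v] exI[of _ 0])+

lemma V_E:
  assumes "v \<in> V"
  obtains a b where "v = a + b" "a \<in> mpart M 0" "b \<in> mpart M 1"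
  using assms unfolding mspace_def by blast

lemma decomposition_unique:
  assumes "a + b = a' + b'" "a \<in> mpart M 0" "a' \<in> mpart M 0" "b \<in> mpart M 1" "b' \<in> mpart M 1"
  shows "a = a'" "b = b'"
proof -
  have eq: "a - a' = b' - b"
    using assms(1) by (simp add: algebra_simps)
  moreover have "a - a' \<in> mpart M 0" "b' - b \<in> mpart M 1"
    using assms complex_vector.subspace_diff[OF subspace_mpart] by auto
  ultimately have "a - a' = 0"
    using mpart_disjoint by metis
  with eq show "a = a'" "b = b'"
    by auto
qed

lemma linear_act: "x \<in> lspace cartan_tensor \<Longrightarrow> linear_on V (act M x)"
  and linear_act_left: "v \<in> V \<Longrightarrow> linear_on (lspace cartan_tensor) (\<lambda>x. act M x v)"
  and act_mpart: "x \<in> cartan_part i \<Longrightarrow> v \<in> mpart M j \<Longrightarrow> act M x v \<in> mpart M (i + j)"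
  and act_bracket: "x \<in> cartan_part i \<Longrightarrow> y \<in> cartan_part j \<Longrightarrow> v \<in> V \<Longrightarrow>
    act M (tensor_bracket x y) v = act M x (act M y v) - parity_sign i j *\<^sub>C act M y (act M x v)"
  using module unfolding is_module_def part_cartan_tensor by blast+

lemma act_V_part:
  assumes x: "x \<in> cartan_part i" and v: "v \<in> V"
  shows "act M x v \<in> V"
proof -
  obtain a b where ab: "v = a + b" "a \<in> mpart M 0" "b \<in> mpart M 1"
    using v by (rule V_E)
  then show ?thesis
    using mpart_V[OF act_mpart[OF x ab(2)]] mpart_V[OF act_mpart[OF x ab(3)]]
      linear_onD(1)[OF linear_act[OF cartan_part_lspace[OF x]]]
    by (simp add: mpart_V complex_vector.subspace_add[OF subspace_V])
qed

lemma act_V: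
  assumes "x \<in> lspace cartan_tensor" and v: "v \<in> V"
  shows "act M x v \<in> V"
proof -
  obtain x0 x1 where "x = x0 + x1" "x0 \<in> cartan_part 0" "x1 \<in> cartan_part 1"
    using assms(1) by (rule lspaceE)
  then show ?thesis
    using act_V_part v linear_onD(1)[OF linear_act_left[OF v]]
    by (simp add: cartan_part_lspace complex_vector.subspace_add[OF subspace_V])
qed

lemma act_0: "v \<in> V \<Longrightarrow> act M 0 v = 0"
  using linear_on_0[OF linear_act_left subspace_lspace] .

lemma act_even_commute:
  assumes "x \<in> cartan_part 0" "y \<in> cartan_part j" "v \<in> V"
  shows "act M x (act M y v) = act M y (act M x v)"
  using act_bracket[OF assms] tensor_bracket_even(1)[OF assms(1,2)] act_0[OF assms(3)]
  by (simp add: parity_sign_def scaleC_one)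

lemma parity_add: "a \<in> mpart M 0 \<Longrightarrow> b \<in> mpart M 1 \<Longrightarrow> parity M (a + b) = a - b"
  unfolding parity_def by (rule the_equality) (auto dest: decomposition_unique)

lemma parity_V: "v \<in> V \<Longrightarrow> parity M v \<in> V"
  by (elim V_E) (simp add: parity_add mpart_V complex_vector.subspace_diff[OF subspace_V])

lemma linear_parity: "linear_on V (parity M)"
proof -
  have "parity M (v + w) = parity M v + parity M w" if vV: "v \<in> V" and wV: "w \<in> V" for v w
  proof -
    obtain a b where v: "v = a + b" "a \<in> mpart M 0" "b \<in> mpart M 1"
      using vV by (rule V_E)
    obtain a' b' where w: "w = a' + b'" "a' \<in> mpart M 0" "b' \<in> mpart M 1"
      using wV by (rule V_E)
    have "parity M (v + w) = parity M ((a + a') + (b + b'))"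
      by (simp add: v w algebra_simps)
    also have "\<dots> = (a + a') - (b + b')"
      using v w by (intro parity_add complex_vector.subspace_add[OF subspace_mpart])
    finally show ?thesis
      using v w by (simp add: parity_add)
  qed
  moreover have "parity M (c *\<^sub>C v) = c *\<^sub>C parity M v" if vV: "v \<in> V" for c v
  proof -
    obtain a b where v: "v = a + b" "a \<in> mpart M 0" "b \<in> mpart M 1"
      using vV by (rule V_E)
    then show ?thesis
      by (simp add: scaleC_add_right parity_add complex_vector.subspace_scale[OF subspace_mpart]
          complex_vector.scale_right_diff_distrib)
  qed
  ultimately show ?thesis
    by (simp add: linear_on_def)
qed

lemma parity_parity: "v \<in> V \<Longrightarrow> parity M (parity M v) = v"
proof (elim V_E)
  fix a b
  assume v: "v = a + b" "a \<in> mpart M 0" "b \<in> mpart M 1"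
  then show "parity M (parity M v) = v"
    using parity_add[of a "- b"] complex_vector.subspace_neg[OF subspace_mpart v(3)]
    by (simp add: parity_add)
qed

lemma parity_act_odd:
  assumes x: "x \<in> cartan_part 1" and "v \<in> V"
  shows "parity M (act M x v) = - act M x (parity M v)"
proof -
  obtain a b where v: "v = a + b" "a \<in> mpart M 0" "b \<in> mpart M 1"
    using assms(2) by (rule V_E)
  have ab: "act M x a \<in> mpart M 1" "act M x b \<in> mpart M 0"
    using act_mpart[OF x v(2)] act_mpart[OF x v(3)] by simp_all
  have lin: "linear_on V (act M x)"
    using x by (intro linear_act cartan_part_lspace)
  have "act M x v = act M x b + act M x a"
    using v by (simp add: linear_onD(1)[OF lin] mpart_V add.commute)
  moreover have "act M x (parity M v) = act M x a - act M x b"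
    using v by (simp add: parity_add linear_on_diff[OF lin subspace_V] mpart_V)
  ultimately show ?thesis
    using ab by (simp add: parity_add)
qed

lemma graded_if_parity_invariant:
  assumes W: "csubspace W" "W \<subseteq> V" "\<And>w. w \<in> W \<Longrightarrow> parity M w \<in> W"
  shows "W = {v + w | v w. v \<in> W \<inter> mpart M 0 \<and> w \<in> W \<inter> mpart M 1}"
proof
  show "{v + w | v w. v \<in> W \<inter> mpart M 0 \<and> w \<in> W \<inter> mpart M 1} \<subseteq> W"
    using complex_vector.subspace_add[OF W(1)] by blast
  show "W \<subseteq> {v + w | v w. v \<in> W \<inter> mpart M 0 \<and> w \<in> W \<inter> mpart M 1}"
  proof
    fix w
    assume w: "w \<in> W"
    then obtain a b where ab: "w = a + b" "a \<in> mpart M 0" "b \<in> mpart M 1"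
      using W(2) V_E by blast
    have "parity M w = a - b"
      using ab by (simp add: parity_add)
    then have "(1/2) *\<^sub>C (w + parity M w) = a" "(1/2) *\<^sub>C (w - parity M w) = b"
      using half_double[of a] half_double[of b] by (simp_all add: ab(1))
    moreover have "(1/2) *\<^sub>C (w + parity M w) \<in> W" "(1/2) *\<^sub>C (w - parity M w) \<in> W"
      using w W(3) complex_vector.subspace_add[OF W(1)] complex_vector.subspace_diff[OF W(1)]
        complex_vector.subspace_scale[OF W(1)] by blast+
    ultimately show "w \<in> {v + w | v w. v \<in> W \<inter> mpart M 0 \<and> w \<in> W \<inter> mpart M 1}"
      using ab by auto
  qed
qed

text \<open>A form of Schur's lemma for a homogeneous \<open>x\<close>: the eigenspace for \<open>c\<close> is a graded subspace if \<open>x\<close> is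
  even, and also if \<open>x\<close> is odd and \<open>c = 0\<close>. The latter case covers odd elements that act
  nilpotently.\<close>

lemma irreducible_scalar:
  assumes irr: "irreducible_module cartan_tensor M" and x: "x \<in> cartan_part i" and ic: "i = 0 \<or> c = 0"
    and comm: "\<And>y j v. y \<in> cartan_part j \<Longrightarrow> v \<in> V \<Longrightarrow> act M x v = c *\<^sub>C v \<Longrightarrow>
      act M x (act M y v) = c *\<^sub>C act M y v"
    and ex: "w \<in> V" "w \<noteq> 0" "act M x w = c *\<^sub>C w" and v: "v \<in> V"
  shows "act M x v = c *\<^sub>C v"
proof -
  let ?W = "{v \<in> V. act M x v = c *\<^sub>C v}"
  have lin: "linear_on V (act M x)"
    using x by (intro linear_act cartan_part_lspace)
  have sub: "csubspace ?W"
    using subspace_V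
    by (auto intro!: complex_vector.subspaceI simp: linear_onD[OF lin] linear_on_0[OF lin subspace_V]
        complex_vector.subspace_0 complex_vector.subspace_add complex_vector.subspace_scale
        scaleC_add_right scaleC_scaleC mult.commute)
  have "graded_submodule cartan_tensor M ?W"
    unfolding graded_submodule_def
  proof (intro conjI ballI sub)
    show "?W = {v + w | v w. v \<in> ?W \<inter> mpart M 0 \<and> w \<in> ?W \<inter> mpart M 1}"
    proof (rule graded_if_parity_invariant[OF sub])
      fix w
      assume w: "w \<in> ?W"
      then obtain a b where ab: "w = a + b" "a \<in> mpart M 0" "b \<in> mpart M 1"
        using V_E by blast
      have eq: "act M x a + act M x b = c *\<^sub>C a + c *\<^sub>C b"
        using w ab by (simp add: linear_onD(1)[OF lin] mpart_V scaleC_add_right)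
      have "act M x a = c *\<^sub>C a \<and> act M x b = c *\<^sub>C b"
      proof (cases "i = 0")
        case True
        then have "act M x a \<in> mpart M 0" "act M x b \<in> mpart M 1"
          using act_mpart[OF x] ab by force+
        then show ?thesis
          using decomposition_unique[OF eq] ab complex_vector.subspace_scale[OF subspace_mpart] by blast
      next
        case False
        then have "act M x a \<in> mpart M 1" "act M x b \<in> mpart M 0"
          using act_mpart[OF x] ab unfolding bit_not_zero by force+
        then have "act M x b = 0" "act M x a = 0"
          using decomposition_unique[of "act M x b" "act M x a" 0 0] eq False ic
            complex_vector.subspace_0[OF subspace_mpart] by (auto simp: add.commute)
        then show ?thesis
          using False ic by simp
      qed
      then show "parity M w \<in> ?W"
        using ab by (simp add: parity_add linear_on_diff[OF lin subspace_V] mpart_V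
            complex_vector.scale_right_diff_distrib complex_vector.subspace_diff[OF subspace_V])
    qed blast
    fix y :: "('m queer, 'a) tensor" and w
    assume y: "y \<in> lspace cartan_tensor" and w: "w \<in> ?W"
    obtain y0 y1 where y01: "y = y0 + y1" "y0 \<in> cartan_part 0" "y1 \<in> cartan_part 1"
      using y by (rule lspaceE)
    have "act M y0 w \<in> ?W" "act M y1 w \<in> ?W"
      using w comm[OF y01(2), of w] comm[OF y01(3), of w] act_V_part[OF y01(2)] act_V_part[OF y01(3)] by auto
    then have "act M y0 w + act M y1 w \<in> ?W"
      by (rule complex_vector.subspace_add[OF sub])
    then show "act M y w \<in> ?W"
      using w y01 linear_onD(1)[OF linear_act_left] cartan_part_lspace by (metis (mono_tags, lifting) mem_Collect_eq)
  qed
  then have "?W = {0} \<or> ?W = V"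
    using irr unfolding irreducible_module_def by blast
  moreover have "w \<in> ?W"
    using ex by blast
  ultimately have "?W = V"
    using ex(2) by blast
  then show ?thesis
    using v by blast
qed

text \<open>An eigenvector is found in a nonzero homogeneous part of the module, which \<open>x\<close> preserves; its
  eigenspace is a submodule because \<open>x\<close> is central.\<close>

lemma even_acts_by_scalar:
  assumes "irreducible_fd_module cartan_tensor M" "x \<in> cartan_part 0"
  obtains c where "\<And>v. v \<in> V \<Longrightarrow> act M x v = c *\<^sub>C v"
proof -
  have irr: "irreducible_module cartan_tensor M"
    using assms(1) by (simp add: irreducible_fd_module_def)
  obtain B where B: "finite B" "V = cspan B"
    using assms(1) by (auto simp: irreducible_fd_module_def finite_dimensional_module_def)
  have "\<exists>j. mpart M j \<noteq> {0}"
    using irr unfolding irreducible_module_def mspace_def by force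
  then obtain j where j: "mpart M j \<noteq> {0}"
    by blast
  have sub: "mpart M j \<subseteq> V"
    using mpart_V by blast
  have "linear_on (mpart M j) (act M x)"
    using linear_act[OF cartan_part_lspace[OF assms(2)]] sub by (rule linear_on_subset)
  moreover have "act M x v \<in> mpart M j" if "v \<in> mpart M j" for v
    using act_mpart[OF assms(2) that] by (simp only: add_0)
  ultimately obtain c w where w: "w \<in> mpart M j" "w \<noteq> 0" "act M x w = c *\<^sub>C w"
    using eigenvector_exists[OF subspace_mpart _ B(1) j] sub B(2) by metis
  have "act M x v = c *\<^sub>C v" if "v \<in> V" for v
  proof (rule irreducible_scalar[OF irr assms(2) _ _ mpart_V[OF w(1)] w(2,3) that])
    fix y :: "('m queer, 'a) tensor" and k v
    assume "y \<in> cartan_part k" "v \<in> V" "act M x v = c *\<^sub>C v"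
    then show "act M x (act M y v) = c *\<^sub>C act M y v"
      using act_even_commute[OF assms(2)] linear_onD(2)[OF linear_act[OF cartan_part_lspace]] by metis
  qed simp
  then show ?thesis
    by (rule that)
qed

end

definition weight_form ::
    "(('m::finite queer, 'a::complex_comm_algebra) tensor \<Rightarrow> complex) \<Rightarrow>
      ('m queer, 'a) tensor \<Rightarrow> ('m queer, 'a) tensor \<Rightarrow> complex"
  where "weight_form \<psi> x y = \<psi> (tensor_bracket x y)"

lemma tensor_bracket_odd_UNIV:
  "x \<in> cartan_part 1 \<Longrightarrow> y \<in> cartan_part 1 \<Longrightarrow> tensor_bracket x y \<in> cartan_part 0"
  using tensor_bracket_odd[of x UNIV y] by simp

lemma linear_weight_form:
  assumes "linear_on (cartan_part 0) \<psi>" "x \<in> cartan_part 1"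
  shows "linear_on (cartan_part 1) (weight_form \<psi> x)"
  unfolding weight_form_def[abs_def]
  using linear_on_subset[OF linear_tensor_bracket(1) subset_UNIV] assms(1)
  by (rule linear_on_compose) (rule tensor_bracket_odd_UNIV[OF assms(2)])

lemma weight_form_commute:
  "x \<in> cartan_part 1 \<Longrightarrow> y \<in> cartan_part 1 \<Longrightarrow> weight_form \<psi> x y = weight_form \<psi> y x"
  unfolding weight_form_def using tensor_bracket_odd_commute[of x y] by simp

text \<open>An orthonormal basis of the odd part modulo the radical of \<open>weight_form \<psi>\<close>, with the expansion of
  every odd element.\<close>

definition clifford_frame ::
    "(('m::finite queer, 'a::complex_comm_algebra) tensor \<Rightarrow> complex) \<Rightarrow> nat \<Rightarrow>
      (nat \<Rightarrow> ('m queer, 'a) tensor) \<Rightarrow> bool"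
  where "clifford_frame \<psi> r e \<longleftrightarrow>
    (\<forall>i<r. e i \<in> cartan_part 1) \<and>
    (\<forall>i<r. \<forall>j<r. weight_form \<psi> (e i) (e j) = (if i = j then 2 else 0)) \<and>
    (\<forall>x\<in>cartan_part 1. x - (\<Sum>i<r. (weight_form \<psi> (e i) x / 2) *\<^sub>C e i) \<in>
      radical_on (cartan_part 1) (weight_form \<psi>))"

text \<open>The quotient of \<open>h\<^sub>1 \<otimes> A\<close> by \<open>h\<^sub>1 \<otimes> I\<close> is finite-dimensional, since both \<open>h\<^sub>1\<close> and \<open>A/I\<close> are.\<close>

lemma cartan_part_mod_ideal_finite:
  assumes "finite_codimension (I :: 'a::complex_comm_algebra set)"
  obtains F where "finite F" "F \<subseteq> (cartan_part 1 :: ('m::finite queer, 'a) tensor set)"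
    "\<And>x. x \<in> cartan_part 1 \<Longrightarrow> \<exists>a\<in>cspan F. x - a \<in> tensor_space (cartan 1) I"
proof -
  obtain D :: "'m queer set" where D: "finite D" "D \<subseteq> cartan 1" "cartan 1 \<subseteq> cspan D"
    by (rule cartan_odd_finite_span)
  obtain G where G: "finite G" "cspan (I \<union> G) = (UNIV :: 'a set)"
    using assms by (auto simp: finite_codimension_def)
  let ?F = "(\<lambda>(d, f). d \<otimes>\<^sub>C f) ` (D \<times> G)"
  let ?S = "{x + y | x y. x \<in> cspan ?F \<and> y \<in> tensor_space (cartan 1) I}"
  have sub: "csubspace ?S"
    by (intro complex_vector.subspace_sums complex_vector.subspace_span subspace_tensor_space)
  have d: "d \<otimes>\<^sub>C f \<in> ?S" if "d \<in> D" for d and f :: 'a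
  proof (rule linear_span_induct[OF linear_tensor(2) sub])
    show "d \<otimes>\<^sub>C f \<in> ?S" if "f \<in> I \<union> G" for f
    proof (cases "f \<in> I")
      case True
      then have "d \<otimes>\<^sub>C f \<in> tensor_space (cartan 1) I"
        using D(2) \<open>d \<in> D\<close> by (blast intro: tensor_space_base)
      then show ?thesis
        using complex_vector.span_zero by force
    next
      case False
      then have "d \<otimes>\<^sub>C f \<in> cspan ?F"
        using that \<open>d \<in> D\<close> by (intro complex_vector.span_base) auto
      then show ?thesis
        using complex_vector.subspace_0[OF subspace_tensor_space] by force
    qed
    show "f \<in> cspan (I \<union> G)"
      using G(2) by simp
  qed
  have "x \<otimes>\<^sub>C f \<in> ?S" if "x \<in> cartan 1" for x and f :: 'a
    using linear_span_induct[OF linear_tensor(1) sub d] D(3) that by blast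
  then have "cartan_part 1 \<subseteq> ?S"
    unfolding tensor_space_def[of "cartan 1" UNIV] by (intro complex_vector.span_minimal sub) blast
  then have "\<exists>a\<in>cspan ?F. x - a \<in> tensor_space (cartan 1) I" if "x \<in> cartan_part 1" for x
    using that by force
  moreover have "?F \<subseteq> cartan_part 1"
    using D(2) by (auto intro!: tensor_space_base)
  ultimately show ?thesis
    using D(1) G(1) by (intro that[of ?F]) auto
qed

text \<open>Brackets of \<open>h\<^sub>1 \<otimes> I\<close> with \<open>h\<^sub>1 \<otimes> A\<close> lie in \<open>h\<^sub>0 \<otimes> I\<close>, where \<open>\<psi>\<close> vanishes; so \<open>h\<^sub>1 \<otimes> I\<close> is contained
  in the radical, which leaves a finite-dimensional quotient.\<close>

lemma clifford_frame_exists: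
  assumes "\<psi> \<in> (cartan_functionals :: (('m::finite queer, 'a::complex_comm_algebra) tensor \<Rightarrow> complex) set)"
  obtains r e where "clifford_frame \<psi> r e"
proof -
  obtain I where lin: "linear_on (cartan_part 0) \<psi>" and I: "algebra_ideal I" "finite_codimension I"
    "\<And>t. t \<in> tensor_space (cartan 0) I \<Longrightarrow> \<psi> t = 0"
    using assms by (auto simp: cartan_functionals_def)
  obtain F where F: "finite F" "F \<subseteq> (cartan_part 1 :: ('m queer, 'a) tensor set)"
    "\<And>x. x \<in> cartan_part 1 \<Longrightarrow> \<exists>a\<in>cspan F. x - a \<in> tensor_space (cartan 1) I"
    using cartan_part_mod_ideal_finite[OF I(2)] by metis
  have rad: "tensor_space (cartan 1) I \<subseteq> radical_on (cartan_part 1) (weight_form \<psi>)"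
  proof
    fix x :: "('m queer, 'a) tensor"
    assume x: "x \<in> tensor_space (cartan 1) I"
    have "f * g \<in> I" if "f \<in> I" for f g
      using I(1) that by (metis algebra_ideal_def mult.commute)
    then have "weight_form \<psi> x y = 0" if "y \<in> cartan_part 1" for y
      unfolding weight_form_def using tensor_bracket_odd[OF x that] I(3) by blast
    moreover have "x \<in> cartan_part 1"
      using x tensor_space_mono[of "cartan 1" "cartan 1" I UNIV] by blast
    ultimately show "x \<in> radical_on (cartan_part 1) (weight_form \<psi>)"
      by (simp add: radical_on_def)
  qed
  have span: "\<exists>a\<in>cspan F. x - a \<in> radical_on (cartan_part 1) (weight_form \<psi>)" if "x \<in> cartan_part 1" for x
    using F(3)[OF that] rad by blast
  show ?thesis
  proof (rule orthonormal_basis_mod_radical[OF subspace_tensor_space linear_weight_form[OF lin]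
        weight_form_commute F(1,2) span])
    fix r :: nat and e
    assume "\<And>i. i < r \<Longrightarrow> e i \<in> cartan_part 1"
      "\<And>i j. i < r \<Longrightarrow> j < r \<Longrightarrow> weight_form \<psi> (e i) (e j) = (if i = j then 2 else 0)"
      "\<And>x. x \<in> cartan_part 1 \<Longrightarrow> x - (\<Sum>i<r. (weight_form \<psi> (e i) x / 2) *\<^sub>C e i) \<in>
        radical_on (cartan_part 1) (weight_form \<psi>)"
    then show thesis
      by (intro that[of r e]) (simp add: clifford_frame_def)
  qed
qed

locale weight_rep = cartan_rep M
  for M :: "(('m::finite queer, 'a::complex_comm_algebra) tensor, 'v::complex_vector) supermodule" +
  fixes \<psi> :: "('m queer, 'a) tensor \<Rightarrow> complex"
  assumes irreducible: "irreducible_module cartan_tensor M" and weight: "has_weight M \<psi>"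
begin

lemma act_even: "x \<in> cartan_part 0 \<Longrightarrow> v \<in> V \<Longrightarrow> act M x v = \<psi> x *\<^sub>C v"
  using weight by (simp add: has_weight_def)

lemma act_odd_anticommutator:
  assumes "x \<in> cartan_part 1" "y \<in> cartan_part 1" "v \<in> V"
  shows "act M x (act M y v) + act M y (act M x v) = weight_form \<psi> x y *\<^sub>C v"
  using act_bracket[OF assms] act_even[OF tensor_bracket_odd_UNIV[OF assms(1,2)] assms(3)]
  by (simp add: parity_sign_def weight_form_def)

text \<open>A radical element \<open>x\<close> anticommutes with all odd operators and squares to zero. Its kernel is thus a
  nonzero graded submodule.\<close>

lemma act_radical:
  assumes x: "x \<in> radical_on (cartan_part 1) (weight_form \<psi>)" and v: "v \<in> V"
  shows "act M x v = 0"
proof -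
  have x1: "x \<in> cartan_part 1" and rad: "\<And>y. y \<in> cartan_part 1 \<Longrightarrow> weight_form \<psi> x y = 0"
    using x by (auto simp: radical_on_def)
  have lin: "linear_on V (act M y)" if "y \<in> cartan_part j" for y :: "('m queer, 'a) tensor" and j
    using that by (intro linear_act cartan_part_lspace)
  have anti: "act M x (act M y w) = - act M y (act M x w)" if "y \<in> cartan_part 1" "w \<in> V" for y w
    using act_odd_anticommutator[OF x1 that] rad[OF that(1)] by (simp add: eq_neg_iff_add_eq_0)
  have square: "act M x (act M x w) = 0" if "w \<in> V" for w
    using act_odd_anticommutator[OF x1 x1 that] rad[OF x1] half_double[of "act M x (act M x w)"] by simp
  obtain w where w: "w \<in> V" "w \<noteq> 0"
    using irreducible complex_vector.subspace_0[OF subspace_V] unfolding irreducible_module_def by blast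
  obtain u where u: "u \<in> V" "u \<noteq> 0" "act M x u = 0"
    using w square[OF w(1)] act_V_part[OF x1 w(1)] by metis
  have "act M x v = 0 *\<^sub>C v"
  proof (rule irreducible_scalar[OF irreducible x1 _ _ u(1,2) _ v])
    fix y :: "('m queer, 'a) tensor" and j w
    assume *: "y \<in> cartan_part j" "w \<in> V" "act M x w = 0 *\<^sub>C w"
    have y0: "act M y 0 = 0"
      using linear_on_0[OF lin[OF *(1)] subspace_V] .
    show "act M x (act M y w) = 0 *\<^sub>C act M y w"
    proof (cases "j = 0")
      case True
      then show ?thesis
        using * act_even_commute[of y x 1 w] x1 y0 by simp
    next
      case False
      then show ?thesis
        using * anti[of y w] y0 unfolding bit_not_zero by simp
    qed
  qed (use u(3) in auto)
  then show ?thesis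
    by simp
qed

text \<open>The generators of the Clifford representation attached to the module: the frame, followed by the parity
  operator in position \<open>r\<close>.\<close>

definition clifford_op :: "nat \<Rightarrow> (nat \<Rightarrow> ('m queer, 'a) tensor) \<Rightarrow> nat \<Rightarrow> 'v \<Rightarrow> 'v"
  where "clifford_op r e i = (if i < r then act M (e i) else parity M)"

lemma act_clifford_frame:
  assumes frame: "clifford_frame \<psi> r e" and x: "x0 \<in> cartan_part 0" "x1 \<in> cartan_part 1" and v: "v \<in> V"
  shows "act M (x0 + x1) v = \<psi> x0 *\<^sub>C v + (\<Sum>i<r. (weight_form \<psi> (e i) x1 / 2) *\<^sub>C clifford_op r e i v)"
proof -
  let ?y = "\<Sum>i<r. (weight_form \<psi> (e i) x1 / 2) *\<^sub>C e i"
  have e: "e i \<in> cartan_part 1" if "i < r" for i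
    using frame that by (simp add: clifford_frame_def)
  have rad: "x1 - ?y \<in> radical_on (cartan_part 1) (weight_form \<psi>)"
    using frame x by (simp add: clifford_frame_def)
  note lin = linear_act_left[OF v]
  have L: "x0 \<in> lspace cartan_tensor" "x1 \<in> lspace cartan_tensor" "x1 - ?y \<in> lspace cartan_tensor"
    "\<And>i. i < r \<Longrightarrow> e i \<in> lspace cartan_tensor"
    using x e rad by (auto simp: radical_on_def intro: cartan_part_lspace)
  have y: "?y \<in> lspace cartan_tensor"
    using L(4) by (intro complex_vector.subspace_sum complex_vector.subspace_scale subspace_lspace) auto
  have "act M (x0 + x1) v = act M x0 v + act M x1 v"
    using L by (simp add: linear_onD(1)[OF lin])
  also have "act M x1 v = act M ((x1 - ?y) + ?y) v"
    by simp
  also have "\<dots> = act M (x1 - ?y) v + act M ?y v"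
    using L(3) y by (rule linear_onD(1)[OF lin])
  also have "act M (x1 - ?y) v = 0"
    using rad v by (rule act_radical)
  also have "act M ?y v = (\<Sum>i<r. (weight_form \<psi> (e i) x1 / 2) *\<^sub>C clifford_op r e i v)"
    using L(4) by (subst linear_on_lincomb[OF lin subspace_lspace]) (auto simp: clifford_op_def)
  also have "act M x0 v = \<psi> x0 *\<^sub>C v"
    using x(1) v by (rule act_even)
  finally show ?thesis
    by simp
qed

text \<open>Invariance under the parity operator makes a subspace graded, and invariance under the frame makes it a
  submodule, because even elements act by scalars and radical elements by zero.\<close>

lemma clifford_op_irreducible:
  assumes frame: "clifford_frame \<psi> r e"
  shows "irreducible_clifford_rep (Suc r) V (clifford_op r e)"
proof -
  have e: "e i \<in> cartan_part 1" if "i < r" for i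
    using frame that by (simp add: clifford_frame_def)
  have orth: "weight_form \<psi> (e i) (e j) = (if i = j then 2 else 0)" if "i < r" "j < r" for i j
    using frame that by (simp add: clifford_frame_def)
  have "clifford_rep (Suc r) V (clifford_op r e)"
  proof
    show "csubspace V"
      by (rule subspace_V)
    show "linear_on V (clifford_op r e i)" for i
      using e linear_parity by (auto simp: clifford_op_def intro!: linear_act cartan_part_lspace)
    show "clifford_op r e i v \<in> V" if "v \<in> V" for i v
      using that e by (auto simp: clifford_op_def parity_V intro: act_V_part)
    show "clifford_op r e i (clifford_op r e j v) + clifford_op r e j (clifford_op r e i v) =
        (if i = j then 2 else 0) *\<^sub>C v" if "i < Suc r" "j < Suc r" "v \<in> V" for i j v
      using that e act_odd_anticommutator[of "e i" "e j" v] orth[of i j] parity_act_odd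
      by (auto simp: clifford_op_def less_Suc_eq parity_parity double_scaleC)
  qed
  moreover have "W = {0} \<or> W = V"
    if W: "csubspace W" "W \<subseteq> V" "\<forall>i<Suc r. \<forall>w\<in>W. clifford_op r e i w \<in> W" for W
  proof -
    have "graded_submodule cartan_tensor M W"
      unfolding graded_submodule_def
    proof (intro conjI ballI W(1))
      show "W = {v + w | v w. v \<in> W \<inter> mpart M 0 \<and> w \<in> W \<inter> mpart M 1}"
        using W(1,2)
      proof (rule graded_if_parity_invariant)
        show "parity M w \<in> W" if "w \<in> W" for w
          using W(3) that by (auto simp: clifford_op_def)
      qed
      fix x :: "('m queer, 'a) tensor" and w
      assume x: "x \<in> lspace cartan_tensor" and w: "w \<in> W"
      obtain x0 x1 where x: "x = x0 + x1" "x0 \<in> cartan_part 0" "x1 \<in> cartan_part 1"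
        using x by (rule lspaceE)
      show "act M x w \<in> W"
        unfolding x(1) using W(2,3) w
        by (subst act_clifford_frame[OF frame x(2,3)])
          (auto intro!: complex_vector.subspace_add[OF W(1)] complex_vector.subspace_sum[OF W(1)]
            complex_vector.subspace_scale[OF W(1)])
    qed
    then show ?thesis
      using irreducible unfolding irreducible_module_def by blast
  qed
  ultimately show ?thesis
    using irreducible unfolding irreducible_clifford_rep_def irreducible_module_def by blast
qed

end

text \<open>Uniqueness for Clifford representations gives a bijection that intertwines the frame. It need not
  respect the parity operator, which is the last generator, but it intertwines the action of all of
  \<open>h \<otimes> A\<close>, since that action is expressed through \<open>\<psi>\<close> and the frame alone.\<close>

theorem weight_module_unique:
  fixes M :: "(('m::finite queer, 'a::complex_comm_algebra) tensor, 'v::complex_vector) supermodule"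
    and N :: "(('m queer, 'a) tensor, 'w::complex_vector) supermodule"
  assumes "\<psi> \<in> cartan_functionals"
    and "irreducible_fd_module cartan_tensor M" "has_weight M \<psi>"
    and "irreducible_fd_module cartan_tensor N" "has_weight N \<psi>"
  shows "isomorphic_modules cartan_tensor M N"
proof -
  interpret M: weight_rep M \<psi>
    using assms by unfold_locales (auto simp: irreducible_fd_module_def irreducible_module_def)
  interpret N: weight_rep N \<psi>
    using assms by unfold_locales (auto simp: irreducible_fd_module_def irreducible_module_def)
  obtain r e where frame: "clifford_frame \<psi> r e"
    using assms(1) by (rule clifford_frame_exists)
  obtain f where f: "linear_on M.V f" "bij_betw f M.V N.V"
    "\<And>i v. Suc i < Suc r \<Longrightarrow> v \<in> M.V \<Longrightarrow> f (M.clifford_op r e i v) = N.clifford_op r e i (f v)"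
    using irreducible_clifford_rep_unique[OF M.clifford_op_irreducible[OF frame]
        N.clifford_op_irreducible[OF frame]] by blast
  have "f (act M x v) = act N x (f v)" if xL: "x \<in> lspace cartan_tensor" and vV: "v \<in> M.V" for x v
  proof -
    obtain x0 x1 where x: "x = x0 + x1" "x0 \<in> cartan_part 0" "x1 \<in> cartan_part 1"
      using xL by (rule lspaceE)
    let ?c = "\<lambda>i. weight_form \<psi> (e i) x1 / 2"
    have "clifford_rep (Suc r) M.V (M.clifford_op r e)"
      using M.clifford_op_irreducible[OF frame] by (simp add: irreducible_clifford_rep_def)
    then have op: "M.clifford_op r e i v \<in> M.V" if "i \<in> {..<r}" for i
      using clifford_rep.closed[of "Suc r" M.V "M.clifford_op r e" i v] vV that by simp
    have fv: "f v \<in> N.V"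
      using f(2) vV by (auto simp: bij_betw_def)
    have "f (act M x v) = f (\<psi> x0 *\<^sub>C v + (\<Sum>i<r. ?c i *\<^sub>C M.clifford_op r e i v))"
      unfolding x(1) M.act_clifford_frame[OF frame x(2,3) vV] ..
    also have "\<dots> = f (\<psi> x0 *\<^sub>C v) + f (\<Sum>i<r. ?c i *\<^sub>C M.clifford_op r e i v)"
      using vV op by (intro linear_onD(1)[OF f(1)] lincomb_mem complex_vector.subspace_scale M.subspace_V)
    also have "\<dots> = \<psi> x0 *\<^sub>C f v + (\<Sum>i<r. ?c i *\<^sub>C f (M.clifford_op r e i v))"
      by (simp only: linear_onD(2)[OF f(1) vV] linear_on_lincomb[OF f(1) M.subspace_V, of "{..<r}"] op)
    also have "\<dots> = \<psi> x0 *\<^sub>C f v + (\<Sum>i<r. ?c i *\<^sub>C N.clifford_op r e i (f v))"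
      using f(3) vV by simp
    also have "\<dots> = act N x (f v)"
      unfolding x(1) N.act_clifford_frame[OF frame x(2,3) fv] ..
    finally show ?thesis .
  qed
  with f(1,2) show ?thesis
    unfolding isomorphic_modules_def by blast
qed

section \<open>Modules built from Clifford representations\<close>

text \<open>The module built from a representation of \<open>r + 1\<close> Clifford generators: the eigenspaces of the last
  generator \<open>\<gamma>\<^sub>r\<close> form the grading, and an odd element acts through its coordinates in the frame.\<close>

definition clifford_module ::
    "(('m::finite queer, 'a::complex_comm_algebra) tensor \<Rightarrow> complex) \<Rightarrow> nat \<Rightarrow>
      (nat \<Rightarrow> ('m queer, 'a) tensor) \<Rightarrow> 'v::complex_vector set \<Rightarrow> (nat \<Rightarrow> 'v \<Rightarrow> 'v) \<Rightarrow>
      (('m queer, 'a) tensor, 'v) supermodule"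
  where "clifford_module \<psi> r e V \<gamma> =
    \<lparr>mpart = (\<lambda>j. {v \<in> V. \<gamma> r v = (if j = 0 then v else - v)}),
     act = (\<lambda>x v. \<psi> (even_proj x) *\<^sub>C v +
       (\<Sum>i<r. (weight_form \<psi> (e i) (x - even_proj x) / 2) *\<^sub>C \<gamma> i v))\<rparr>"

locale framed_clifford_rep = clifford_rep "Suc r" V \<gamma>
  for r V and \<gamma> :: "nat \<Rightarrow> 'v::complex_vector \<Rightarrow> 'v" +
  fixes \<psi> :: "('m::finite queer, 'a::complex_comm_algebra) tensor \<Rightarrow> complex"
    and e :: "nat \<Rightarrow> ('m queer, 'a) tensor"
  assumes linear_\<psi>: "linear_on (cartan_part 0) \<psi>" and frame: "clifford_frame \<psi> r e"
begin

abbreviation H :: "(('m queer, 'a) tensor, 'v) supermodule"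
  where "H \<equiv> clifford_module \<psi> r e V \<gamma>"

abbreviation coord :: "('m queer, 'a) tensor \<Rightarrow> nat \<Rightarrow> complex"
  where "coord x i \<equiv> weight_form \<psi> (e i) x / 2"

lemma e_odd: "i < r \<Longrightarrow> e i \<in> cartan_part 1"
  using frame by (simp add: clifford_frame_def)

lemma gamma_linear: "i < r \<Longrightarrow> linear_on V (\<gamma> i)" and gamma_closed: "i < r \<Longrightarrow> v \<in> V \<Longrightarrow> \<gamma> i v \<in> V"
  using linear closed by auto

lemma mpart_H: "v \<in> mpart H j \<longleftrightarrow> v \<in> V \<and> \<gamma> r v = (if j = 0 then v else - v)"
  by (simp add: clifford_module_def)

lemma mspace_H: "mspace H = V"
proof
  show "mspace H \<subseteq> V"
    using complex_vector.subspace_add[OF subspace] by (auto simp: mspace_def clifford_module_def)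
  show "V \<subseteq> mspace H"
  proof
    fix v
    assume v: "v \<in> V"
    let ?a = "(1/2) *\<^sub>C (v + \<gamma> r v)" and ?b = "(1/2) *\<^sub>C (v - \<gamma> r v)"
    note mem = complex_vector.subspace_add[OF subspace] complex_vector.subspace_diff[OF subspace]
      complex_vector.subspace_scale[OF subspace] closed[of r] v
    have "\<gamma> r ?a = ?a" "\<gamma> r ?b = - ?b"
      using v square[of r v]
      by (simp_all add: linear_onD[OF linear] linear_on_diff[OF linear subspace] mem add.commute
          flip: complex_vector.scale_minus_right)
    moreover have "v = ?a + ?b"
      using half_double[of v] by (simp flip: scaleC_add_right)
    moreover have "?a \<in> V" "?b \<in> V"
      by (simp_all add: mem)
    ultimately show "v \<in> mspace H"
      unfolding mspace_def clifford_module_def by fastforce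
  qed
qed

lemma act_even: "x \<in> cartan_part 0 \<Longrightarrow> act H x v = \<psi> x *\<^sub>C v"
  using linear_on_0[OF linear_weight_form[OF linear_\<psi> e_odd] subspace_tensor_space]
  by (simp add: clifford_module_def even_proj_even)

lemma act_odd: "x \<in> cartan_part 1 \<Longrightarrow> act H x v = (\<Sum>i<r. coord x i *\<^sub>C \<gamma> i v)"
  using linear_on_0[OF linear_\<psi> subspace_tensor_space]
  by (simp add: clifford_module_def even_proj_odd)

lemma act_frame: "i < r \<Longrightarrow> act H (e i) v = \<gamma> i v"
proof -
  assume i: "i < r"
  have "act H (e i) v = (\<Sum>j<r. if j = i then \<gamma> j v else 0)"
    unfolding act_odd[OF e_odd[OF i]] using frame i
    by (intro sum.cong) (auto simp: clifford_frame_def scaleC_one)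
  then show ?thesis
    using i by simp
qed

lemma even_proj_lspace:
  assumes "x \<in> lspace cartan_tensor"
  shows "even_proj x \<in> cartan_part 0" "x - even_proj x \<in> cartan_part 1"
proof -
  obtain x0 x1 where "x = x0 + x1" "x0 \<in> cartan_part 0" "x1 \<in> cartan_part 1"
    using assms by (rule lspaceE)
  then show "even_proj x \<in> cartan_part 0" "x - even_proj x \<in> cartan_part 1"
    by (simp_all add: linear_onD[OF linear_even_proj] even_proj_even even_proj_odd)
qed

lemma linear_act: "linear_on V (act H x)"
  unfolding clifford_module_def
  by (auto intro!: linear_on_add linear_on_scale linear_on_id linear_on_sum_fun gamma_linear)

lemma linear_act_left: "linear_on (lspace cartan_tensor) (\<lambda>x. act H x v)"
proof -
  have proj: "linear_on (lspace cartan_tensor) (even_proj :: ('m queer, 'a) tensor \<Rightarrow> _)"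
    using linear_even_proj by (rule linear_on_subset) simp
  have "linear_on (lspace cartan_tensor) (\<lambda>x :: ('m queer, 'a) tensor. x + (- 1) *\<^sub>C even_proj x)"
    by (intro linear_on_add linear_on_id linear_on_scale proj)
  then have odd: "linear_on (lspace cartan_tensor) (\<lambda>x :: ('m queer, 'a) tensor. x - even_proj x)"
    by simp
  have "linear_on (lspace cartan_tensor) (\<lambda>x. (1/2) *\<^sub>C weight_form \<psi> (e i) (x - even_proj x))" if "i < r" for i
    by (intro linear_on_scale linear_on_compose[OF odd linear_weight_form[OF linear_\<psi> e_odd[OF that]]]
        even_proj_lspace(2))
  then have "linear_on (lspace cartan_tensor) (\<lambda>x. coord (x - even_proj x) i)" if "i < r" for i
    using that by (simp add: scaleC_complex_def)
  then show ?thesis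
    unfolding clifford_module_def
    by (auto intro!: linear_on_add linear_on_sum_fun linear_on_scaleC_left
        linear_on_compose[OF proj linear_\<psi>] even_proj_lspace(1))
qed

lemma act_mpart:
  assumes x: "x \<in> cartan_part i" and v: "v \<in> mpart H j"
  shows "act H x v \<in> mpart H (i + j)"
proof -
  have vV: "v \<in> V" and \<gamma>v: "\<gamma> r v = (if j = 0 then v else - v)"
    using v by (auto simp: clifford_module_def)
  show ?thesis
  proof (cases "i = 0")
    case True
    then have "act H x v = \<psi> x *\<^sub>C v"
      using x by (simp add: act_even)
    then show ?thesis
      using True vV \<gamma>v linear_onD(2)[OF linear[of r] vV]
      by (simp add: clifford_module_def complex_vector.subspace_scale[OF subspace])
  next
    case False
    then have i: "i = 1"
      by (simp add: bit_not_zero)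
    then have act: "act H x v = (\<Sum>k<r. coord x k *\<^sub>C \<gamma> k v)"
      using x by (simp add: act_odd)
    have mem: "coord x k *\<^sub>C \<gamma> k v \<in> V" if "k < r" for k
      using that vV by (intro complex_vector.subspace_scale[OF subspace] gamma_closed)
    have "\<gamma> r (act H x v) = (\<Sum>k<r. coord x k *\<^sub>C \<gamma> r (\<gamma> k v))"
      unfolding act using vV gamma_closed by (intro linear_on_lincomb[OF linear subspace]) auto
    also have "\<dots> = (\<Sum>k<r. - (coord x k *\<^sub>C \<gamma> k (\<gamma> r v)))"
      using anticommute[of r _ v] vV by (intro sum.cong) auto
    also have "\<dots> = (if j = 0 then - act H x v else act H x v)"
      unfolding act \<gamma>v using vV gamma_minus by (simp add: sum_negf)
    finally have "\<gamma> r (act H x v) = (if i + j = 0 then act H x v else - act H x v)"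
      using i by (cases j) auto
    moreover have "act H x v \<in> V"
      unfolding act using mem by (intro complex_vector.subspace_sum[OF subspace]) auto
    ultimately show ?thesis
      by (simp only: mpart_H simp_thms)
  qed
qed

text \<open>Only the coordinates in the frame matter, since the rest of an odd element is radical.\<close>

lemma weight_form_coord:
  assumes x: "x \<in> cartan_part 1" and y: "y \<in> cartan_part 1"
  shows "weight_form \<psi> x y = (\<Sum>i<r. 2 * coord x i * coord y i)"
proof -
  let ?x = "\<Sum>i<r. coord x i *\<^sub>C e i"
  note lin = linear_weight_form[OF linear_\<psi> y]
  have x': "?x \<in> cartan_part 1"
    using e_odd by (intro complex_vector.subspace_sum complex_vector.subspace_scale subspace_tensor_space) auto
  have "x - ?x \<in> radical_on (cartan_part 1) (weight_form \<psi>)"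
    using frame x by (simp add: clifford_frame_def)
  then have "weight_form \<psi> y (x - ?x) = 0"
    using y weight_form_commute[of y "x - ?x" \<psi>] by (simp add: radical_on_def)
  then have "weight_form \<psi> y x = weight_form \<psi> y ?x"
    using linear_on_diff[OF lin subspace_tensor_space x x'] by simp
  also have "\<dots> = (\<Sum>i<r. coord x i * weight_form \<psi> y (e i))"
    using e_odd by (subst linear_on_lincomb[OF lin subspace_tensor_space]) (auto simp: scaleC_complex_def)
  also have "\<dots> = (\<Sum>i<r. 2 * coord x i * coord y i)"
    using weight_form_commute[OF y e_odd] by (intro sum.cong) auto
  finally show ?thesis
    using weight_form_commute[OF x y] by simp
qed

lemma act_odd_anticommutator:
  assumes x: "x \<in> cartan_part 1" and y: "y \<in> cartan_part 1" and v: "v \<in> V"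
  shows "act H x (act H y v) + act H y (act H x v) = weight_form \<psi> x y *\<^sub>C v"
proof -
  have comp: "act H x (act H y v) = (\<Sum>i<r. \<Sum>j<r. (coord x i * coord y j) *\<^sub>C \<gamma> i (\<gamma> j v))"
    if "x \<in> cartan_part 1" "y \<in> cartan_part 1" for x y
  proof -
    have "\<gamma> i (\<Sum>j<r. coord y j *\<^sub>C \<gamma> j v) = (\<Sum>j<r. coord y j *\<^sub>C \<gamma> i (\<gamma> j v))" if "i < r" for i
      using that v gamma_closed by (intro linear_on_lincomb[OF gamma_linear subspace]) auto
    then show ?thesis
      unfolding act_odd[OF that(1)] act_odd[OF that(2)]
      by (simp add: complex_vector.scale_sum_right scaleC_scaleC)
  qed
  have "act H y (act H x v) = (\<Sum>i<r. \<Sum>j<r. (coord x i * coord y j) *\<^sub>C \<gamma> j (\<gamma> i v))"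
    unfolding comp[OF y x] by (subst sum.swap) (simp add: mult.commute)
  then have "act H x (act H y v) + act H y (act H x v) =
      (\<Sum>i<r. \<Sum>j<r. (coord x i * coord y j) *\<^sub>C (\<gamma> i (\<gamma> j v) + \<gamma> j (\<gamma> i v)))"
    unfolding comp[OF x y] by (simp add: sum.distrib scaleC_add_right)
  also have "\<dots> = (\<Sum>i<r. \<Sum>j<r. if i = j then (2 * coord x i * coord y j) *\<^sub>C v else 0)"
    using anticommutator v by (intro sum.cong) (auto simp: scaleC_scaleC mult.commute)
  also have "\<dots> = weight_form \<psi> x y *\<^sub>C v"
    unfolding weight_form_coord[OF x y] by (simp add: complex_vector.scale_sum_left)
  finally show ?thesis .
qed

lemma is_module_H: "is_module cartan_tensor H"
  unfolding is_module_def mspace_H part_cartan_tensor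
proof (intro conjI allI ballI)
  have sub: "csubspace (mpart H j)" for j
    using subspace
    by (cases "j = 0") (auto intro!: complex_vector.subspaceI simp: clifford_module_def linear_onD[OF linear]
        gamma_0 complex_vector.subspace_0 complex_vector.subspace_add complex_vector.subspace_scale)
  show "csubspace (mpart H 0)" "csubspace (mpart H 1)"
    by (rule sub)+
  have "v = 0" if "v = - v" for v :: 'v
    using half_double[of v] that by (metis add.left_inverse complex_vector.scale_zero_right)
  then show "mpart H 0 \<inter> mpart H 1 = {0}"
    by (auto simp: mpart_H gamma_0 complex_vector.subspace_0[OF subspace])
  show "linear_on V (act H x)" for x
    by (rule linear_act)
  show "linear_on (lspace cartan_tensor) (\<lambda>x. act H x v)" for v
    by (rule linear_act_left)
  show "act H x v \<in> mpart H (i + j)" if "x \<in> cartan_part i" "v \<in> mpart H j" for x v i j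
    using that by (rule act_mpart)
  show "act H (tensor_bracket x y) v = act H x (act H y v) - parity_sign i j *\<^sub>C act H y (act H x v)"
    if x: "x \<in> cartan_part i" and y: "y \<in> cartan_part j" and v: "v \<in> V" for i j x y v
  proof (cases "i = 1 \<and> j = 1")
    case True
    then show ?thesis
      using x y v act_odd_anticommutator[of x y v] act_even[OF tensor_bracket_odd_UNIV[of x y]]
      by (simp add: parity_sign_def weight_form_def)
  next
    case False
    have zero: "act H 0 v = 0"
      using linear_on_0[OF linear_act_left subspace_lspace] .
    from False consider "i = 0" | "j = 0"
      using bit_not_zero by blast
    then have "tensor_bracket x y = 0 \<and> act H x (act H y v) = act H y (act H x v)"
    proof cases
      case 1
      then show ?thesis
        using x tensor_bracket_even(1)[OF _ y] act_even[of x] linear_onD(2)[OF linear_act v] by auto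
    next
      case 2
      then show ?thesis
        using y tensor_bracket_even(2)[OF _ x] act_even[of y] linear_onD(2)[OF linear_act v] by auto
    qed
    then show ?thesis
      using False zero by (auto simp: parity_sign_def scaleC_one)
  qed
qed

text \<open>A graded submodule is invariant under \<open>\<gamma>\<^sub>r\<close> because it is graded, and under the other generators
  because they are the actions of the frame elements.\<close>

lemma irreducible_H:
  assumes "irreducible_clifford_rep (Suc r) V \<gamma>"
  shows "irreducible_module cartan_tensor H"
  unfolding irreducible_module_def mspace_H
proof (intro conjI allI impI is_module_H)
  show "V \<noteq> {0}"
    using assms by (simp add: irreducible_clifford_rep_def)
  fix W
  assume W: "graded_submodule cartan_tensor H W"
  have sub: "csubspace W"
    using W by (simp add: graded_submodule_def)
  have dec: "\<exists>a b. w = a + b \<and> a \<in> W \<inter> mpart H 0 \<and> b \<in> W \<inter> mpart H 1" if "w \<in> W" for w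
    using W that unfolding graded_submodule_def by blast
  have "W \<subseteq> V"
    using dec complex_vector.subspace_add[OF subspace] by (fastforce simp: clifford_module_def)
  moreover have "\<gamma> i w \<in> W" if i: "i < Suc r" and w: "w \<in> W" for i w
  proof (cases "i < r")
    case True
    then have "act H (e i) w \<in> W"
      using W w cartan_part_lspace[OF e_odd[OF True]] unfolding graded_submodule_def by blast
    then show ?thesis
      using True by (simp add: act_frame)
  next
    case False
    obtain a b where ab: "w = a + b" "a \<in> W" "b \<in> W" "a \<in> mpart H 0" "b \<in> mpart H 1"
      using dec[OF w] by blast
    then have "\<gamma> r w = a - b"
      by (simp add: clifford_module_def linear_onD(1)[OF linear])
    then show ?thesis
      using False i ab complex_vector.subspace_diff[OF sub] by (simp add: less_Suc_eq)
  qed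
  ultimately show "W = {0} \<or> W = V"
    using assms sub unfolding irreducible_clifford_rep_def by blast
qed

end

theorem weight_module_exists:
  assumes "\<psi> \<in> (cartan_functionals :: (('m::finite queer, 'a::complex_comm_algebra) tensor \<Rightarrow> complex) set)"
  obtains H :: "('m::finite, 'a::complex_comm_algebra) cartan_module" where "irreducible_fd_module cartan_tensor H" "has_weight H \<psi>"
proof -
  obtain r e where frame: "clifford_frame \<psi> r e"
    using assms by (rule clifford_frame_exists)
  obtain V :: "(nat \<Rightarrow>\<^sub>0 complex) set" and \<gamma> B
    where V: "irreducible_clifford_rep (Suc r) V \<gamma>" "finite B" "V = cspan B"
    by (rule irreducible_clifford_rep_exists)
  interpret framed_clifford_rep r V \<gamma> \<psi> e
    using V(1) frame assms
    by (simp add: framed_clifford_rep_def framed_clifford_rep_axioms_def irreducible_clifford_rep_def cartan_functionals_def)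
  show ?thesis
  proof
    show "irreducible_fd_module cartan_tensor H"
      using irreducible_H[OF V(1)] V(2,3) mspace_H
      unfolding irreducible_fd_module_def finite_dimensional_module_def by blast
    show "has_weight H \<psi>"
      by (simp add: has_weight_def act_even)
  qed
qed

section \<open>The weight of an irreducible module\<close>

text \<open>The functional consists of the scalars by which the even elements act. The ideal is the largest one on
  which it vanishes. It contains every \<open>f\<close> such that \<open>h\<^sub>1 \<otimes> f\<close> acts by zero, because for \<open>x, y\<close> in \<open>h\<^sub>1\<close>
  the element \<open>[x, y] \<otimes> gf = [x \<otimes> g, y \<otimes> f]\<close> then acts by zero and such brackets \<open>[x, y]\<close> span \<open>h\<^sub>0\<close>.\<close>

lemma weight_exists:
  fixes M :: "(('m::finite queer, 'a::complex_comm_algebra) tensor, 'v::complex_vector) supermodule"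
  assumes card: "CARD('m) \<ge> 3" and M: "irreducible_fd_module cartan_tensor M"
  obtains \<psi> where "\<psi> \<in> cartan_functionals" "has_weight M \<psi>"
proof -
  interpret cartan_rep M
    using M by unfold_locales (simp add: irreducible_fd_module_def irreducible_module_def)
  obtain B where B: "finite B" "V = cspan B"
    using M by (auto simp: irreducible_fd_module_def finite_dimensional_module_def)
  obtain w where w: "w \<in> V" "w \<noteq> 0"
    using M complex_vector.subspace_0[OF subspace_V]
    unfolding irreducible_fd_module_def irreducible_module_def by blast
  have "\<exists>c. \<forall>v\<in>V. act M x v = c *\<^sub>C v" if "x \<in> cartan_part 0" for x
    using even_acts_by_scalar[OF M that] by metis
  then obtain \<phi> where \<phi>: "act M x v = \<phi> x *\<^sub>C v" if "x \<in> cartan_part 0" "v \<in> V" for x v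
    by metis
  define \<psi> where "\<psi> = restrict \<phi> (cartan_part 0)"
  have \<psi>: "act M x v = \<psi> x *\<^sub>C v" if "x \<in> cartan_part 0" "v \<in> V" for x v
    using \<phi> that by (simp add: \<psi>_def)
  have \<psi>_unique: "\<psi> x = c" if "x \<in> cartan_part 0" "act M x w = c *\<^sub>C w" for x c
    using \<psi>[OF that(1) w(1)] that(2) w(2) by simp
  note L = cartan_part_lspace[of _ 0]
  have lin: "linear_on (cartan_part 0) \<psi>"
    unfolding linear_on_def
  proof (intro conjI ballI allI)
    fix x y :: "('m queer, 'a) tensor" and c
    assume x: "x \<in> cartan_part 0"
    show "\<psi> (c *\<^sub>C x) = c *\<^sub>C \<psi> x"
      using x linear_onD(2)[OF linear_act_left[OF w(1)] L[OF x], of c] \<psi>[OF x w(1)]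
      by (intro \<psi>_unique) (simp_all add: complex_vector.subspace_scale[OF subspace_tensor_space]
          scaleC_scaleC scaleC_complex_def)
    assume y: "y \<in> cartan_part 0"
    show "\<psi> (x + y) = \<psi> x + \<psi> y"
      using x y linear_onD(1)[OF linear_act_left[OF w(1)] L[OF x] L[OF y]] \<psi>[OF x w(1)] \<psi>[OF y w(1)]
      by (intro \<psi>_unique) (simp_all add: complex_vector.subspace_add[OF subspace_tensor_space] scaleC_add_left)
  qed
  have pure: "x \<otimes>\<^sub>C f \<in> cartan_part j" if "x \<in> cartan j" for x j and f :: 'a
    using that by (intro tensor_space_base) auto
  define I where "I = {f. \<forall>g. \<forall>x\<in>cartan 0. \<psi> (x \<otimes>\<^sub>C (g * f)) = 0}"
  have ideal: "algebra_ideal I"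
    unfolding algebra_ideal_def
  proof (intro conjI ballI allI)
    have "x \<otimes>\<^sub>C (0::'a) = 0" for x :: "'m queer"
      using linear_on_0[OF linear_tensor(2)] by simp
    then show "0 \<in> I"
      using linear_on_0[OF lin subspace_tensor_space] by (simp add: I_def)
    show "f + g \<in> I" if "f \<in> I" "g \<in> I" for f g
      using that by (simp add: I_def distrib_left tensor_linear linear_onD(1)[OF lin] pure)
    show "g * f \<in> I" if "f \<in> I" for f g
      using that by (simp add: I_def flip: mult.assoc)
  qed
  obtain D :: "'m queer set" where D: "finite D" "D \<subseteq> cartan 1" "cartan 1 \<subseteq> cspan D"
    by (rule cartan_odd_finite_span)
  let ?K = "{f. \<forall>k\<in>D \<times> B. act M (fst k \<otimes>\<^sub>C f) (snd k) = 0}"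
  have BV: "b \<in> V" if "b \<in> B" for b
    using that B(2) complex_vector.span_base by blast
  have "finite_codimension ?K"
  proof (rule finite_codimension_kernel[where B = B and L = "\<lambda>k f. act M (fst k \<otimes>\<^sub>C f) (snd k)"])
    fix k
    assume k: "k \<in> D \<times> B"
    then have d: "fst k \<otimes>\<^sub>C f \<in> lspace cartan_tensor" for f :: 'a
      using D(2) by (auto intro!: cartan_part_lspace[of _ 1] pure)
    have b: "snd k \<in> V"
      using k BV by auto
    show "linear_on UNIV (\<lambda>f. act M (fst k \<otimes>\<^sub>C f) (snd k))"
      using linear_tensor(2) linear_act_left[OF b] d by (rule linear_on_compose)
    show "act M (fst k \<otimes>\<^sub>C f) (snd k) \<in> cspan B" for f
      using act_V[OF d b] B(2) by simp
  qed (use D(1) B(1) in auto)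
  moreover have "?K \<subseteq> I"
  proof
    fix f
    assume f: "f \<in> ?K"
    have D0: "act M (d \<otimes>\<^sub>C f) v = 0" if d: "d \<in> D" and v: "v \<in> V" for d v
    proof -
      have lin: "linear_on V (act M (d \<otimes>\<^sub>C f))"
        using d D(2) by (intro linear_act cartan_part_lspace[of _ 1] pure) auto
      have "csubspace {v \<in> V. act M (d \<otimes>\<^sub>C f) v = 0}"
        using subspace_V linear_on_0[OF lin subspace_V]
        by (auto intro!: complex_vector.subspaceI simp: linear_onD[OF lin] complex_vector.subspace_0
            complex_vector.subspace_add complex_vector.subspace_scale)
      moreover have "B \<subseteq> {v \<in> V. act M (d \<otimes>\<^sub>C f) v = 0}"
        using f d BV by auto
      ultimately show ?thesis
        using complex_vector.span_minimal v B(2) by blast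
    qed
    have odd0: "act M (x \<otimes>\<^sub>C f) v = 0" if x: "x \<in> cartan 1" and v: "v \<in> V" for x v
    proof -
      have "x \<otimes>\<^sub>C f \<in> {t \<in> lspace cartan_tensor. act M t v = 0}"
      proof (rule linear_span_induct[OF linear_tensor(1)])
        show "csubspace {t \<in> lspace cartan_tensor. act M t v = 0}"
          using act_0[OF v]
          by (auto intro!: complex_vector.subspaceI simp: linear_onD[OF linear_act_left[OF v]]
              complex_vector.subspace_0[OF subspace_lspace] complex_vector.subspace_add[OF subspace_lspace]
              complex_vector.subspace_scale[OF subspace_lspace])
        show "d \<otimes>\<^sub>C f \<in> {t \<in> lspace cartan_tensor. act M t v = 0}" if "d \<in> D" for d
          using D0[OF that v] D(2) that by (auto intro!: cartan_part_lspace[of _ 1] pure)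
        show "x \<in> cspan D"
          using x D(3) by blast
      qed
      then show ?thesis
        by simp
    qed
    have bracket0: "\<psi> (queer_bracket x y \<otimes>\<^sub>C (g * f)) = 0" if "x \<in> cartan 1" "y \<in> cartan 1" for x y g
    proof -
      note xy = pure[OF that(1), of g] pure[OF that(2), of f]
      have "act M (x \<otimes>\<^sub>C g) 0 = 0"
        using linear_on_0[OF linear_act[OF cartan_part_lspace[OF xy(1)]] subspace_V] .
      then have "act M (queer_bracket x y \<otimes>\<^sub>C (g * f)) w = 0 *\<^sub>C w"
        using act_bracket[OF xy w(1)] odd0[OF that(2) w(1)] odd0[OF that(2) act_V_part[OF xy(1) w(1)]]
        by (simp add: tensor_bracket_pure)
      then show ?thesis
        using bracket_cartan_odd(1)[OF that] by (intro \<psi>_unique pure)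
    qed
    have axis0: "\<psi> (even_diag (axis k 1) \<otimes>\<^sub>C (g * f)) = 0" for k g
    proof -
      obtain b c :: "complex^'m" where bc: "b \<in> traceless" "c \<in> traceless"
        "queer_bracket (odd_diag b) (odd_diag c) = 2 *\<^sub>C even_diag (axis k 1)"
        using even_diag_axis_bracket[OF card] by blast
      have "\<psi> (2 *\<^sub>C (even_diag (axis k 1) \<otimes>\<^sub>C (g * f))) = 0"
        using bracket0[of "odd_diag b" "odd_diag c" g] bc by (simp add: cartan_odd tensor_linear)
      then show ?thesis
        using linear_onD(2)[OF lin pure[of "even_diag (axis k 1)" 0 "g * f"], of 2]
        by (simp add: cartan_even scaleC_complex_def)
    qed
    have "\<psi> (even_diag a \<otimes>\<^sub>C (g * f)) = 0" for a g
    proof -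
      have "even_diag a \<otimes>\<^sub>C (g * f) = (\<Sum>k\<in>UNIV. a $ k *\<^sub>C (even_diag (axis k 1) \<otimes>\<^sub>C (g * f)))"
        by (subst even_diag_sum)
          (simp add: linear_on_sum[OF linear_tensor(1)] tensor_linear)
      also have "\<psi> \<dots> = (\<Sum>k\<in>UNIV. \<psi> (a $ k *\<^sub>C (even_diag (axis k 1) \<otimes>\<^sub>C (g * f))))"
        by (intro linear_on_sum[OF lin subspace_tensor_space] complex_vector.subspace_scale[OF subspace_tensor_space] pure)
          (simp add: cartan_even)
      also have "\<dots> = 0"
      proof (intro sum.neutral ballI)
        show "\<psi> (a $ k *\<^sub>C (even_diag (axis k 1) \<otimes>\<^sub>C (g * f))) = 0" for k
          using linear_onD(2)[OF lin pure[of "even_diag (axis k 1)" 0 "g * f"], of "a $ k"] axis0[of k g]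
          by (simp add: cartan_even)
      qed
      finally show ?thesis .
    qed
    then show "f \<in> I"
      by (auto simp: I_def cartan_even)
  qed
  ultimately have "finite_codimension I"
    by (rule finite_codimension_mono)
  moreover have "\<psi> t = 0" if "t \<in> tensor_space (cartan 0) I" for t
  proof -
    have "t \<in> {t \<in> cartan_part 0. \<psi> t = 0}"
      using that unfolding tensor_space_def[of "cartan 0" I]
    proof (rule linear_span_induct[OF linear_on_id, rotated 2])
      show "csubspace {t \<in> cartan_part 0. \<psi> t = 0}"
        using linear_on_0[OF lin subspace_tensor_space]
        by (auto intro!: complex_vector.subspaceI simp: linear_onD[OF lin]
            complex_vector.subspace_0[OF subspace_tensor_space] complex_vector.subspace_add[OF subspace_tensor_space]
            complex_vector.subspace_scale[OF subspace_tensor_space])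
      fix t :: "('m queer, 'a) tensor"
      assume "t \<in> {x \<otimes>\<^sub>C f | x f. x \<in> cartan 0 \<and> f \<in> I}"
      then obtain x f where t: "t = x \<otimes>\<^sub>C f" "x \<in> cartan 0" "f \<in> I"
        by blast
      then have "\<psi> (x \<otimes>\<^sub>C (1 * f)) = 0"
        unfolding I_def by blast
      with t show "t \<in> {t \<in> cartan_part 0. \<psi> t = 0}"
        by (simp add: pure)
    qed
    then show ?thesis
      by simp
  qed
  moreover have "\<psi> \<in> extensional (cartan_part 0)"
    by (simp add: \<psi>_def)
  ultimately have "\<psi> \<in> cartan_functionals"
    using lin ideal unfolding cartan_functionals_def by blast
  moreover have "has_weight M \<psi>"
    using \<psi> by (simp add: has_weight_def)
  ultimately show ?thesis
    by (rule that)
qed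

section \<open>The classification\<close>

lemma isomorphic_modules_refl: "isomorphic_modules g M M"
  unfolding isomorphic_modules_def by (intro exI[of _ "\<lambda>v. v"]) (simp add: linear_on_id bij_betw_def)

lemma isomorphic_modules_sym:
  fixes M :: "(('m::finite queer, 'a::complex_comm_algebra) tensor, 'v::complex_vector) supermodule"
    and N :: "(('m queer, 'a) tensor, 'w::complex_vector) supermodule"
  assumes "isomorphic_modules cartan_tensor M N" "is_module cartan_tensor M"
  shows "isomorphic_modules cartan_tensor N M"
proof -
  interpret cartan_rep M
    by unfold_locales (rule assms(2))
  obtain f where f: "linear_on V f" "bij_betw f V (mspace N)"
    "\<And>x v. x \<in> lspace cartan_tensor \<Longrightarrow> v \<in> V \<Longrightarrow> f (act M x v) = act N x (f v)"
    using assms(1) unfolding isomorphic_modules_def by blast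
  let ?g = "inv_into V f"
  have g: "?g w \<in> V" "f (?g w) = w" if "w \<in> mspace N" for w
    using that f(2) by (auto simp: bij_betw_def inv_into_into f_inv_into_f)
  have "?g (act N x w) = act M x (?g w)" if "x \<in> lspace cartan_tensor" "w \<in> mspace N" for x w
    using that g f(3)[OF that(1) g(1)[OF that(2)]] f(2) act_V[OF that(1) g(1)[OF that(2)]]
    by (metis bij_betw_inv_into_left)
  then show ?thesis
    unfolding isomorphic_modules_def
    using linear_on_inverse[OF f(1,2) subspace_V] bij_betw_inv_into[OF f(2)] by blast
qed

lemma isomorphic_modules_trans:
  assumes "isomorphic_modules g M N" "isomorphic_modules g N R"
  shows "isomorphic_modules g M R"
proof -
  obtain f where f: "linear_on (mspace M) f" "bij_betw f (mspace M) (mspace N)"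
    "\<And>x v. x \<in> lspace g \<Longrightarrow> v \<in> mspace M \<Longrightarrow> f (act M x v) = act N x (f v)"
    using assms(1) unfolding isomorphic_modules_def by blast
  obtain h where h: "linear_on (mspace N) h" "bij_betw h (mspace N) (mspace R)"
    "\<And>x v. x \<in> lspace g \<Longrightarrow> v \<in> mspace N \<Longrightarrow> h (act N x v) = act R x (h v)"
    using assms(2) unfolding isomorphic_modules_def by blast
  have fN: "f v \<in> mspace N" if "v \<in> mspace M" for v
    using f(2) that by (auto simp: bij_betw_def)
  have "linear_on (mspace M) (\<lambda>v. h (f v))"
    using f(1) h(1) fN by (rule linear_on_compose)
  moreover have "bij_betw (\<lambda>v. h (f v)) (mspace M) (mspace R)"
    using bij_betw_trans[OF f(2) h(2)] by (simp add: o_def)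
  ultimately show ?thesis
    unfolding isomorphic_modules_def using f(3) h(3) fN by (intro exI[of _ "\<lambda>v. h (f v)"]) simp
qed

lemma equiv_isomorphism_rel:
  "equiv {M. irreducible_fd_module cartan_tensor M} isomorphism_rel"
proof (rule equivI)
  show "isomorphism_rel \<subseteq> {M. irreducible_fd_module cartan_tensor M} \<times> {M. irreducible_fd_module cartan_tensor M}"
    by (auto simp: isomorphism_rel_def)
  show "refl_on {M. irreducible_fd_module cartan_tensor M} isomorphism_rel"
    by (auto simp: refl_on_def isomorphism_rel_def isomorphic_modules_refl)
  show "sym isomorphism_rel"
    by (auto simp: sym_def isomorphism_rel_def irreducible_fd_module_def irreducible_module_def
        intro: isomorphic_modules_sym)
  show "trans isomorphism_rel"
    by (auto simp: trans_def isomorphism_rel_def intro: isomorphic_modules_trans)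
qed

lemma has_weight_isomorphic:
  fixes M :: "(('m::finite queer, 'a::complex_comm_algebra) tensor, 'v::complex_vector) supermodule"
    and N :: "(('m queer, 'a) tensor, 'w::complex_vector) supermodule"
  assumes "isomorphic_modules cartan_tensor M N" "has_weight N \<psi>" "is_module cartan_tensor M"
  shows "has_weight M \<psi>"
  unfolding has_weight_def
proof (intro ballI)
  interpret cartan_rep M
    by unfold_locales (rule assms(3))
  obtain f where f: "linear_on V f" "bij_betw f V (mspace N)"
    "\<And>x v. x \<in> lspace cartan_tensor \<Longrightarrow> v \<in> V \<Longrightarrow> f (act M x v) = act N x (f v)"
    using assms(1) unfolding isomorphic_modules_def by blast
  fix x :: "('m queer, 'a) tensor" and v
  assume x: "x \<in> cartan_part 0" and v: "v \<in> V"
  have "f v \<in> mspace N"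
    using f(2) v by (auto simp: bij_betw_def)
  then have "f (act M x v) = f (\<psi> x *\<^sub>C v)"
    using x v assms(2) f(3)[OF cartan_part_lspace[OF x] v] linear_onD(2)[OF f(1) v]
    by (simp add: has_weight_def)
  then show "act M x v = \<psi> x *\<^sub>C v"
    using f(2) act_V_part[OF x v] complex_vector.subspace_scale[OF subspace_V v]
    by (auto simp: bij_betw_def inj_on_def)
qed

text \<open>Two functionals that are weights of the same nonzero module agree on \<open>h\<^sub>0 \<otimes> A\<close>, and extensionality
  takes care of the values elsewhere.\<close>

lemma weight_unique:
  assumes "irreducible_fd_module cartan_tensor M" "has_weight M \<psi>" "has_weight M \<phi>"
    and "\<psi> \<in> cartan_functionals" "\<phi> \<in> cartan_functionals"
  shows "\<psi> = \<phi>"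
proof (rule extensionalityI)
  show "\<psi> \<in> extensional (cartan_part 0)" "\<phi> \<in> extensional (cartan_part 0)"
    using assms(4,5) by (auto simp: cartan_functionals_def)
  interpret cartan_rep M
    using assms(1) by unfold_locales (simp add: irreducible_fd_module_def irreducible_module_def)
  obtain w where w: "w \<in> V" "w \<noteq> 0"
    using assms(1) complex_vector.subspace_0[OF subspace_V]
    unfolding irreducible_fd_module_def irreducible_module_def by blast
  show "\<psi> x = \<phi> x" if "x \<in> cartan_part 0" for x
    using assms(2,3) that w unfolding has_weight_def by (metis complex_vector.scale_right_imp_eq)
qed

lemma weight_module:
  assumes "\<psi> \<in> cartan_functionals"
  shows "irreducible_fd_module cartan_tensor (weight_module \<psi>)" "has_weight (weight_module \<psi>) \<psi>"
  using someI_ex[of "\<lambda>H. irreducible_fd_module cartan_tensor H \<and> has_weight H \<psi>"]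
    weight_module_exists[OF assms] unfolding weight_module_def by blast+

theorem theorem4p3:
  fixes n :: nat
  assumes "n \<ge> 2" and "CARD('m::finite) = n + 1"
  shows "(\<forall>\<psi> \<in> (cartan_functionals :: (('m queer, 'a::complex_comm_algebra) tensor \<Rightarrow> complex) set).
      (\<exists>H :: ('m, 'a) cartan_module. irreducible_fd_module cartan_tensor H \<and> has_weight H \<psi>) \<and>
      (\<forall>(M :: (('m queer, 'a) tensor, 'v::complex_vector) supermodule)
        (N :: (('m queer, 'a) tensor, 'w::complex_vector) supermodule).
        irreducible_fd_module cartan_tensor M \<and> has_weight M \<psi> \<and>
        irreducible_fd_module cartan_tensor N \<and> has_weight N \<psi> \<longrightarrow>
        isomorphic_modules cartan_tensor M N)) \<and>
    (\<forall>M :: (('m queer, 'a) tensor, 'v) supermodule. irreducible_fd_module cartan_tensor M \<longrightarrow>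
      (\<exists>\<psi>\<in>cartan_functionals. isomorphic_modules cartan_tensor M (weight_module \<psi>))) \<and>
    bij_betw (\<lambda>\<psi>. isomorphism_rel `` {weight_module \<psi>})
      (cartan_functionals :: (('m queer, 'a) tensor \<Rightarrow> complex) set) irreducible_classes"
proof -
  let ?L = "cartan_functionals :: (('m queer, 'a) tensor \<Rightarrow> complex) set"
  let ?c = "\<lambda>\<psi> :: ('m queer, 'a) tensor \<Rightarrow> complex. isomorphism_rel `` {weight_module \<psi>}"
  let ?A = "{M :: ('m, 'a) cartan_module. irreducible_fd_module cartan_tensor M}"
  have card: "CARD('m) \<ge> 3"
    using assms by simp
  have inj: "inj_on ?c ?L"
  proof (rule inj_onI)
    fix \<psi> \<phi> :: "('m queer, 'a) tensor \<Rightarrow> complex"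
    assume \<psi>: "\<psi> \<in> ?L" and \<phi>: "\<phi> \<in> ?L" and "?c \<psi> = ?c \<phi>"
    then have "(weight_module \<psi>, weight_module \<phi>) \<in> isomorphism_rel"
      using eq_equiv_class[OF _ equiv_isomorphism_rel] weight_module(1)[OF \<phi>] by blast
    then have iso: "isomorphic_modules cartan_tensor (weight_module \<psi>) (weight_module \<phi>)"
      by (simp add: isomorphism_rel_def)
    have "is_module cartan_tensor (weight_module \<psi>)"
      using weight_module(1)[OF \<psi>] by (simp add: irreducible_fd_module_def irreducible_module_def)
    then have "has_weight (weight_module \<psi>) \<phi>"
      by (rule has_weight_isomorphic[OF iso weight_module(2)[OF \<phi>]])
    then show "\<psi> = \<phi>"
      using weight_unique[OF weight_module(1)[OF \<psi>] weight_module(2)[OF \<psi>] _ \<psi> \<phi>] by blast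
  qed
  have surj: "?c ` ?L = irreducible_classes"
  proof
    show "?c ` ?L \<subseteq> irreducible_classes"
      unfolding irreducible_classes_def using weight_module(1) by (auto intro: quotientI)
    show "irreducible_classes \<subseteq> ?c ` ?L"
    proof
      fix X :: "('m, 'a) cartan_module set"
      assume "X \<in> irreducible_classes"
      then obtain M where M: "X = isomorphism_rel `` {M}" "irreducible_fd_module cartan_tensor M"
        unfolding irreducible_classes_def by (auto elim: quotientE)
      obtain \<psi> where \<psi>: "\<psi> \<in> ?L" "has_weight M \<psi>"
        using weight_exists[OF card M(2)] by blast
      have "(M, weight_module \<psi>) \<in> isomorphism_rel"
        using weight_module_unique[OF \<psi>(1) M(2) \<psi>(2) weight_module[OF \<psi>(1)]] M(2) weight_module(1)[OF \<psi>(1)]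
        by (simp add: isomorphism_rel_def)
      then show "X \<in> ?c ` ?L"
        using \<psi>(1) M(1) equiv_class_eq[OF equiv_isomorphism_rel] by blast
    qed
  qed
  show ?thesis
  proof (intro conjI ballI allI impI)
    fix \<psi> :: "('m queer, 'a) tensor \<Rightarrow> complex"
    assume \<psi>: "\<psi> \<in> ?L"
    show "\<exists>H :: ('m, 'a) cartan_module. irreducible_fd_module cartan_tensor H \<and> has_weight H \<psi>"
      using weight_module[OF \<psi>] by blast
    fix M :: "(('m queer, 'a) tensor, 'v) supermodule" and N :: "(('m queer, 'a) tensor, 'w) supermodule"
    assume "irreducible_fd_module cartan_tensor M \<and> has_weight M \<psi> \<and>
      irreducible_fd_module cartan_tensor N \<and> has_weight N \<psi>"
    then show "isomorphic_modules cartan_tensor M N"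
      using weight_module_unique[OF \<psi>] by blast
  next
    fix M :: "(('m queer, 'a) tensor, 'v) supermodule"
    assume M: "irreducible_fd_module cartan_tensor M"
    obtain \<psi> where \<psi>: "\<psi> \<in> ?L" "has_weight M \<psi>"
      using weight_exists[OF card M] by blast
    then show "\<exists>\<psi>\<in>cartan_functionals. isomorphic_modules cartan_tensor M (weight_module \<psi>)"
      using weight_module_unique[OF \<psi>(1) M \<psi>(2) weight_module[OF \<psi>(1)]] by blast
  next
    show "bij_betw ?c ?L irreducible_classes"
      unfolding bij_betw_def using inj surj by blast
  qed
qed

end
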